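(* Let $Q,N\in\mathbb{N}$, $M\in\mathbb{Z}$, and let $a_{M+1},\dots,a_{M+N}$ be complex numbers. Then for every $\epsilon>0$, \[ \sum_{\substack{q\le Q\\ q\ \text{prime}}}\frac{q}{\varphi(q)}\sum_{\xi\in G_1(q)}\Bigl|\sum_{n=M+1}^{M+N}a_n\,\xi(n)\Bigr|^2\ll_{\epsilon} Q^{\epsilon}\left(NQ^{1/2}+N^{1/4}Q^{2}+N^{3/4}Q^{11/8}\right)\sum_{n=M+1}^{M+N}|a_n|^2, \] where the implied constant depends only on $\epsilon$.
   Context: $e(x)=\exp(2\pi i x)$ and $\varphi$ is Euler's function. For a positive integer $q$, $G_1(q)$ denotes the set of Dirichlet characters $\xi$ modulo $q^2$ such that $\xi(x)=e\!\left(\frac{x-1}{q^2}\right)$ for every integer $x\equiv 1\pmod q$ (there are exactly $\varphi(q)$ such characters). Dirichlet characters modulo $q^2$ vanish on integers not coprime to $q$. *)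

theory Defs
  imports "HOL-Analysis.Analysis" "HOL-Number_Theory.Number_Theory"
begin

definition e :: "real \<Rightarrow> complex" where
  "e x = exp (2 * of_real pi * \<i> * of_real x)"

definition dirichlet_char :: "int \<Rightarrow> (int \<Rightarrow> complex) \<Rightarrow> bool" where
  "dirichlet_char m chi \<longleftrightarrow>
     (\<forall>a b. chi (a * b) = chi a * chi b) \<and>
     (\<forall>a. chi (a + m) = chi a) \<and>
     (\<forall>a. \<not> coprime a m \<longrightarrow> chi a = 0) \<and>
     (\<forall>a. coprime a m \<longrightarrow> chi a \<noteq> 0) \<and>
     chi 1 = 1"

definition G1 :: "nat \<Rightarrow> (int \<Rightarrow> complex) set" where
  "G1 q = {chi. dirichlet_char (int q ^ 2) chi \<and>
              (\<forall>x::int. [x = 1] (mod int q) \<longrightarrow> chi x = e (real_of_int (x - 1) / real (q ^ 2)))}"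

end

theory Submission
  imports Defs
begin

text \<open>
  For a prime \<open>q\<close> the restriction of any \<open>\<xi>\<close> in \<open>G1 q\<close> to a residue class \<open>b\<close> modulo \<open>q\<close> is a constant times
  the additive character \<open>k \<mapsto> e(k b\<^sup>* / q)\<close> of \<open>n = b + q k\<close>, where \<open>b\<^sup>*\<close> inverts \<open>b\<close> modulo \<open>q\<close>. By duality and
  the triangle inequality the theorem reduces to bounding \<open>\<Sum> F n * cnj (G n)\<close> over an interval of
  length \<open>N\<close>, for \<open>F\<close> and \<open>G\<close> in the spans of \<open>G1 q\<close> and \<open>G1 p\<close>, where \<open>p\<close> and \<open>q\<close> are distinct primes of size
  about \<open>P\<close>.

  If \<open>N \<ge> P\<^sup>3\<close>, split into classes modulo \<open>p q\<close>: the resulting geometric sums have distinct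
  frequencies modulo \<open>p q\<close>, and Cauchy--Schwarz suffices. If \<open>P \<le> N \<le> P\<^sup>3\<close>, apply Cauchy--Schwarz over the
  classes modulo \<open>p\<close>, open the square, write the two variables as \<open>m + p r\<close> and \<open>m = b + q k\<close>, and sum over
  \<open>k\<close>: this is an incomplete Kloosterman sum modulo \<open>p\<close> with coefficient \<open>r\<close> and a linear phase depending
  on \<open>r\<close>. Differencing in \<open>k\<close> removes that phase; orthogonality in \<open>r\<close> and the fact that a quadratic
  congruence has at most two roots then save a quarter power of \<open>P\<close> on average, which replaces
  Weil's bound. Incomplete ranges of \<open>k\<close> are completed at the cost of a logarithm, and when \<open>N > P\<^sup>2\<close> the
  full periods of \<open>k\<close> contribute a Dirichlet kernel whose frequencies are distinct as \<open>r\<close> varies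
  modulo \<open>q\<close>.
\<close>

text \<open>For N below p q a class modulo p q holds at most one integer of the interval, so
  splitting into these classes leaves nothing to cancel. Cauchy--Schwarz modulo p removes G, but the
  values of F on the residues modulo q stay arbitrary. The form in these values that remains is
  treated by a Schur test: the symmetry of its kernel reduces it to row sums. Hence the residue b is
  fixed, only the shift r is averaged, and the bound has to be uniform in b.

  Let X be the pair bound: the squared sum is at most X times the square norms of F and G. The
  weight q/phi(q) turns the square norm of F divided by q into a plain coefficient norm, and with
  this normalisation the pairs of primes cost P^2 sqrt(X). Up to logarithms, X is N^2/P^3 for N >=
  P^3, which gives N P^(1/2); it is ((N/P)^3 P^(1/2))^(1/2) for P <= N <= P^3, which gives N^(3/4)
  P^(11/8); and it is constant for N <= P, which gives P^2.\<close>

section \<open>Additive characters and geometric sums\<close>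

lemma e_add: "e (x + y) = e x * e y"
  by (simp add: e_def distrib_left exp_add)

lemma e_0 [simp]: "e 0 = 1"
  by (simp add: e_def)

lemma cnj_e: "cnj (e x) = e (- x)"
  by (simp add: e_def exp_cnj)

lemma norm_e [simp]: "cmod (e x) = 1"
  by (simp add: e_def)

lemma e_of_int [simp]: "e (of_int k) = 1"
proof -
  have "e (of_int k) = exp (2 * of_int k * of_real pi * \<i>)"
    by (simp add: e_def mult_ac)
  also have "\<dots> = 1"
    by (subst exp_eq_1) (auto intro!: exI[of _ k])
  finally show ?thesis .
qed

lemma e_eqI: "x - y = of_int k \<Longrightarrow> e x = e y"
  by (metis add.commute diff_add_cancel e_add e_of_int mult_1_right)

lemma e_int_div_eqI:
  assumes "[a = b] (mod int m)" "m > 0"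
  shows "e (of_int a / real m) = e (of_int b / real m)"
proof -
  obtain k where "a - b = int m * k"
    using assms(1) by (auto simp: cong_iff_dvd_diff)
  hence "real_of_int a - real_of_int b = real m * of_int k"
    by (metis of_int_diff of_int_mult of_int_of_nat_eq)
  thus ?thesis
    using assms(2) by (intro e_eqI[of _ _ k]) (auto simp: field_simps)
qed

lemma e_power: "e x ^ n = e (real n * x)"
  by (simp add: e_def exp_of_nat_mult[symmetric] mult_ac)

lemma norm_one_minus_e: "cmod (1 - e x) = 2 * \<bar>sin (pi * x)\<bar>"
proof -
  have "(cmod (1 - e x))\<^sup>2 = (1 - cos (2 * pi * x))\<^sup>2 + (sin (2 * pi * x))\<^sup>2"
    by (simp add: e_def cmod_power2 Re_exp Im_exp)
  also have "\<dots> = 2 - 2 * cos (2 * (pi * x))"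
    using sin_cos_squared_add[of "2 * pi * x"]
    by (simp add: power2_eq_square algebra_simps)
  also have "\<dots> = (2 * \<bar>sin (pi * x)\<bar>)\<^sup>2"
    by (subst cos_double_sin) (simp add: power2_eq_square algebra_simps)
  finally show ?thesis
    by (rule power2_eq_imp_eq) auto
qed

lemma sin_pi_ge:
  assumes "0 < x" "x < 1"
  shows "sin (pi * x) \<ge> 2 * min x (1 - x)"
proof -
  have *: "sin (pi * y) \<ge> 2 * y" if "0 \<le> y" "y \<le> 1 / 2" for y :: real
  proof -
    have "concave_on {0..pi} sin"
      unfolding concave_on_def
      by (rule f''_ge0_imp_convex[where f' = "\<lambda>x. - cos x" and f'' = "\<lambda>x. sin x"])
         (auto intro!: derivative_eq_intros sin_ge_zero)
    hence "sin ((1 - 2 * y) *\<^sub>R 0 + (2 * y) *\<^sub>R (pi / 2)) \<ge> (1 - 2 * y) * sin 0 + (2 * y) * sin (pi / 2)"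
      using that by (intro concave_onD) auto
    thus ?thesis by (simp add: mult_ac)
  qed
  show ?thesis
  proof (cases "x \<le> 1 / 2")
    case True
    thus ?thesis using *[of x] assms by auto
  next
    case False
    have "sin (pi * (1 - x)) = sin (pi * x)"
      by (simp add: algebra_simps)
    thus ?thesis using *[of "1 - x"] assms False by auto
  qed
qed

text \<open>A majorant for \<open>\<Sum> e(k s / m)\<close> over at most \<open>J\<close> consecutive \<open>k\<close>. For \<open>x\<close> the fractional part of
  \<open>s / m\<close>, the usual bound \<open>1 / (2 min x (1 - x))\<close> is replaced by \<open>(1 / x + 1 / (1 - x)) / 2\<close>.\<close>
definition dker :: "real \<Rightarrow> nat \<Rightarrow> int \<Rightarrow> real" where
  "dker J m s = (if int m dvd s then J else
     min J (real m / 2 * (1 / of_int (s mod int m) + 1 / of_int (int m - s mod int m))))"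

lemma dker_cong: "[s = t] (mod int m) \<Longrightarrow> dker J m s = dker J m t"
  using cong_dvd_iff[of s t "int m"] by (simp only: dker_def cong_def)

lemma dker_nonneg: "J \<ge> 0 \<Longrightarrow> m > 0 \<Longrightarrow> dker J m s \<ge> 0"
  using pos_mod_bound[of "int m" s]
  by (auto simp: dker_def intro!: mult_nonneg_nonneg add_nonneg_nonneg simp del: pos_mod_bound)

lemma dker_le: "dker J m s \<le> J"
  by (auto simp: dker_def)

text \<open>The progression with ratio z = e x has norm at most 2/|1 - z|, and |1 - z| = 2 |sin (pi
  x)| is at least 4 min x (1 - x) by concavity of the sine. The trivial bound J supplies the other
  entry of the minimum.\<close>

lemma norm_geometric_e_le:
  assumes "m > 0" "real (card {u..<v::int}) \<le> J"
  shows "cmod (\<Sum>k\<in>{u..<v}. e (of_int k * of_int s / real m)) \<le> dker J m s"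
proof -
  let ?z = "e (of_int s / real m)"
  have triv: "cmod (\<Sum>k\<in>{u..<v}. e (of_int k * of_int s / real m)) \<le> J"
    by (rule order_trans[OF norm_sum]) (use assms in simp)
  show ?thesis
  proof (cases "int m dvd s")
    case True
    thus ?thesis using triv by (simp add: dker_def)
  next
    case False
    define s' where "s' = s mod int m"
    have s': "0 < s'" "s' < int m"
    proof -
      have "s' \<ge> 0" "s' < int m" using assms(1) by (simp_all add: s'_def)
      moreover have "s' \<noteq> 0" using False by (auto simp: s'_def)
      ultimately show "0 < s'" "s' < int m" by linarith+
    qed
    define x where "x = of_int s' / real m"
    have x: "0 < x" "x < 1" using s' assms(1) by (auto simp: x_def)
    have zx: "?z = e x"
      unfolding x_def s'_def by (intro e_int_div_eqI assms) (simp add: cong_def)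
    have lower: "cmod (1 - ?z) \<ge> 4 * min x (1 - x)"
      using sin_pi_ge[OF x] unfolding zx norm_one_minus_e by linarith
    have pos: "min x (1 - x) > 0" using x by simp
    define n where "n = nat (v - u)"
    have "(\<Sum>k\<in>{u..<v}. e (of_int k * of_int s / real m)) =
        (\<Sum>j<n. e (of_int (u + int j) * of_int s / real m))"
      by (rule sum.reindex_bij_witness[of _ "\<lambda>j. u + int j" "\<lambda>k. nat (k - u)"])
         (auto simp: n_def)
    also have "\<dots> = e (of_int u * of_int s / real m) * (\<Sum>j<n. ?z ^ j)"
      unfolding sum_distrib_left
      by (intro sum.cong) (auto simp: e_power e_add[symmetric] add_divide_distrib distrib_right)
    finally have eq: "cmod (\<Sum>k\<in>{u..<v}. e (of_int k * of_int s / real m)) = cmod (\<Sum>j<n. ?z ^ j)"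
      by (simp add: norm_mult)
    have "cmod (\<Sum>j<n. ?z ^ j) * cmod (1 - ?z) = cmod (1 - ?z ^ n)"
      by (simp add: norm_mult[symmetric] one_diff_power_eq mult.commute)
    also have "\<dots> \<le> 2"
      using norm_triangle_ineq4[of 1 "?z ^ n"] by (simp add: norm_power)
    finally have "cmod (\<Sum>j<n. ?z ^ j) * (4 * min x (1 - x)) \<le> 2"
      by (rule order_trans[OF mult_left_mono[OF lower norm_ge_zero]])
    hence "cmod (\<Sum>j<n. ?z ^ j) \<le> 1 / (2 * min x (1 - x))"
      using pos by (simp add: field_simps)
    also have "\<dots> \<le> 1 / 2 * (1 / x + 1 / (1 - x))"
    proof -
      have "1 / min x (1 - x) \<le> 1 / x + 1 / (1 - x)"
        using x by (auto simp: min_def)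
      hence "1 / 2 * (1 / min x (1 - x)) \<le> 1 / 2 * (1 / x + 1 / (1 - x))"
        by (rule mult_left_mono) simp
      thus ?thesis by (simp only: times_divide_times_eq mult_1)
    qed
    also have "\<dots> = real m / 2 * (1 / of_int s' + 1 / of_int (int m - s'))"
    proof -
      have "1 - x = of_int (int m - s') / real m"
        using assms(1) by (simp add: x_def field_simps)
      hence "1 / (1 - x) = real m * (1 / of_int (int m - s'))" by simp
      moreover have "1 / x = real m * (1 / of_int s')" by (simp add: x_def)
      ultimately show ?thesis by (simp only: distrib_left)
    qed
    finally show ?thesis
      using eq triv False by (simp add: dker_def s'_def)
  qed
qed

lemma harmonic_le:
  assumes "n > 0"
  shows "(\<Sum>k=1..<n. 1 / real k) \<le> 1 + ln (real n)"
proof -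
  have "(\<Sum>k=1..n. 1 / real k) \<le> 1 + ln (real n)"
    using assms
  proof (induction n rule: nat_induct_non_zero)
    case (Suc n)
    have "ln (real n / real (Suc n)) \<le> real n / real (Suc n) - 1"
      by (rule ln_le_minus_one) (use Suc in auto)
    also have "real n / real (Suc n) - 1 = - (1 / real (Suc n))"
      by (simp add: field_simps)
    finally have "1 / real (Suc n) \<le> ln (real (Suc n)) - ln (real n)"
      using Suc by (simp add: ln_div)
    thus ?case using Suc by simp
  qed auto
  moreover have "(\<Sum>k=1..<n. 1 / real k) \<le> (\<Sum>k=1..n. 1 / real k)"
    by (intro sum_mono2) auto
  ultimately show ?thesis by linarith
qed

text \<open>Here the additive form of the majorant pays off: over the nonzero residues it splits
  into two harmonic sums, which the reflection of s to m - s shows to be equal.\<close>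

lemma sum_dker_le:
  assumes "m > 0" "J \<ge> 0"
  shows "(\<Sum>s\<in>{0..<int m}. dker J m s) \<le> J + real m * (1 + ln (real m))"
proof -
  have split: "{0..<int m} = insert 0 (int ` {1..<m})"
    using assms(1) by (force simp: image_int_atLeastLessThan)
  have "(\<Sum>s\<in>{0..<int m}. dker J m s) = J + (\<Sum>s\<in>{1..<m}. dker J m (int s))"
    unfolding split by (subst sum.insert) (auto simp: sum.reindex dker_def)
  also have "(\<Sum>s\<in>{1..<m}. dker J m (int s)) \<le>
      (\<Sum>s\<in>{1..<m}. real m / 2 * (1 / real s + 1 / real (m - s)))"
  proof (rule sum_mono)
    fix s assume s: "s \<in> {1..<m}"
    hence "\<not> int m dvd int s" by (auto dest: zdvd_not_zless)
    thus "dker J m (int s) \<le> real m / 2 * (1 / real s + 1 / real (m - s))"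
      using s unfolding dker_def by (simp only: if_False) (rule min.coboundedI2, simp add: of_nat_diff)
  qed
  also have "\<dots> = real m / 2 * ((\<Sum>s\<in>{1..<m}. 1 / real s) + (\<Sum>s\<in>{1..<m}. 1 / real (m - s)))"
    by (simp add: sum_distrib_left sum.distrib[symmetric])
  also have "(\<Sum>s\<in>{1..<m}. 1 / real (m - s)) = (\<Sum>s\<in>{1..<m}. 1 / real s)"
    by (rule sum.reindex_bij_witness[of _ "\<lambda>s. m - s" "\<lambda>s. m - s"]) auto
  also have "real m / 2 * ((\<Sum>s\<in>{1..<m}. 1 / real s) + (\<Sum>s\<in>{1..<m}. 1 / real s)) =
     real m * (\<Sum>s\<in>{1..<m}. 1 / real s)" by simp
  also have "\<dots> \<le> real m * (1 + ln (real m))"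
    by (intro mult_left_mono harmonic_le assms) auto
  finally show ?thesis by simp
qed

text \<open>One factor is replaced by its maximum J and the other is summed.\<close>

lemma sum_dker_square_le:
  assumes "m > 0" "J \<ge> 0"
  shows "(\<Sum>s\<in>{0..<int m}. (dker J m s)\<^sup>2) \<le> J * (J + real m * (1 + ln (real m)))"
proof -
  have "(\<Sum>s\<in>{0..<int m}. (dker J m s)\<^sup>2) \<le> (\<Sum>s\<in>{0..<int m}. J * dker J m s)"
    unfolding power2_eq_square
    by (intro sum_mono mult_right_mono dker_le dker_nonneg assms)
  also have "\<dots> = J * (\<Sum>s\<in>{0..<int m}. dker J m s)"
    by (simp add: sum_distrib_left)
  finally show ?thesis
    using mult_left_mono[OF sum_dker_le[OF assms] assms(2)] by linarith
qed


section \<open>Sums over intervals and residue classes\<close>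

lemma sum_mod_int_interval:
  fixes g :: "int \<Rightarrow> 'a :: comm_monoid_add"
  assumes "q > 0"
  shows "(\<Sum>n\<in>{a..<a + int q}. g (n mod int q)) = (\<Sum>b\<in>{0..<int q}. g b)"
proof (rule sum.reindex_bij_witness[of _ "\<lambda>b. a + (b - a) mod int q" "\<lambda>n. n mod int q"])
  fix n assume n: "n \<in> {a..<a + int q}"
  have "(n mod int q - a) mod int q = (n - a) mod int q"
    by (simp add: mod_diff_left_eq)
  also have "\<dots> = n - a" using n by simp
  finally show "a + (n mod int q - a) mod int q = n" by simp
next
  fix b assume b: "b \<in> {0..<int q}"
  have "(a + (b - a) mod int q) mod int q = (a + (b - a)) mod int q"
    by (rule mod_add_right_eq)
  thus "(a + (b - a) mod int q) mod int q = b" using b by simp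
qed (use assms in \<open>auto simp: pos_mod_bound\<close>)

text \<open>Whole periods are peeled off one at a time; the rest, shorter than q, is enlarged to a
  full period because g is nonnegative. This is the extra 1.\<close>

lemma sum_periodic_le:
  fixes g :: "int \<Rightarrow> real"
  assumes q: "q > 0" and nonneg: "\<And>n. g n \<ge> 0" and per: "\<And>n. g n = g (n mod int q)"
  shows "(\<Sum>n\<in>{a..<a + int N}. g n) \<le> (real N / real q + 1) * (\<Sum>b\<in>{0..<int q}. g b)"
proof -
  let ?S = "\<Sum>b\<in>{0..<int q}. g b"
  have S0: "?S \<ge> 0" by (intro sum_nonneg nonneg)
  have "(\<Sum>n\<in>{a..<a + int N}. g n) \<le> real (N div q + 1) * ?S"
  proof (induction "N div q" arbitrary: N a)
    case 0
    hence "N < q" using q by (simp add: div_eq_0_iff)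
    hence "(\<Sum>n\<in>{a..<a + int N}. g n) \<le> (\<Sum>n\<in>{a..<a + int q}. g n)"
      by (intro sum_mono2 nonneg) auto
    also have "\<dots> = (\<Sum>n\<in>{a..<a + int q}. g (n mod int q))"
      by (intro sum.cong refl per)
    also have "\<dots> = ?S" by (rule sum_mod_int_interval[OF q])
    finally show ?case using 0 by simp
  next
    case (Suc d)
    have Nq: "N \<ge> q" using Suc(2) by (metis div_less leI nat.distinct(1))
    have d: "d = (N - q) div q" using Suc(2) Nq q by (simp add: le_div_geq)
    have "{a..<a + int N} = {a..<a + int q} \<union> {a + int q..<(a + int q) + int (N - q)}"
      using Nq by (auto simp: of_nat_diff)
    hence "(\<Sum>n\<in>{a..<a + int N}. g n) =
        (\<Sum>n\<in>{a..<a + int q}. g n) + (\<Sum>n\<in>{a + int q..<(a + int q) + int (N - q)}. g n)"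
      by (simp add: sum.union_disjoint)
    also have "(\<Sum>n\<in>{a..<a + int q}. g n) = (\<Sum>n\<in>{a..<a + int q}. g (n mod int q))"
      by (intro sum.cong refl per)
    also have "\<dots> = ?S" by (rule sum_mod_int_interval[OF q])
    also have "(\<Sum>n\<in>{a + int q..<(a + int q) + int (N - q)}. g n) \<le> real ((N - q) div q + 1) * ?S"
      by (rule Suc(1)[OF d])
    finally have "(\<Sum>n\<in>{a..<a + int N}. g n) \<le> ?S + real (d + 1) * ?S"
      using d by simp
    thus ?case unfolding Suc(2)[symmetric] by (simp add: algebra_simps)
  qed
  also have "real (N div q + 1) \<le> real N / real q + 1"
    using of_nat_div_le_of_nat[of N q, where 'a = real] by simp
  finally show ?thesis using S0 by (meson mult_right_mono order_trans order_refl)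
qed

lemma sum_interval_mod_split:
  fixes g :: "int \<Rightarrow> 'a :: comm_monoid_add"
  assumes "q > 0" "finite I"
  shows "(\<Sum>n\<in>I. g n) = (\<Sum>b\<in>{0..<int q}. \<Sum>n\<in>{n\<in>I. n mod int q = b}. g n)"
  by (rule sum.group[symmetric]) (use assms in auto)

section \<open>The characters in \<open>G1\<close> and the functions they span\<close>

lemma coprime_prime_iff: "prime q \<Longrightarrow> coprime n (int q) \<longleftrightarrow> \<not> int q dvd n"
proof
  assume q: "prime q" and cop: "coprime n (int q)"
  have "\<not> is_unit (int q)"
    using prime_gt_1_nat[OF q] by simp
  thus "\<not> int q dvd n"
    using coprime_common_divisor[OF cop, of "int q"] by (metis dvd_refl)
next
  assume q: "prime q" and n: "\<not> int q dvd n"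
  have "prime (int q)" using q by simp
  from prime_imp_coprime[OF this n] show "coprime n (int q)"
    by (rule coprime_imp_coprime) auto
qed

lemma dirichlet_char_cong:
  assumes "dirichlet_char m chi" "[a = b] (mod m)"
  shows "chi a = chi b"
proof -
  have per: "chi (x + m) = chi x" for x
    using assms(1) by (auto simp: dirichlet_char_def)
  have nat: "chi (x + int k * m) = chi x" for x k
  proof (induction k)
    case (Suc k)
    have "x + int (Suc k) * m = (x + int k * m) + m" by (simp add: algebra_simps)
    thus ?case using Suc by (simp only: per)
  qed simp
  obtain k where k: "a = b + k * m"
    using assms(2) by (metis add.commute cong_iff_lin cong_sym mult.commute)
  show ?thesis
  proof (cases "k \<ge> 0")
    case True
    thus ?thesis using nat[of b "nat k"] k by simp
  next
    case False
    thus ?thesis using nat[of a "nat (- k)"] k by simp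
  qed
qed

text \<open>Relative to a prime modulus \<open>q\<close>, the span of \<open>G1 q\<close> consists of the functions that vanish on
  multiples of \<open>q\<close> and transform under translation by \<open>q\<close> as follows.\<close>
definition twisted :: "nat \<Rightarrow> (int \<Rightarrow> complex) \<Rightarrow> bool" where
  "twisted q F \<longleftrightarrow>
     (\<forall>n k y. [n * y = 1] (mod int q) \<longrightarrow> F (n + int q * k) = F n * e (of_int (k * y) / real q)) \<and>
     (\<forall>n. int q dvd n \<longrightarrow> F n = 0)"

text \<open>The modulus of a twisted function has period q, so any complete residue system modulo q
  gives the same square norm, although F itself is not periodic modulo q.\<close>

definition sqsum :: "nat \<Rightarrow> (int \<Rightarrow> complex) \<Rightarrow> real" where
  "sqsum q F = (\<Sum>b\<in>{0..<int q}. (cmod (F b))\<^sup>2)"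

lemma sqsum_nonneg [simp]: "sqsum q F \<ge> 0"
  by (simp add: sqsum_def sum_nonneg)

lemma twistedD:
  "twisted q F \<Longrightarrow> [n * y = 1] (mod int q) \<Longrightarrow> F (n + int q * k) = F n * e (of_int (k * y) / real q)"
  "twisted q F \<Longrightarrow> int q dvd n \<Longrightarrow> F n = 0"
  unfolding twisted_def by blast+

lemma ex_inverse_mod_prime:
  assumes "prime q" "\<not> int q dvd n"
  obtains y where "[n * y = 1] (mod int q)"
  using cong_solve_coprime_int[of n "int q"] assms coprime_prime_iff by blast

lemma twisted_norm_cong:
  assumes "prime q" "twisted q F" "[m = n] (mod int q)"
  shows "cmod (F m) = cmod (F n)"
proof -
  obtain k where k: "m = n + int q * k"
    using assms(3) by (metis cong_iff_lin cong_sym)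
  show ?thesis
  proof (cases "int q dvd n")
    case True
    thus ?thesis using twistedD(2)[OF assms(2)] k by (metis dvd_add dvd_triv_left)
  next
    case False
    then obtain y where "[n * y = 1] (mod int q)"
      using ex_inverse_mod_prime assms(1) by blast
    thus ?thesis using twistedD(1)[OF assms(2), of n y k] k by (simp add: norm_mult)
  qed
qed

lemma twisted_sum:
  assumes "\<And>i. i \<in> A \<Longrightarrow> twisted q (F i)"
  shows "twisted q (\<lambda>n. \<Sum>i\<in>A. c i * F i n)"
  unfolding twisted_def using twistedD[OF assms]
  by (auto simp: sum_distrib_right mult.assoc intro!: sum.cong sum.neutral)

text \<open>Modulo q^2, n + q k equals n (1 + q k y') with y' an inverse of n modulo q^2. The second
  factor is 1 modulo q, where \<xi> is prescribed, and its phase sees y' only modulo q.\<close>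

lemma G1_twisted:
  assumes q: "prime q" and xi: "\<xi> \<in> G1 q"
  shows "twisted q \<xi>"
proof -
  have chi: "dirichlet_char (int q ^ 2) \<xi>"
    and one: "\<And>x. [x = 1] (mod int q) \<Longrightarrow> \<xi> x = e (real_of_int (x - 1) / real (q ^ 2))"
    using xi by (auto simp: G1_def)
  have q0: "q > 0" using q by (simp add: prime_gt_0_nat)
  have "\<xi> (n + int q * k) = \<xi> n * e (of_int (k * y) / real q)" if y: "[n * y = 1] (mod int q)" for n k y
  proof -
    have "coprime n (int q)"
      using y by (metis cong_imp_coprime cong_sym coprime_1_left coprime_mult_left_iff)
    hence "coprime n ((int q)\<^sup>2)" by simp
    then obtain y' where y': "[n * y' = 1] (mod (int q)\<^sup>2)"
      using cong_solve_coprime_int by blast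
    hence "(int q)\<^sup>2 dvd n * y' - 1" by (simp add: cong_iff_dvd_diff)
    hence "(int q)\<^sup>2 dvd int q * k * (n * y' - 1)" by (rule dvd_mult)
    hence "[n * (1 + int q * (k * y')) = n + int q * k] (mod (int q)\<^sup>2)"
      by (simp add: cong_iff_dvd_diff algebra_simps)
    hence "\<xi> (n + int q * k) = \<xi> n * \<xi> (1 + int q * (k * y'))"
      using dirichlet_char_cong[OF chi] chi unfolding dirichlet_char_def by metis
    also have "\<xi> (1 + int q * (k * y')) = e (real_of_int (1 + int q * (k * y') - 1) / real (q ^ 2))"
      by (rule one) (simp add: cong_iff_dvd_diff)
    also have "real_of_int (1 + int q * (k * y') - 1) / real (q ^ 2) = of_int (k * y') / real q"
      using q0 by (simp add: power2_eq_square)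
    also have "e (of_int (k * y') / real q) = e (of_int (k * y) / real q)"
    proof (rule e_int_div_eqI[OF _ q0])
      have "[n * y' = 1] (mod int q)"
        using y' by (metis cong_modulus_mult power2_eq_square)
      hence "[n * y' = n * y] (mod int q)" using y cong_sym cong_trans by blast
      hence "[y' = y] (mod int q)"
        using \<open>coprime n (int q)\<close> cong_mult_lcancel by blast
      thus "[k * y' = k * y] (mod int q)" by (rule cong_scalar_left)
    qed
    finally show ?thesis .
  qed
  moreover have "\<xi> n = 0" if "int q dvd n" for n
  proof -
    have "\<not> coprime n (int q)" using that q coprime_prime_iff by blast
    hence "\<not> coprime n ((int q)\<^sup>2)" by simp
    thus ?thesis using chi by (auto simp: dirichlet_char_def)
  qed
  ultimately show ?thesis by (auto simp: twisted_def)
qed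

lemma G1_mult: "\<xi> \<in> G1 q \<Longrightarrow> \<xi> (a * b) = \<xi> a * \<xi> b"
  by (auto simp: G1_def dirichlet_char_def)

text \<open>The definition asks only for nonzero values on units. Since the modulus of \<xi> has
  period q, Fermat modulo q suffices: its (q-1)-th power at m is its value at 1.\<close>

lemma norm_G1:
  assumes q: "prime q" and xi: "\<xi> \<in> G1 q" and n: "\<not> int q dvd n"
  shows "cmod (\<xi> n) = 1"
proof -
  define m where "m = nat (n mod int q)"
  have q0: "q > 0" using q by (simp add: prime_gt_0_nat)
  have mn: "[int m = n] (mod int q)" using q0 by (simp add: m_def cong_def)
  hence norm_mn: "cmod (\<xi> n) = cmod (\<xi> (int m))"
    using twisted_norm_cong[OF q G1_twisted[OF q xi]] by simp
  have "\<not> q dvd m"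
    using cong_dvd_iff[OF mn] n by simp
  hence cong: "[m ^ (q - 1) = 1] (mod q)" using q fermat_theorem by blast
  have pow: "\<xi> (x ^ j) = \<xi> x ^ j" for x j
  proof (induction j)
    case 0
    thus ?case using xi by (simp add: G1_def dirichlet_char_def)
  next
    case (Suc j)
    thus ?case by (simp add: G1_mult[OF xi])
  qed
  have "cmod (\<xi> (int m)) ^ (q - 1) = cmod (\<xi> (int m ^ (q - 1)))"
    by (simp add: pow norm_power)
  also have "\<dots> = cmod (\<xi> 1)"
    by (rule twisted_norm_cong[OF q G1_twisted[OF q xi]])
       (use cong in \<open>metis cong_int_iff of_nat_1 of_nat_power\<close>)
  also have "\<dots> = 1" using xi by (simp add: G1_def dirichlet_char_def)
  finally have "cmod (\<xi> (int m)) = 1"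
    using prime_gt_1_nat[OF q] power_eq_imp_eq_base[of "cmod (\<xi> (int m))" "q - 1" 1] by simp
  thus ?thesis using norm_mn by simp
qed

lemma not_dvd_residues: "0 < q \<Longrightarrow> {b\<in>{0..<int q}. \<not> int q dvd b} = {1..<int q}"
proof -
  have "int q dvd b \<longleftrightarrow> b = 0" if "0 \<le> b" "b < int q" for b
    using that zdvd_not_zless[of b "int q"] by (cases "b = 0") auto
  thus ?thesis by (auto simp: order_le_less)
qed

text \<open>The twisting phases of \<xi> and \<xi>' coincide, so they cancel in the product of \<xi>
  with the conjugate of \<xi>'. That product is a character modulo q, not merely modulo q^2, and the
  usual argument of multiplying by an element b0 with value other than 1 applies.\<close>

lemma G1_orthogonality:
  assumes q: "prime q" and xi: "\<xi> \<in> G1 q" and xi': "\<xi>' \<in> G1 q"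
  shows "(\<Sum>b\<in>{0..<int q}. \<xi> b * cnj (\<xi>' b)) = (if \<xi> = \<xi>' then of_nat (totient q) else 0)"
proof -
  have q0: "q > 0" using q by (simp add: prime_gt_0_nat)
  define \<psi> where "\<psi> = (\<lambda>b. \<xi> b * cnj (\<xi>' b))"
  have \<psi>0: "\<psi> b = 0" if "int q dvd b" for b
    using twistedD(2)[OF G1_twisted[OF q xi] that] by (simp add: \<psi>_def)
  show ?thesis
  proof (cases "\<xi> = \<xi>'")
    case True
    have "(\<Sum>b\<in>{0..<int q}. \<psi> b) = (\<Sum>b\<in>{b\<in>{0..<int q}. \<not> int q dvd b}. \<psi> b)"
      using \<psi>0 by (intro sum.mono_neutral_right) auto
    also have "\<dots> = (\<Sum>b\<in>{b\<in>{0..<int q}. \<not> int q dvd b}. 1)"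
      using norm_G1[OF q xi] True
      by (intro sum.cong refl) (auto simp: \<psi>_def complex_norm_square[symmetric])
    also have "\<dots> = of_nat (totient q)"
      unfolding not_dvd_residues[OF q0] using q0 by (simp add: totient_prime[OF q])
    finally show ?thesis using True by (simp add: \<psi>_def)
  next
    case False
    then obtain b0 where b0: "\<xi> b0 \<noteq> \<xi>' b0" by blast
    have nd: "\<not> int q dvd b0"
      using b0 twistedD(2)[OF G1_twisted[OF q xi]] twistedD(2)[OF G1_twisted[OF q xi']] by metis
    have "\<xi>' b0 * cnj (\<xi>' b0) = 1"
      using norm_G1[OF q xi' nd] by (simp add: complex_norm_square[symmetric])
    hence ne: "\<psi> b0 \<noteq> 1"
      using b0 unfolding \<psi>_def by (metis mult_cancel_right mult_zero_right zero_neq_one)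
    have \<psi>mod: "\<psi> b = \<psi> (b mod int q)" for b
    proof (cases "int q dvd b")
      case True
      thus ?thesis using \<psi>0 by (simp add: dvd_mod)
    next
      case False
      hence "\<not> int q dvd (b mod int q)" by (simp add: dvd_mod_iff)
      then obtain y where y: "[b mod int q * y = 1] (mod int q)"
        using ex_inverse_mod_prime q by blast
      show ?thesis
        using twistedD(1)[OF G1_twisted[OF q xi] y, of "b div int q"]
              twistedD(1)[OF G1_twisted[OF q xi'] y, of "b div int q"]
        by (simp add: \<psi>_def cnj_e e_add[symmetric])
    qed
    obtain y0 where y0: "[b0 * y0 = 1] (mod int q)"
      using ex_inverse_mod_prime q nd by blast
    have canc: "(b0 * (y0 * b mod int q)) mod int q = b" if "b \<in> {0..<int q}" for b
    proof -
      have "[b0 * (y0 * b mod int q) = b0 * y0 * b] (mod int q)"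
        by (simp add: cong_def mod_mult_right_eq mult.assoc)
      also have "[b0 * y0 * b = 1 * b] (mod int q)" by (rule cong_scalar_right[OF y0])
      finally show ?thesis using that by (simp add: cong_def)
    qed
    have canc': "(y0 * (b0 * b mod int q)) mod int q = b" if "b \<in> {0..<int q}" for b
    proof -
      have "[y0 * (b0 * b mod int q) = b0 * y0 * b] (mod int q)"
        by (simp add: cong_def mod_mult_right_eq mult_ac)
      also have "[b0 * y0 * b = 1 * b] (mod int q)" by (rule cong_scalar_right[OF y0])
      finally show ?thesis using that by (simp add: cong_def)
    qed
    have "(\<Sum>b\<in>{0..<int q}. \<psi> b) = (\<Sum>b\<in>{0..<int q}. \<psi> (b0 * b mod int q))"
      by (rule sum.reindex_bij_witness[of _ "\<lambda>b. b0 * b mod int q" "\<lambda>b. y0 * b mod int q"])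
         (use q0 canc canc' in \<open>auto simp: mult.assoc\<close>)
    also have "\<dots> = (\<Sum>b\<in>{0..<int q}. \<psi> b0 * \<psi> b)"
      by (intro sum.cong refl, subst \<psi>mod[symmetric])
         (simp add: \<psi>_def G1_mult[OF xi] G1_mult[OF xi'])
    also have "\<dots> = \<psi> b0 * (\<Sum>b\<in>{0..<int q}. \<psi> b)" by (simp add: sum_distrib_left)
    finally have "(\<Sum>b\<in>{0..<int q}. \<psi> b) = 0"
      using ne by (metis mult_cancel_right1)
    thus ?thesis using False by (simp add: \<psi>_def)
  qed
qed

text \<open>Orthogonality over the residues modulo q kills the cross terms; the factor
  \<open>totient q\<close> that is left is the one that the weight in the theorem cancels.\<close>

lemma sqsum_G1:
  assumes q: "prime q" and A: "finite A" "A \<subseteq> G1 q"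
  shows "sqsum q (\<lambda>n. \<Sum>\<xi>\<in>A. c \<xi> * \<xi> n) = real (totient q) * (\<Sum>\<xi>\<in>A. (cmod (c \<xi>))\<^sup>2)"
proof -
  have "complex_of_real (sqsum q (\<lambda>n. \<Sum>\<xi>\<in>A. c \<xi> * \<xi> n)) =
      (\<Sum>b\<in>{0..<int q}. (\<Sum>\<xi>\<in>A. c \<xi> * \<xi> b) * cnj (\<Sum>\<xi>\<in>A. c \<xi> * \<xi> b))"
    unfolding sqsum_def of_real_sum complex_norm_square ..
  also have "\<dots> = (\<Sum>b\<in>{0..<int q}. \<Sum>\<xi>\<in>A. \<Sum>\<xi>'\<in>A. c \<xi> * cnj (c \<xi>') * (\<xi> b * cnj (\<xi>' b)))"
    by (simp add: sum_product mult_ac)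
  also have "\<dots> = (\<Sum>\<xi>\<in>A. \<Sum>\<xi>'\<in>A. \<Sum>b\<in>{0..<int q}. c \<xi> * cnj (c \<xi>') * (\<xi> b * cnj (\<xi>' b)))"
    by (subst sum.swap, intro sum.cong refl, rule sum.swap)
  also have "\<dots> = (\<Sum>\<xi>\<in>A. \<Sum>\<xi>'\<in>A. c \<xi> * cnj (c \<xi>') * (if \<xi> = \<xi>' then of_nat (totient q) else 0))"
    unfolding sum_distrib_left[symmetric]
    by (intro sum.cong refl arg_cong2[where f = "(*)"] G1_orthogonality[OF q]) (use A in auto)
  also have "\<dots> = (\<Sum>\<xi>\<in>A. c \<xi> * cnj (c \<xi>) * of_nat (totient q))"
    using A by (intro sum.cong refl) (simp add: if_distrib cong: if_cong)
  also have "\<dots> = complex_of_real (real (totient q) * (\<Sum>\<xi>\<in>A. (cmod (c \<xi>))\<^sup>2))"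
    unfolding of_real_mult of_real_sum sum_distrib_left complex_norm_square
    by (intro sum.cong refl) simp
  finally show ?thesis by (simp only: of_real_eq_iff)
qed

section \<open>Duality and reduction to pairs of primes\<close>

lemma norm_sum_square_le:
  fixes f g :: "'a \<Rightarrow> complex"
  shows "(cmod (\<Sum>i\<in>A. f i * g i))\<^sup>2 \<le> (\<Sum>i\<in>A. (cmod (f i))\<^sup>2) * (\<Sum>i\<in>A. (cmod (g i))\<^sup>2)"
proof -
  have "cmod (\<Sum>i\<in>A. f i * g i) \<le> (\<Sum>i\<in>A. cmod (f i) * cmod (g i))"
    by (rule order_trans[OF norm_sum]) (simp add: norm_mult)
  hence "(cmod (\<Sum>i\<in>A. f i * g i))\<^sup>2 \<le> (\<Sum>i\<in>A. cmod (f i) * cmod (g i))\<^sup>2"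
    by (intro power_mono) auto
  also have "\<dots> \<le> (\<Sum>i\<in>A. (cmod (f i))\<^sup>2) * (\<Sum>i\<in>A. (cmod (g i))\<^sup>2)"
    by (rule Cauchy_Schwarz_ineq_sum)
  finally show ?thesis .
qed

text \<open>The dual inequality is applied to the conjugates of the inner sums. With S the left side
  and Z the square norm of a, Cauchy--Schwarz gives S^2 <= D Z S, and S cancels.\<close>

lemma duality_principle:
  fixes m :: "'a \<Rightarrow> 'b \<Rightarrow> complex"
  assumes dual: "\<And>c. (\<Sum>j\<in>J. (cmod (\<Sum>i\<in>I. c i * m i j))\<^sup>2) \<le> D * (\<Sum>i\<in>I. (cmod (c i))\<^sup>2)"
    and "D \<ge> 0"
  shows "(\<Sum>i\<in>I. (cmod (\<Sum>j\<in>J. a j * m i j))\<^sup>2) \<le> D * (\<Sum>j\<in>J. (cmod (a j))\<^sup>2)"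
proof -
  define c where "c = (\<lambda>i. cnj (\<Sum>j\<in>J. a j * m i j))"
  define S where "S = (\<Sum>i\<in>I. (cmod (\<Sum>j\<in>J. a j * m i j))\<^sup>2)"
  define Z where "Z = (\<Sum>j\<in>J. (cmod (a j))\<^sup>2)"
  have S0: "S \<ge> 0" "Z \<ge> 0" by (simp_all add: S_def Z_def sum_nonneg)
  have "complex_of_real S = (\<Sum>i\<in>I. (\<Sum>j\<in>J. a j * m i j) * c i)"
    unfolding S_def of_real_sum complex_norm_square c_def ..
  also have "\<dots> = (\<Sum>i\<in>I. \<Sum>j\<in>J. a j * (c i * m i j))"
    by (simp add: sum_distrib_left sum_distrib_right mult_ac)
  also have "\<dots> = (\<Sum>j\<in>J. a j * (\<Sum>i\<in>I. c i * m i j))"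
    by (subst sum.swap) (simp add: sum_distrib_left)
  finally have "S = cmod (\<Sum>j\<in>J. a j * (\<Sum>i\<in>I. c i * m i j))"
    using S0 by (metis norm_of_real abs_of_nonneg)
  hence "S\<^sup>2 \<le> Z * (\<Sum>j\<in>J. (cmod (\<Sum>i\<in>I. c i * m i j))\<^sup>2)"
    using norm_sum_square_le[of a "\<lambda>j. \<Sum>i\<in>I. c i * m i j" J] by (simp add: Z_def)
  also have "\<dots> \<le> Z * (D * S)"
  proof (rule mult_left_mono[OF _ S0(2)])
    have "(\<Sum>i\<in>I. (cmod (c i))\<^sup>2) = S" by (simp only: S_def c_def complex_mod_cnj)
    thus "(\<Sum>j\<in>J. (cmod (\<Sum>i\<in>I. c i * m i j))\<^sup>2) \<le> D * S" using dual[of c] by simp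
  qed
  finally have "S * S \<le> (D * Z) * S" by (simp add: power2_eq_square mult_ac)
  hence "S \<le> D * Z"
    using S0 assms(2) by (cases "S = 0") auto
  thus ?thesis by (simp add: S_def Z_def)
qed

lemma G1_large_sieve_of_dual:
  assumes S: "finite S" "\<And>q. q \<in> S \<Longrightarrow> prime q" and B: "B \<ge> 0"
    and dual: "\<And>G. (\<And>q. q \<in> S \<Longrightarrow> twisted q (G q)) \<Longrightarrow>
      (\<Sum>n\<in>I. (cmod (\<Sum>q\<in>S. G q n))\<^sup>2) \<le> B * (\<Sum>q\<in>S. sqsum q (G q) / real q)"
  shows "(\<Sum>q\<in>S. (real q / real (totient q)) * (\<Sum>\<xi>\<in>G1 q. (cmod (\<Sum>n\<in>I. a n * \<xi> n))\<^sup>2))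
     \<le> B * (\<Sum>n\<in>I. (cmod (a n))\<^sup>2)"
proof -
  \<comment> \<open>A sum over an infinite set is 0 by convention, so passing to \<open>A q\<close>
    changes no sum and supplies the finiteness required below.\<close>
  define A where "A = (\<lambda>q. if finite (G1 q) then G1 q else {})"
  have A: "finite (A q)" "A q \<subseteq> G1 q" for q by (auto simp: A_def)
  \<comment> \<open>The square root of the weight goes into the matrix, so that the dual function
    has \<open>sqsum\<close> divided by q equal to the square norm of its coefficients.\<close>
  define w where "w = (\<lambda>q. sqrt (real q / real (totient q)))"
  define m :: "nat \<times> (int \<Rightarrow> complex) \<Rightarrow> int \<Rightarrow> complex" where "m = (\<lambda>(q, \<xi>) n. of_real (w q) * \<xi> n)"
  have tot: "totient q > 0" "q > 0" if "q \<in> S" for q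
    using S(2)[OF that] by (auto simp: prime_gt_0_nat)
  have w2: "(w q)\<^sup>2 = real q / real (totient q)" for q
    by (simp add: w_def)
  have w0: "w q \<ge> 0" for q by (simp add: w_def)
  have "(\<Sum>q\<in>S. (real q / real (totient q)) * (\<Sum>\<xi>\<in>G1 q. (cmod (\<Sum>n\<in>I. a n * \<xi> n))\<^sup>2)) =
      (\<Sum>q\<in>S. \<Sum>\<xi>\<in>A q. (cmod (\<Sum>n\<in>I. a n * m (q, \<xi>) n))\<^sup>2)"
  proof (rule sum.cong[OF refl])
    fix q
    have "(\<Sum>\<xi>\<in>G1 q. (cmod (\<Sum>n\<in>I. a n * \<xi> n))\<^sup>2) = (\<Sum>\<xi>\<in>A q. (cmod (\<Sum>n\<in>I. a n * \<xi> n))\<^sup>2)"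
      by (simp add: A_def)
    moreover have "(\<Sum>n\<in>I. a n * m (q, \<xi>) n) = of_real (w q) * (\<Sum>n\<in>I. a n * \<xi> n)" for \<xi>
      unfolding m_def sum_distrib_left by (intro sum.cong) auto
    hence "(cmod (\<Sum>n\<in>I. a n * m (q, \<xi>) n))\<^sup>2 =
        real q / real (totient q) * (cmod (\<Sum>n\<in>I. a n * \<xi> n))\<^sup>2" for \<xi>
      by (simp only: norm_mult power_mult_distrib norm_of_real power2_abs w2)
    ultimately show "(real q / real (totient q)) * (\<Sum>\<xi>\<in>G1 q. (cmod (\<Sum>n\<in>I. a n * \<xi> n))\<^sup>2) =
        (\<Sum>\<xi>\<in>A q. (cmod (\<Sum>n\<in>I. a n * m (q, \<xi>) n))\<^sup>2)"
      by (simp only: sum_distrib_left)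
  qed
  also have "\<dots> = (\<Sum>i\<in>Sigma S A. (cmod (\<Sum>n\<in>I. a n * m i n))\<^sup>2)"
    using S A by (subst sum.Sigma) auto
  also have "\<dots> \<le> B * (\<Sum>n\<in>I. (cmod (a n))\<^sup>2)"
  proof (rule duality_principle[OF _ B])
    fix c :: "nat \<times> (int \<Rightarrow> complex) \<Rightarrow> complex"
    define G where "G = (\<lambda>q n. \<Sum>\<xi>\<in>A q. (c (q, \<xi>) * of_real (w q)) * \<xi> n)"
    have tw: "twisted q (G q)" if "q \<in> S" for q
      unfolding G_def using A G1_twisted S(2)[OF that] by (intro twisted_sum) blast
    have sq: "sqsum q (G q) / real q = (\<Sum>\<xi>\<in>A q. (cmod (c (q, \<xi>)))\<^sup>2)" if "q \<in> S" for q
    proof -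
      have "(cmod (c (q, \<xi>) * of_real (w q)))\<^sup>2 = real q / real (totient q) * (cmod (c (q, \<xi>)))\<^sup>2" for \<xi>
        by (simp add: norm_mult power_mult_distrib w2)
      thus ?thesis
        unfolding G_def sqsum_G1[OF S(2)[OF that] A(1) A(2)]
        using tot[OF that] by (simp only: sum_distrib_left[symmetric]) simp
    qed
    have "(\<Sum>n\<in>I. (cmod (\<Sum>i\<in>Sigma S A. c i * m i n))\<^sup>2) = (\<Sum>n\<in>I. (cmod (\<Sum>q\<in>S. G q n))\<^sup>2)"
      using S A unfolding G_def m_def by (subst sum.Sigma) (auto simp: mult_ac case_prod_beta)
    also have "\<dots> \<le> B * (\<Sum>q\<in>S. sqsum q (G q) / real q)"
      by (rule dual[OF tw])
    also have "(\<Sum>q\<in>S. sqsum q (G q) / real q) = (\<Sum>q\<in>S. \<Sum>\<xi>\<in>A q. (cmod (c (q, \<xi>)))\<^sup>2)"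
      by (intro sum.cong refl sq)
    also have "\<dots> = (\<Sum>i\<in>Sigma S A. (cmod (c i))\<^sup>2)"
      using S A by (subst sum.Sigma) (auto simp: case_prod_beta)
    finally show "(\<Sum>n\<in>I. (cmod (\<Sum>i\<in>Sigma S A. c i * m i n))\<^sup>2) \<le> B * (\<Sum>i\<in>Sigma S A. (cmod (c i))\<^sup>2)" .
  qed
  finally show ?thesis .
qed

lemma sum_twisted_square_le:
  assumes "prime q" "twisted q F"
  shows "(\<Sum>n\<in>{a..<a + int N}. (cmod (F n))\<^sup>2) \<le> (real N / real q + 1) * sqsum q F"
  unfolding sqsum_def
proof (rule sum_periodic_le)
  show "(cmod (F n))\<^sup>2 = (cmod (F (n mod int q)))\<^sup>2" for n
    using twisted_norm_cong[OF assms, of n "n mod int q"] by (simp add: cong_def)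
qed (use assms in \<open>auto simp: prime_gt_0_nat\<close>)

text \<open>With C q = \<open>sqsum q (G q) / q\<close>, the diagonal costs N + q at each prime. Off
  the diagonal, each square norm is at most 3 P C, so a pair costs 3 P sqrt(X C(q) C(p));
  Cauchy--Schwarz over at most 2 P primes brings the total to 6 P^2 sqrt(X).\<close>

lemma dual_large_sieve_of_pairs:
  fixes X :: real
  assumes S: "finite S" "\<And>q. q \<in> S \<Longrightarrow> prime q" "\<And>q. q \<in> S \<Longrightarrow> q \<le> 3 * P" "card S \<le> 2 * P"
    and X: "X \<ge> 0"
    and pairs: "\<And>p q F G. p \<in> S \<Longrightarrow> q \<in> S \<Longrightarrow> p \<noteq> q \<Longrightarrow> twisted q F \<Longrightarrow> twisted p G \<Longrightarrow>
      (cmod (\<Sum>n\<in>{a..<a + int N}. F n * cnj (G n)))\<^sup>2 \<le> X * sqsum q F * sqsum p G"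
    and tw: "\<And>q. q \<in> S \<Longrightarrow> twisted q (G q)"
  shows "(\<Sum>n\<in>{a..<a + int N}. (cmod (\<Sum>q\<in>S. G q n))\<^sup>2)
    \<le> (real N + 3 * real P + 6 * real P ^ 2 * sqrt X) * (\<Sum>q\<in>S. sqsum q (G q) / real q)"
proof -
  define I where "I = {a..<a + int N}"
  define C where "C = (\<lambda>q. sqsum q (G q) / real q)"
  have C0: "C q \<ge> 0" for q by (simp add: C_def)
  have sq: "sqsum q (G q) = real q * C q" if "q \<in> S" for q
    using S(2)[OF that] by (simp add: C_def prime_gt_0_nat)
  have sq3: "sqsum q (G q) \<le> 3 * real P * C q" if "q \<in> S" for q
    unfolding sq[OF that] using S(3)[OF that] C0[of q] by (intro mult_right_mono) linarith+
  define K where "K = (\<lambda>q p. \<Sum>n\<in>I. G q n * cnj (G p n))"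
  have diag: "cmod (K q q) \<le> (real N + 3 * real P) * C q" if "q \<in> S" for q
  proof -
    have "cmod (K q q) = (\<Sum>n\<in>I. (cmod (G q n))\<^sup>2)"
    proof -
      have "K q q = complex_of_real (\<Sum>n\<in>I. (cmod (G q n))\<^sup>2)"
        unfolding K_def of_real_sum complex_norm_square ..
      thus ?thesis by (simp only: norm_of_real abs_of_nonneg sum_nonneg zero_le_power2)
    qed
    also have "\<dots> \<le> (real N / real q + 1) * sqsum q (G q)"
      unfolding I_def by (rule sum_twisted_square_le[OF S(2)[OF that] tw[OF that]])
    also have "\<dots> = (real N + real q) * C q"
      using S(2)[OF that] by (simp add: sq[OF that] prime_gt_0_nat field_simps)
    also have "\<dots> \<le> (real N + 3 * real P) * C q"
      using S(3)[OF that] C0[of q] by (intro mult_right_mono) linarith+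
    finally show ?thesis .
  qed
  have off: "cmod (K q p) \<le> 3 * real P * sqrt X * (sqrt (C q) * sqrt (C p))"
    if "p \<in> S" "q \<in> S" "p \<noteq> q" for p q
  proof -
    have "(cmod (K q p))\<^sup>2 \<le> X * sqsum q (G q) * sqsum p (G p)"
      unfolding K_def I_def using that tw by (intro pairs)
    also have "\<dots> \<le> X * (3 * real P * C q) * (3 * real P * C p)"
      using X C0 that by (intro mult_mono sq3 mult_nonneg_nonneg) auto
    also have "\<dots> = (3 * real P * sqrt X * (sqrt (C q) * sqrt (C p)))\<^sup>2"
      using X C0[of p] C0[of q] by (simp add: power_mult_distrib) (simp add: power2_eq_square)
    finally show ?thesis
      using X C0 by (intro power2_le_imp_le[of "cmod (K q p)"]) (auto intro!: mult_nonneg_nonneg)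
  qed
  have "complex_of_real (\<Sum>n\<in>I. (cmod (\<Sum>q\<in>S. G q n))\<^sup>2) =
      (\<Sum>n\<in>I. (\<Sum>q\<in>S. G q n) * cnj (\<Sum>q\<in>S. G q n))"
    unfolding of_real_sum complex_norm_square ..
  also have "\<dots> = (\<Sum>n\<in>I. \<Sum>q\<in>S. \<Sum>p\<in>S. G q n * cnj (G p n))"
    by (simp add: sum_product)
  also have "\<dots> = (\<Sum>q\<in>S. \<Sum>p\<in>S. K q p)"
    unfolding K_def by (subst sum.swap, intro sum.cong refl, rule sum.swap)
  finally have eq: "(\<Sum>q\<in>S. \<Sum>p\<in>S. K q p) = complex_of_real (\<Sum>n\<in>I. (cmod (\<Sum>q\<in>S. G q n))\<^sup>2)" ..
  have "(\<Sum>n\<in>I. (cmod (\<Sum>q\<in>S. G q n))\<^sup>2) = cmod (\<Sum>q\<in>S. \<Sum>p\<in>S. K q p)"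
    unfolding eq by (simp only: norm_of_real abs_of_nonneg sum_nonneg zero_le_power2)
  also have "\<dots> \<le> (\<Sum>q\<in>S. \<Sum>p\<in>S. cmod (K q p))"
    by (rule order_trans[OF norm_sum sum_mono[OF norm_sum]])
  also have "\<dots> \<le> (\<Sum>q\<in>S. \<Sum>p\<in>S. (if p = q then (real N + 3 * real P) * C q else 0) +
      3 * real P * sqrt X * (sqrt (C q) * sqrt (C p)))"
    (is "_ \<le> (\<Sum>q\<in>S. \<Sum>p\<in>S. ?R q p)")
  proof (intro sum_mono)
    fix q p assume "q \<in> S" "p \<in> S"
    moreover have "3 * real P * sqrt X * (sqrt (C q) * sqrt (C p)) \<ge> 0"
      using X C0 by (intro mult_nonneg_nonneg) auto
    ultimately show "cmod (K q p) \<le> ?R q p"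
      using diag[of q] off[of p q] by (cases "p = q") auto
  qed
  also have "\<dots> = (real N + 3 * real P) * (\<Sum>q\<in>S. C q) + 3 * real P * sqrt X * (\<Sum>q\<in>S. sqrt (C q))\<^sup>2"
    using S(1) by (simp add: sum.distrib power2_eq_square sum_product)
      (simp add: sum_distrib_left)
  also have "\<dots> \<le> (real N + 3 * real P) * (\<Sum>q\<in>S. C q) + 3 * real P * sqrt X * (2 * real P * (\<Sum>q\<in>S. C q))"
  proof (intro add_left_mono mult_left_mono)
    show "(\<Sum>q\<in>S. sqrt (C q))\<^sup>2 \<le> 2 * real P * (\<Sum>q\<in>S. C q)"
    proof -
      have "(\<Sum>q\<in>S. 1 * sqrt (C q))\<^sup>2 \<le> (\<Sum>q\<in>S. 1\<^sup>2) * (\<Sum>q\<in>S. (sqrt (C q))\<^sup>2)"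
        by (rule Cauchy_Schwarz_ineq_sum)
      also have "\<dots> = real (card S) * (\<Sum>q\<in>S. C q)" using C0 by simp
      also have "\<dots> \<le> 2 * real P * (\<Sum>q\<in>S. C q)"
      proof (rule mult_right_mono)
        show "real (card S) \<le> 2 * real P" using S(4) by linarith
      qed (simp add: C0 sum_nonneg)
      finally show ?thesis by simp
    qed
  qed (use X in simp)
  also have "\<dots> = (real N + 3 * real P + 6 * real P ^ 2 * sqrt X) * (\<Sum>q\<in>S. C q)"
    by (simp add: algebra_simps power2_eq_square)
  finally show ?thesis
    unfolding I_def C_def .
qed

section \<open>Differencing and mean squares of sums over modular inverses\<close>

text \<open>Expand the square and group by the difference h. The absolute value around each
  correlation is the point: a linear phase in k becomes a constant depending on h and disappears
  there.\<close>

lemma norm_square_sum_le_correlations: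
  fixes z :: "int \<Rightarrow> complex"
  shows "(cmod (\<Sum>k\<in>{0..<int m}. z k))\<^sup>2
    \<le> (\<Sum>h\<in>{-int m<..<int m}. cmod (\<Sum>k\<in>{k\<in>{0..<int m}. k + h \<in> {0..<int m}}. z (k + h) * cnj (z k)))"
proof -
  let ?K = "{0..<int m}"
  have "complex_of_real ((cmod (\<Sum>k\<in>?K. z k))\<^sup>2) = (\<Sum>k'\<in>?K. z k') * cnj (\<Sum>k\<in>?K. z k)"
    by (rule complex_norm_square)
  also have "\<dots> = (\<Sum>(k', k)\<in>?K \<times> ?K. z k' * cnj (z k))"
    by (simp add: sum_product sum.cartesian_product)
  also have "\<dots> = (\<Sum>h\<in>{-int m<..<int m}. \<Sum>(k', k)\<in>{x\<in>?K \<times> ?K. fst x - snd x = h}. z k' * cnj (z k))"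
    by (rule sum.group[symmetric]) auto
  also have "\<dots> = (\<Sum>h\<in>{-int m<..<int m}. \<Sum>k\<in>{k\<in>?K. k + h \<in> ?K}. z (k + h) * cnj (z k))"
    by (intro sum.cong refl, rule sum.reindex_bij_witness[of _ "\<lambda>k. (k + h, k)" snd for h]) auto
  finally have "(cmod (\<Sum>k\<in>?K. z k))\<^sup>2 =
      cmod (\<Sum>h\<in>{-int m<..<int m}. \<Sum>k\<in>{k\<in>?K. k + h \<in> ?K}. z (k + h) * cnj (z k))"
    by (metis norm_of_real abs_of_nonneg zero_le_power2)
  also have "\<dots> \<le> (\<Sum>h\<in>{-int m<..<int m}. cmod (\<Sum>k\<in>{k\<in>?K. k + h \<in> ?K}. z (k + h) * cnj (z k)))"
    by (rule norm_sum)
  finally show ?thesis .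
qed

lemma sum_e_residues:
  assumes "m > 0"
  shows "(\<Sum>r\<in>{0..<int m}. e (of_int r * of_int s / real m)) = (if int m dvd s then of_nat m else 0)"
proof (cases "int m dvd s")
  case True
  then obtain t where "s = int m * t" by blast
  hence "of_int r * of_int s / real m = of_int (r * t)" for r
    using assms by simp
  thus ?thesis using True by (simp only: e_of_int) simp
next
  case False
  let ?z = "e (of_int s / real m)"
  have "?z \<noteq> 1"
  proof
    assume "?z = 1"
    then obtain n :: int where "2 * pi * (of_int s / real m) = of_int (2 * n) * pi"
      by (auto simp: e_def exp_eq_1)
    hence "2 * pi * (of_int s / real m) = 2 * pi * of_int n" by simp
    hence "of_int s / real m = (of_int n :: real)"
      by (metis mult_left_cancel pi_neq_zero mult_eq_0_iff zero_neq_numeral)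
    hence "real_of_int s = of_int (int m * n)" using assms by (simp add: field_simps)
    hence "s = int m * n" by (simp only: of_int_eq_iff)
    thus False using False by simp
  qed
  have "?z ^ m = 1"
    unfolding e_power using assms by simp
  have "(\<Sum>r\<in>{0..<int m}. e (of_int r * of_int s / real m)) = (\<Sum>j<m. ?z ^ j)"
    by (rule sum.reindex_bij_witness[of _ int nat]) (auto simp: e_power)
  also have "\<dots> = 0"
    using \<open>?z \<noteq> 1\<close> \<open>?z ^ m = 1\<close> by (simp add: geometric_sum)
  finally show ?thesis using False by simp
qed

text \<open>Over a full period of r, orthogonality leaves p times the number of coinciding
  frequencies; the range of r is covered by R/p + 1 periods.\<close>

lemma mean_square_exponential_sum:
  assumes p: "p > 0" and K: "finite K"
  shows "(\<Sum>r\<in>{a..<a + int R}. (cmod (\<Sum>k\<in>K. e (of_int r * of_int (y k) / real p)))\<^sup>2)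
    \<le> (real R + real p) * real (card {(k, k')\<in>K \<times> K. [y k = y k'] (mod int p)})"
proof -
  define g where "g = (\<lambda>r. (cmod (\<Sum>k\<in>K. e (of_int r * of_int (y k) / real p)))\<^sup>2)"
  let ?C = "card {(k, k')\<in>K \<times> K. [y k = y k'] (mod int p)}"
  have "complex_of_real (\<Sum>r\<in>{0..<int p}. g r) =
      (\<Sum>r\<in>{0..<int p}. (\<Sum>k\<in>K. e (of_int r * of_int (y k) / real p)) *
         cnj (\<Sum>k\<in>K. e (of_int r * of_int (y k) / real p)))"
    unfolding g_def of_real_sum complex_norm_square ..
  also have "\<dots> = (\<Sum>r\<in>{0..<int p}. \<Sum>x\<in>K \<times> K. e (of_int r * of_int (y (fst x) - y (snd x)) / real p))"
    unfolding cnj_sum sum_product sum.cartesian_product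
    by (intro sum.cong refl)
       (auto simp: cnj_e e_add[symmetric] diff_divide_distrib right_diff_distrib)
  also have "\<dots> = (\<Sum>x\<in>K \<times> K. \<Sum>r\<in>{0..<int p}. e (of_int r * of_int (y (fst x) - y (snd x)) / real p))"
    by (rule sum.swap)
  also have "\<dots> = (\<Sum>x\<in>K \<times> K. if [y (fst x) = y (snd x)] (mod int p) then of_nat p else 0)"
    unfolding sum_e_residues[OF p] by (simp add: cong_iff_dvd_diff)
  also have "\<dots> = (\<Sum>x\<in>{x\<in>K \<times> K. [y (fst x) = y (snd x)] (mod int p)}. of_nat p)"
    using K by (intro sum.inter_filter[symmetric]) auto
  also have "\<dots> = complex_of_real (real p * real ?C)"
  proof -
    have "{x\<in>K \<times> K. [y (fst x) = y (snd x)] (mod int p)} = {(k, k')\<in>K \<times> K. [y k = y k'] (mod int p)}"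
      by auto
    thus ?thesis by (simp add: mult.commute)
  qed
  finally have eq: "(\<Sum>r\<in>{0..<int p}. g r) = real p * real ?C"
    by (simp only: of_real_eq_iff)
  have "(\<Sum>r\<in>{a..<a + int R}. g r) \<le> (real R / real p + 1) * (\<Sum>r\<in>{0..<int p}. g r)"
  proof (rule sum_periodic_le[OF p])
    fix r
    have "e (of_int r * of_int (y k) / real p) = e (of_int (r mod int p) * of_int (y k) / real p)" for k
      using e_int_div_eqI[of "r * y k" "r mod int p * y k" p] p
      by (simp add: cong_def mod_mult_left_eq)
    thus "g r = g (r mod int p)" by (simp only: g_def)
  qed (simp add: g_def)
  also have "\<dots> = (real R + real p) * real ?C"
    using p by (simp add: eq field_simps)
  finally show ?thesis by (simp only: g_def)
qed

text \<open>For fixed \<open>d\<close> the difference \<open>1 / (n + d) - 1 / n = -d / (n (n + d))\<close> modulo \<open>p\<close>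
  determines \<open>n\<close> up to the involution \<open>n \<mapsto> -n - d\<close>.\<close>
lemma inverse_difference_cong:
  fixes x :: "int \<Rightarrow> int"
  assumes p: "prime p" and x: "\<And>n. \<not> int p dvd n \<Longrightarrow> [n * x n = 1] (mod int p)"
    and n: "\<not> int p dvd n" "\<not> int p dvd n + d" and n': "\<not> int p dvd n'" "\<not> int p dvd n' + d"
    and d: "\<not> int p dvd d" and eq: "[x (n + d) - x n = x (n' + d) - x n'] (mod int p)"
  shows "int p dvd n' - n \<or> int p dvd n' + n + d"
proof -
  have key: "[(x (n + d) - x n) * (n * (n + d)) = - d] (mod int p)"
    if "\<not> int p dvd n" "\<not> int p dvd n + d" for n
  proof -
    have "int p dvd ((n + d) * x (n + d) - 1) * n - (n * x n - 1) * (n + d)"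
      using x[OF that(1)] x[OF that(2)] by (simp add: cong_iff_dvd_diff)
    also have "((n + d) * x (n + d) - 1) * n - (n * x n - 1) * (n + d) =
        (x (n + d) - x n) * (n * (n + d)) - (- d)"
      by (simp add: algebra_simps)
    finally show ?thesis by (simp add: cong_iff_dvd_diff)
  qed
  let ?y = "x (n' + d) - x n'"
  have "[?y * (n' * (n' + d)) = ?y * (n * (n + d))] (mod int p)"
    using key[OF n] key[OF n'] cong_scalar_right[OF eq, of "n * (n + d)"] cong_sym cong_trans by blast
  moreover have "coprime ?y (int p)"
  proof -
    have "\<not> int p dvd ?y"
    proof
      assume "int p dvd ?y"
      hence "int p dvd ?y * (n' * (n' + d))" by simp
      hence "int p dvd - d" using key[OF n'] cong_dvd_iff by blast
      thus False using d by simp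
    qed
    thus ?thesis using p coprime_prime_iff by blast
  qed
  ultimately have "[n' * (n' + d) = n * (n + d)] (mod int p)"
    using cong_mult_lcancel by blast
  hence "int p dvd n' * (n' + d) - n * (n + d)" by (simp add: cong_iff_dvd_diff)
  also have "n' * (n' + d) - n * (n + d) = (n' - n) * (n' + n + d)" by (simp add: algebra_simps)
  finally show ?thesis using p by (simp add: prime_dvd_mult_iff)
qed

lemma int_eqI_mod_small:
  fixes k k' :: int
  assumes "int p dvd k - k'" "0 \<le> k" "k < int m" "0 \<le> k'" "k' < int m" "m \<le> p"
  shows "k = k'"
proof -
  have "[k = k'] (mod int p)" using assms(1) by (simp add: cong_iff_dvd_diff)
  thus ?thesis using assms by (simp add: cong_def)
qed

text \<open>For fixed k, \<open>inverse_difference_cong\<close> puts k' into one of two linear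
  congruences modulo p. As q is invertible and m <= p, each has at most one solution below m, so
  every k has at most two partners.\<close>

lemma card_inverse_difference_pairs:
  fixes x :: "int \<Rightarrow> int"
  assumes p: "prime p" and x: "\<And>n. \<not> int p dvd n \<Longrightarrow> [n * x n = 1] (mod int p)"
    and q: "\<not> int p dvd q" and m: "m \<le> p" and h: "h \<noteq> 0" "\<bar>h\<bar> < int m"
    and K: "K \<subseteq> {k\<in>{0..<int m}. \<not> int p dvd b + q * k \<and> \<not> int p dvd b + q * (k + h)}"
  shows "card {(k, k')\<in>K \<times> K. [x (b + q * (k + h)) - x (b + q * k) = x (b + q * (k' + h)) - x (b + q * k')] (mod int p)} \<le> 2 * m"
proof -
  let ?y = "\<lambda>k. x (b + q * (k + h)) - x (b + q * k)"
  have finK: "finite K" by (rule finite_subset[of _ "{0..<int m}"]) (use K in auto)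
  have pq: "int p dvd q * t \<longleftrightarrow> int p dvd t" for t
    using p q by (simp add: prime_dvd_mult_iff)
  have nd: "\<not> int p dvd q * h"
  proof
    assume "int p dvd q * h"
    hence "int p dvd h" by (simp add: pq)
    hence "int p \<le> \<bar>h\<bar>" using dvd_imp_le_int[OF h(1), of "int p"] by simp
    thus False using h m by simp
  qed
  have fibre: "card {k'\<in>K. [?y k = ?y k'] (mod int p)} \<le> 2" if k: "k \<in> K" for k
  proof -
    let ?A = "{k'\<in>{0..<int m}. int p dvd k' - k}"
    let ?B = "{k'\<in>{0..<int m}. int p dvd 2 * b + q * (k' + k + h)}"
    have "{k'\<in>K. [?y k = ?y k'] (mod int p)} \<subseteq> ?A \<union> ?B"
    proof
      fix k' assume "k' \<in> {k'\<in>K. [?y k = ?y k'] (mod int p)}"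
      hence k': "k' \<in> K" "[?y k = ?y k'] (mod int p)" by auto
      have "int p dvd (b + q * k') - (b + q * k) \<or> int p dvd (b + q * k') + (b + q * k) + q * h"
        by (rule inverse_difference_cong[OF p x])
           (use k k' K nd in \<open>auto simp: distrib_left add.assoc\<close>)
      moreover have "(b + q * k') - (b + q * k) = q * (k' - k)"
        by (simp add: algebra_simps)
      moreover have "(b + q * k') + (b + q * k) + q * h = 2 * b + q * (k' + k + h)"
        by (simp add: algebra_simps)
      ultimately have "int p dvd k' - k \<or> int p dvd 2 * b + q * (k' + k + h)"
        by (simp only: pq)
      thus "k' \<in> ?A \<union> ?B" using k' K by auto
    qed
    moreover have fin: "finite ?A" "finite ?B"
      by (rule finite_subset[of _ "{0..<int m}"]; auto)+
    ultimately have "card {k'\<in>K. [?y k = ?y k'] (mod int p)} \<le> card (?A \<union> ?B)"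
      by (intro card_mono finite_UnI)
    also have "\<dots> \<le> card ?A + card ?B" by (rule card_Un_le)
    also have "card ?A \<le> Suc 0"
    proof (rule iffD2[OF card_le_Suc0_iff_eq[OF fin(1)]], intro ballI)
      fix u v assume uv: "u \<in> ?A" "v \<in> ?A"
      hence "int p dvd u - k" "int p dvd v - k" by auto
      hence "int p dvd (u - k) - (v - k)" by (rule dvd_diff)
      thus "u = v" using uv m by (intro int_eqI_mod_small[of p u v m]) auto
    qed
    also have "card ?B \<le> Suc 0"
    proof (rule iffD2[OF card_le_Suc0_iff_eq[OF fin(2)]], intro ballI)
      fix u v assume uv: "u \<in> ?B" "v \<in> ?B"
      hence "int p dvd 2 * b + q * (u + k + h)" "int p dvd 2 * b + q * (v + k + h)" by auto
      hence "int p dvd (2 * b + q * (u + k + h)) - (2 * b + q * (v + k + h))" by (rule dvd_diff)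
      also have "(2 * b + q * (u + k + h)) - (2 * b + q * (v + k + h)) = q * (u - v)"
        by (simp add: algebra_simps)
      finally have "int p dvd u - v" by (simp add: pq)
      thus "u = v" using uv m by (intro int_eqI_mod_small[of p u v m]) auto
    qed
    finally show ?thesis by simp
  qed
  have "{(k, k')\<in>K \<times> K. [?y k = ?y k'] (mod int p)} = Sigma K (\<lambda>k. {k'\<in>K. [?y k = ?y k'] (mod int p)})"
    by auto
  hence "card {(k, k')\<in>K \<times> K. [?y k = ?y k'] (mod int p)} =
      (\<Sum>k\<in>K. card {k'\<in>K. [?y k = ?y k'] (mod int p)})"
    using finK by simp
  also have "\<dots> \<le> (\<Sum>k\<in>K. 2)" by (intro sum_mono fibre)
  also have "\<dots> \<le> 2 * m"
  proof -
    have "card K \<le> card {0..<int m}" by (rule card_mono) (use K in auto)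
    thus ?thesis by simp
  qed
  finally show ?thesis .
qed

text \<open>The frequency \<open>\<theta>\<close> may depend on \<open>r\<close>, so the sum over \<open>r\<close> can only be used for cancellation after
  differencing in \<open>k\<close> has removed the linear phase.\<close>
lemma inverse_sum_mean_square:
  fixes x :: "int \<Rightarrow> int" and \<theta> :: "int \<Rightarrow> real"
  assumes p: "prime p" and x: "\<And>n. \<not> int p dvd n \<Longrightarrow> [n * x n = 1] (mod int p)"
    and q: "\<not> int p dvd q" and m: "m \<le> p"
  shows "(\<Sum>r\<in>{a..<a + int R}. (cmod (\<Sum>k\<in>{0..<int m}.
      (if int p dvd b + q * k then 0 else e (of_int k * \<theta> r) * e (- of_int (r * x (b + q * k)) / real p))))\<^sup>2)
    \<le> real R * real m + 2 * real m * sqrt (real R * ((real R + real p) * (2 * real m)))"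
proof -
  define z where "z = (\<lambda>r k. if int p dvd b + q * k then 0
      else e (of_int k * \<theta> r) * e (- of_int (r * x (b + q * k)) / real p))"
  define K where "K = (\<lambda>h. {k\<in>{0..<int m}. k + h \<in> {0..<int m}
      \<and> \<not> int p dvd b + q * k \<and> \<not> int p dvd b + q * (k + h)})"
  define y where "y = (\<lambda>h k. x (b + q * (k + h)) - x (b + q * k))"
  define W where "W = (\<lambda>h r. cmod (\<Sum>k\<in>K h. e (of_int r * of_int (- y h k) / real p)))"
  define B where "B = sqrt (real R * ((real R + real p) * (2 * real m)))"
  let ?R = "{a..<a + int R}"
  have p0: "p > 0" using p by (simp add: prime_gt_0_nat)
  have finK: "finite (K h)" for h
    by (rule finite_subset[of _ "{0..<int m}"]) (auto simp: K_def)
  have corr: "cmod (\<Sum>k\<in>{k\<in>{0..<int m}. k + h \<in> {0..<int m}}. z r (k + h) * cnj (z r k)) = W h r" for h r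
  proof -
    have "(\<Sum>k\<in>{k\<in>{0..<int m}. k + h \<in> {0..<int m}}. z r (k + h) * cnj (z r k)) =
        (\<Sum>k\<in>K h. z r (k + h) * cnj (z r k))"
    proof (rule sum.mono_neutral_right)
      show "finite {k\<in>{0..<int m}. k + h \<in> {0..<int m}}"
        by (rule finite_subset[of _ "{0..<int m}"]) auto
    qed (auto simp: K_def z_def)
    also have "\<dots> = (\<Sum>k\<in>K h. e (of_int h * \<theta> r) * e (of_int r * of_int (- y h k) / real p))"
    proof (rule sum.cong[OF refl])
      fix k assume "k \<in> K h"
      hence "z r (k + h) * cnj (z r k) =
          e (of_int (k + h) * \<theta> r + - of_int (r * x (b + q * (k + h))) / real p
            + (- (of_int k * \<theta> r + - of_int (r * x (b + q * k)) / real p)))"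
        by (simp add: K_def z_def e_add[symmetric] cnj_e)
      also have "of_int (k + h) * \<theta> r + - of_int (r * x (b + q * (k + h))) / real p
            + (- (of_int k * \<theta> r + - of_int (r * x (b + q * k)) / real p)) =
          of_int h * \<theta> r + of_int r * of_int (- y h k) / real p"
        using p0 by (simp add: y_def field_simps)
      finally show "z r (k + h) * cnj (z r k) = e (of_int h * \<theta> r) * e (of_int r * of_int (- y h k) / real p)"
        by (simp only: e_add)
    qed
    also have "cmod \<dots> = W h r"
      by (simp only: sum_distrib_left[symmetric] norm_mult norm_e W_def mult_1)
    finally show ?thesis .
  qed
  have cardK: "card (K h) \<le> m" for h
  proof -
    have "card (K h) \<le> card {0..<int m}" by (rule card_mono) (auto simp: K_def)
    thus ?thesis by simp
  qed
  \<comment> \<open>For h = 0 all frequencies vanish, so only the trivial bound is available; this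
    is the diagonal term R m.\<close>
  have W0: "(\<Sum>r\<in>?R. W 0 r) \<le> real R * real m"
  proof -
    have "W 0 r \<le> real m" for r
    proof -
      have "W 0 r \<le> (\<Sum>k\<in>K 0. 1)"
        unfolding W_def by (rule order_trans[OF norm_sum]) simp
      thus ?thesis using cardK[of 0] by simp
    qed
    hence "(\<Sum>r\<in>?R. W 0 r) \<le> (\<Sum>r\<in>?R. real m)" by (intro sum_mono)
    thus ?thesis by simp
  qed
  \<comment> \<open>Cauchy--Schwarz over r restores a square, to which orthogonality in r and the
    count of at most 2 m coincidences apply.\<close>
  have Wh: "(\<Sum>r\<in>?R. W h r) \<le> B" if h: "h \<in> {-int m<..<int m} - {0}" for h
  proof -
    have "(\<Sum>r\<in>?R. W h r)\<^sup>2 = (\<Sum>r\<in>?R. 1 * W h r)\<^sup>2" by simp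
    also have "\<dots> \<le> (\<Sum>r\<in>?R. 1\<^sup>2) * (\<Sum>r\<in>?R. (W h r)\<^sup>2)"
      by (rule Cauchy_Schwarz_ineq_sum)
    also have "(\<Sum>r\<in>?R. 1\<^sup>2) = real R" by simp
    also have "(\<Sum>r\<in>?R. (W h r)\<^sup>2) \<le> (real R + real p) * real (card {(k, k')\<in>K h \<times> K h. [- y h k = - y h k'] (mod int p)})"
      unfolding W_def by (rule mean_square_exponential_sum[OF p0 finK])
    also have "{(k, k')\<in>K h \<times> K h. [- y h k = - y h k'] (mod int p)} = {(k, k')\<in>K h \<times> K h. [y h k = y h k'] (mod int p)}"
      by (simp add: cong_minus_minus_iff)
    also have "card \<dots> \<le> 2 * m"
      unfolding y_def
      by (rule card_inverse_difference_pairs[OF p x q m]) (use h in \<open>auto simp: K_def\<close>)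
    finally have "(\<Sum>r\<in>?R. W h r)\<^sup>2 \<le> real R * ((real R + real p) * (2 * real m))"
      by (simp add: mult_left_mono)
    thus ?thesis unfolding B_def by (rule real_le_rsqrt)
  qed
  have "(\<Sum>r\<in>?R. (cmod (\<Sum>k\<in>{0..<int m}. z r k))\<^sup>2) \<le> (\<Sum>r\<in>?R. \<Sum>h\<in>{-int m<..<int m}. W h r)"
    by (intro sum_mono, rule order_trans[OF norm_square_sum_le_correlations]) (simp only: corr order_refl)
  also have "\<dots> = (\<Sum>h\<in>{-int m<..<int m}. \<Sum>r\<in>?R. W h r)" by (rule sum.swap)
  also have "\<dots> \<le> real R * real m + 2 * real m * B"
  proof (cases "m = 0")
    case False
    have "(\<Sum>h\<in>{-int m<..<int m}. \<Sum>r\<in>?R. W h r) =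
        (\<Sum>r\<in>?R. W 0 r) + (\<Sum>h\<in>{-int m<..<int m} - {0}. \<Sum>r\<in>?R. W h r)"
      using False by (intro sum.remove) auto
    also have "(\<Sum>h\<in>{-int m<..<int m} - {0}. \<Sum>r\<in>?R. W h r) \<le> (\<Sum>h\<in>{-int m<..<int m} - {0}. B)"
      by (intro sum_mono Wh)
    also have "\<dots> \<le> 2 * real m * B"
    proof -
      have "card ({-int m<..<int m} - {0}) \<le> card {-int m<..<int m}"
        by (intro card_mono) auto
      also have "\<dots> \<le> 2 * m" by simp
      finally have "real (card ({-int m<..<int m} - {0})) \<le> 2 * real m" by linarith
      thus ?thesis by (simp add: B_def mult_right_mono)
    qed
    finally show ?thesis using W0 by linarith
  qed simp
  finally show ?thesis by (simp only: z_def B_def)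
qed

section \<open>Completing incomplete sums\<close>

text \<open>A weighted l1 norm of the discrete Fourier transform of z on the residues modulo m. The
  weights bound the transform of every window, so one quantity serves for windows that vary with
  r.\<close>

definition window_majorant :: "nat \<Rightarrow> (int \<Rightarrow> complex) \<Rightarrow> real" where
  "window_majorant m z = (\<Sum>c\<in>{0..<int m}. dker (real m) m c / real m *
     cmod (\<Sum>k\<in>{0..<int m}. z k * e (of_int k * of_int c / real m)))"

lemma window_majorant_nonneg: "window_majorant m z \<ge> 0"
  unfolding window_majorant_def
  by (cases "m = 0") (auto intro!: sum_nonneg mult_nonneg_nonneg divide_nonneg_nonneg dker_nonneg)

lemma norm_window_sum_le:
  assumes "m > 0" "0 \<le> i" "j \<le> int m"
  shows "cmod (\<Sum>k\<in>{i..<j}. z k) \<le> window_majorant m z"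
proof -
  let ?M = "{0..<int m}"
  have "(\<Sum>k\<in>{i..<j}. z k) = (\<Sum>k\<in>?M. z k * (if k \<in> {i..<j} then 1 else 0))"
    using assms by (intro sum.mono_neutral_cong_left) auto
  \<comment> \<open>Orthogonality modulo m detects k = l. Congruence means equality here because k
    and l both lie in \<open>{0..<int m}\<close>.\<close>
  also have "\<dots> = (\<Sum>k\<in>?M. z k * (1 / of_nat m * (\<Sum>l\<in>{i..<j}. \<Sum>c\<in>?M. e (of_int c * of_int (k - l) / real m))))"
  proof (rule sum.cong[OF refl])
    fix k assume k: "k \<in> ?M"
    have "(\<Sum>l\<in>{i..<j}. \<Sum>c\<in>?M. e (of_int c * of_int (k - l) / real m)) =
        (\<Sum>l\<in>{i..<j}. if int m dvd k - l then of_nat m else 0)"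
      by (intro sum.cong refl sum_e_residues assms)
    also have "\<dots> = (\<Sum>l\<in>{i..<j}. if l = k then of_nat m else 0)"
    proof (rule sum.cong[OF refl])
      fix l assume l: "l \<in> {i..<j}"
      have "int m dvd k - l \<longleftrightarrow> l = k"
        using int_eqI_mod_small[of m k l m] k l assms by auto
      thus "(if int m dvd k - l then of_nat m else 0 :: complex) = (if l = k then of_nat m else 0)" by simp
    qed
    also have "\<dots> = of_nat m * (if k \<in> {i..<j} then 1 else 0)" by simp
    finally show "z k * (if k \<in> {i..<j} then 1 else 0) = z k * (1 / of_nat m * (\<Sum>l\<in>{i..<j}. \<Sum>c\<in>?M. e (of_int c * of_int (k - l) / real m)))"
      using assms(1) by simp
  qed
  also have "\<dots> = (\<Sum>k\<in>?M. \<Sum>c\<in>?M. 1 / of_nat m * cnj (\<Sum>l\<in>{i..<j}. e (of_int l * of_int c / real m)) *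
      (z k * e (of_int k * of_int c / real m)))"
  proof (rule sum.cong[OF refl])
    fix k
    have "e (of_int c * of_int (k - l) / real m) =
        cnj (e (of_int l * of_int c / real m)) * e (of_int k * of_int c / real m)" for c l
      by (simp add: cnj_e e_add[symmetric] diff_divide_distrib right_diff_distrib mult.commute)
    hence "(\<Sum>l\<in>{i..<j}. \<Sum>c\<in>?M. e (of_int c * of_int (k - l) / real m)) =
        (\<Sum>c\<in>?M. cnj (\<Sum>l\<in>{i..<j}. e (of_int l * of_int c / real m)) * e (of_int k * of_int c / real m))"
      by (subst sum.swap) (simp add: sum_distrib_right)
    thus "z k * (1 / of_nat m * (\<Sum>l\<in>{i..<j}. \<Sum>c\<in>?M. e (of_int c * of_int (k - l) / real m))) =
        (\<Sum>c\<in>?M. 1 / of_nat m * cnj (\<Sum>l\<in>{i..<j}. e (of_int l * of_int c / real m)) *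
          (z k * e (of_int k * of_int c / real m)))"
      by (simp add: sum_distrib_left mult_ac)
  qed
  also have "\<dots> = (\<Sum>c\<in>?M. 1 / of_nat m * cnj (\<Sum>l\<in>{i..<j}. e (of_int l * of_int c / real m)) *
      (\<Sum>k\<in>?M. z k * e (of_int k * of_int c / real m)))"
    by (subst sum.swap) (simp only: sum_distrib_left)
  also have "cmod \<dots> \<le> (\<Sum>c\<in>?M. cmod (1 / of_nat m * cnj (\<Sum>l\<in>{i..<j}. e (of_int l * of_int c / real m)) *
      (\<Sum>k\<in>?M. z k * e (of_int k * of_int c / real m))))"
    by (rule norm_sum)
  also have "\<dots> \<le> window_majorant m z"
    unfolding window_majorant_def
  proof (rule sum_mono)
    fix c
    have "cmod (\<Sum>l\<in>{i..<j}. e (of_int l * of_int c / real m)) \<le> dker (real m) m c"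
      by (rule norm_geometric_e_le) (use assms in auto)
    hence "cmod (1 / of_nat m * cnj (\<Sum>l\<in>{i..<j}. e (of_int l * of_int c / real m))) \<le> dker (real m) m c / real m"
      using assms(1) by (simp only: norm_mult complex_mod_cnj norm_divide norm_of_nat norm_one) (simp add: divide_right_mono)
    thus "cmod (1 / of_nat m * cnj (\<Sum>l\<in>{i..<j}. e (of_int l * of_int c / real m)) *
        (\<Sum>k\<in>?M. z k * e (of_int k * of_int c / real m)))
        \<le> dker (real m) m c / real m * cmod (\<Sum>k\<in>?M. z k * e (of_int k * of_int c / real m))"
      by (simp only: norm_mult[of _ "\<Sum>k\<in>?M. z k * e (of_int k * of_int c / real m)"]) (rule mult_right_mono, auto)
  qed
  finally show ?thesis .
qed

text \<open>Cauchy--Schwarz with the weights \<open>dker / m\<close>, whose total is at most 2 + ln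
  m, once for the square and once for the average. The hypothesis covers every twist c because
  completion introduces all of them.\<close>

lemma window_majorant_mean_square:
  assumes m: "m > 0"
    and A: "\<And>c. (\<Sum>r\<in>R. (cmod (\<Sum>k\<in>{0..<int m}. z r k * e (of_int k * of_int c / real m)))\<^sup>2) \<le> A"
  shows "(\<Sum>r\<in>R. (window_majorant m (z r))\<^sup>2) \<le> (2 + ln (real m))\<^sup>2 * A"
proof -
  let ?M = "{0..<int m}"
  define w where "w = (\<lambda>c. dker (real m) m c / real m)"
  define t where "t = (\<lambda>r c. cmod (\<Sum>k\<in>?M. z r k * e (of_int k * of_int c / real m)))"
  define S where "S = (\<Sum>c\<in>?M. w c)"
  have w0: "w c \<ge> 0" for c using m by (simp add: w_def dker_nonneg)
  have "A \<ge> 0" by (rule order_trans[OF _ A[of 0]]) (simp add: sum_nonneg)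
  have S0: "S \<ge> 0" using w0 by (simp add: S_def sum_nonneg)
  have "S = (\<Sum>c\<in>?M. dker (real m) m c) / real m"
    by (simp add: S_def w_def sum_divide_distrib)
  also have "\<dots> \<le> (real m + real m * (1 + ln (real m))) / real m"
    by (intro divide_right_mono sum_dker_le) (use m in auto)
  also have "\<dots> = 2 + ln (real m)" using m by (simp add: field_simps)
  finally have S: "S \<le> 2 + ln (real m)" .
  have "(\<Sum>r\<in>R. (window_majorant m (z r))\<^sup>2) \<le> (\<Sum>r\<in>R. S * (\<Sum>c\<in>?M. w c * (t r c)\<^sup>2))"
  proof (rule sum_mono)
    fix r
    have "(window_majorant m (z r))\<^sup>2 = (\<Sum>c\<in>?M. sqrt (w c) * (sqrt (w c) * t r c))\<^sup>2"
    proof -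
      have "sqrt (w c) * (sqrt (w c) * t r c) = w c * t r c" for c
        using w0[of c] by (simp add: mult.assoc[symmetric])
      thus ?thesis by (simp only: window_majorant_def w_def t_def)
    qed
    also have "\<dots> \<le> (\<Sum>c\<in>?M. (sqrt (w c))\<^sup>2) * (\<Sum>c\<in>?M. (sqrt (w c) * t r c)\<^sup>2)"
      by (rule Cauchy_Schwarz_ineq_sum)
    also have "\<dots> = S * (\<Sum>c\<in>?M. w c * (t r c)\<^sup>2)"
      using w0 by (simp add: S_def power_mult_distrib)
    finally show "(window_majorant m (z r))\<^sup>2 \<le> S * (\<Sum>c\<in>?M. w c * (t r c)\<^sup>2)" .
  qed
  also have "\<dots> = S * (\<Sum>c\<in>?M. w c * (\<Sum>r\<in>R. (t r c)\<^sup>2))"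
    unfolding sum_distrib_left by (rule sum.swap)
  also have "\<dots> \<le> S * (\<Sum>c\<in>?M. w c * A)"
    using A w0 S0 unfolding t_def by (intro mult_left_mono sum_mono) auto
  also have "\<dots> = S\<^sup>2 * A"
    by (simp only: S_def sum_distrib_right[symmetric] power2_eq_square mult.assoc)
  also have "\<dots> \<le> (2 + ln (real m))\<^sup>2 * A"
    using S S0 \<open>A \<ge> 0\<close> by (intro mult_right_mono power_mono)
  finally show ?thesis .
qed

text \<open>Cutting at multiples of p leaves at most two end pieces, each a window of one period up
  to a phase. The full periods between them are copies of one sum with phases in geometric
  progression, which yields \<open>dker\<close>.\<close>

lemma quasi_periodic_sum_le:
  fixes z :: "int \<Rightarrow> complex"
  assumes p: "p > 0" and q: "q > 0"
    and z: "\<And>k j. z (k + int p * j) = z k * e (of_int j * of_int s / real q)"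
    and J: "of_int (\<beta> - \<alpha>) / real p \<le> J" "J \<ge> 0"
  shows "cmod (\<Sum>k\<in>{\<alpha>..<\<beta>}. z k) \<le> (2 + dker J q s) * window_majorant p z"
proof -
  let ?S = "window_majorant p z"
  define \<alpha>1 \<alpha>0 where "\<alpha>1 = \<alpha> div int p" and "\<alpha>0 = \<alpha> mod int p"
  define \<beta>1 \<beta>0 where "\<beta>1 = \<beta> div int p" and "\<beta>0 = \<beta> mod int p"
  have \<alpha>: "\<alpha> = \<alpha>0 + int p * \<alpha>1" and \<beta>: "\<beta> = \<beta>0 + int p * \<beta>1"
    by (simp_all add: \<alpha>0_def \<alpha>1_def \<beta>0_def \<beta>1_def)
  have \<alpha>0: "0 \<le> \<alpha>0" "\<alpha>0 < int p" and \<beta>0: "0 \<le> \<beta>0" "\<beta>0 < int p"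
    using p by (simp_all add: \<alpha>0_def \<beta>0_def)
  have S0: "?S \<ge> 0" by (rule window_majorant_nonneg)
  have d0: "dker J q s \<ge> 0" using J q by (simp add: dker_nonneg)
  have shift: "(\<Sum>k\<in>{i + int p * t..<j + int p * t}. z k) = (\<Sum>k\<in>{i..<j}. z k) * e (of_int t * of_int s / real q)" for i j t
  proof -
    have "(\<Sum>k\<in>{i + int p * t..<j + int p * t}. z k) = (\<Sum>k\<in>{i..<j}. z (k + int p * t))"
      by (rule sum.reindex_bij_witness[of _ "\<lambda>k. k + int p * t" "\<lambda>k. k - int p * t"]) auto
    thus ?thesis by (simp add: z sum_distrib_right)
  qed
  have part: "cmod (\<Sum>k\<in>{i + int p * t..<j + int p * t}. z k) \<le> ?S" if "0 \<le> i" "j \<le> int p" for i j t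
    unfolding shift norm_mult norm_e using norm_window_sum_le[OF p that] by simp
  show ?thesis
  proof (cases "\<alpha>1 < \<beta>1")
    case False
    have "{\<alpha>..<\<beta>} = (if \<alpha>1 = \<beta>1 then {\<alpha>0 + int p * \<alpha>1..<\<beta>0 + int p * \<alpha>1} else {})"
    proof (cases "\<alpha>1 = \<beta>1")
      case True
      thus ?thesis using \<alpha> \<beta> by simp
    next
      case ne: False
      hence "\<beta> < \<alpha>" using False p unfolding \<alpha>1_def \<beta>1_def
        by (meson linorder_not_le not_less_iff_gr_or_eq zdiv_mono1 of_nat_0_less_iff order_antisym_conv order.strict_iff_order)
      thus ?thesis using ne by simp
    qed
    hence "cmod (\<Sum>k\<in>{\<alpha>..<\<beta>}. z k) \<le> ?S"
      using part[of \<alpha>0 \<beta>0 \<alpha>1] \<alpha>0 \<beta>0 S0 by (simp split: if_splits)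
    also have "\<dots> \<le> (2 + dker J q s) * ?S"
      using S0 d0 mult_right_mono[of 1 "2 + dker J q s" ?S] by simp
    finally show ?thesis .
  next
    case True
    have full: "(\<Sum>k\<in>{int p * u..<int p * (u + int n)}. z k) =
        (\<Sum>t\<in>{u..<u + int n}. e (of_int t * of_int s / real q)) * (\<Sum>k\<in>{0..<int p}. z k)" for u n
    proof (induction n)
      case (Suc n)
      have "{int p * u..<int p * (u + int (Suc n))} =
          {int p * u..<int p * (u + int n)} \<union> {0 + int p * (u + int n)..<int p + int p * (u + int n)}"
      proof -
        have "0 + int p * (u + int n) = int p * (u + int n)"
          "int p + int p * (u + int n) = int p * (u + int (Suc n))"
          by (simp_all add: algebra_simps)
        moreover have "int p * u \<le> int p * (u + int n)" "int p * (u + int n) \<le> int p * (u + int (Suc n))"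
          by (auto intro!: mult_left_mono)
        ultimately show ?thesis by (simp only: ivl_disj_un_two(3))
      qed
      hence "(\<Sum>k\<in>{int p * u..<int p * (u + int (Suc n))}. z k) =
          (\<Sum>k\<in>{int p * u..<int p * (u + int n)}. z k) + (\<Sum>k\<in>{0 + int p * (u + int n)..<int p + int p * (u + int n)}. z k)"
        by (simp add: sum.union_disjoint)
      moreover have "{u..<u + int (Suc n)} = insert (u + int n) {u..<u + int n}" by auto
      ultimately show ?case
        unfolding shift Suc by (simp add: algebra_simps)
    qed simp
    \<comment> \<open>The blocks with index \<open>\<alpha>1\<close> and \<open>\<beta>1\<close>
      always count as end pieces, even if the first is complete, so this many full periods
      remain.\<close>
    define n where "n = nat (\<beta>1 - \<alpha>1 - 1)"
    have n: "\<alpha>1 + 1 + int n = \<beta>1" using True by (simp add: n_def)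
    have eq: "{\<alpha>..<\<beta>} = {\<alpha>0 + int p * \<alpha>1..<int p + int p * \<alpha>1} \<union>
        ({int p * (\<alpha>1 + 1)..<int p * \<beta>1} \<union> {0 + int p * \<beta>1..<\<beta>0 + int p * \<beta>1})"
    proof -
      have "int p * (\<alpha>1 + 1) \<le> int p * \<beta>1" using True by (intro mult_left_mono) auto
      thus ?thesis using \<alpha>0 \<beta>0 unfolding \<alpha> \<beta> by (auto simp: algebra_simps)
    qed
    have "(\<Sum>k\<in>{\<alpha>..<\<beta>}. z k) = (\<Sum>k\<in>{\<alpha>0 + int p * \<alpha>1..<int p + int p * \<alpha>1}. z k) +
        ((\<Sum>k\<in>{int p * (\<alpha>1 + 1)..<int p * \<beta>1}. z k) + (\<Sum>k\<in>{0 + int p * \<beta>1..<\<beta>0 + int p * \<beta>1}. z k))"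
    proof -
      have "int p * (\<alpha>1 + 1) \<le> int p * \<beta>1" using True by (intro mult_left_mono) auto
      thus ?thesis unfolding eq by (subst sum.union_disjoint; force simp: algebra_simps sum.union_disjoint)
    qed
    also have "cmod \<dots> \<le> cmod (\<Sum>k\<in>{\<alpha>0 + int p * \<alpha>1..<int p + int p * \<alpha>1}. z k) +
        (cmod (\<Sum>k\<in>{int p * (\<alpha>1 + 1)..<int p * \<beta>1}. z k) + cmod (\<Sum>k\<in>{0 + int p * \<beta>1..<\<beta>0 + int p * \<beta>1}. z k))"
      by (intro order_trans[OF norm_triangle_ineq] add_left_mono norm_triangle_ineq)
    also have "\<dots> \<le> ?S + (dker J q s * ?S + ?S)"
    proof (intro add_mono)
      have "(\<Sum>k\<in>{int p * (\<alpha>1 + 1)..<int p * \<beta>1}. z k) =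
          (\<Sum>t\<in>{\<alpha>1 + 1..<\<beta>1}. e (of_int t * of_int s / real q)) * (\<Sum>k\<in>{0..<int p}. z k)"
        using full[of "\<alpha>1 + 1" n] unfolding n .
      moreover have "cmod (\<Sum>t\<in>{\<alpha>1 + 1..<\<beta>1}. e (of_int t * of_int s / real q)) \<le> dker J q s"
      proof (rule norm_geometric_e_le[OF q])
        have "int p * (\<beta>1 - \<alpha>1 - 1) \<le> \<beta> - \<alpha>"
          using \<alpha>0 \<beta>0 unfolding \<alpha> \<beta> by (simp add: algebra_simps)
        hence "real p * of_int (\<beta>1 - \<alpha>1 - 1) \<le> of_int (\<beta> - \<alpha>)"
          by (metis of_int_le_iff of_int_mult of_int_of_nat_eq)
        hence "of_int (\<beta>1 - \<alpha>1 - 1) \<le> of_int (\<beta> - \<alpha>) / real p"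
          using p by (simp add: field_simps)
        moreover have "real (card {\<alpha>1 + 1..<\<beta>1}) = of_int (\<beta>1 - \<alpha>1 - 1)"
          using True by (simp add: of_nat_nat)
        ultimately show "real (card {\<alpha>1 + 1..<\<beta>1}) \<le> J" using J by linarith
      qed
      moreover have "cmod (\<Sum>k\<in>{0..<int p}. z k) \<le> ?S"
        by (rule norm_window_sum_le[OF p]) auto
      ultimately show "cmod (\<Sum>k\<in>{int p * (\<alpha>1 + 1)..<int p * \<beta>1}. z k) \<le> dker J q s * ?S"
        using d0 by (simp only: norm_mult) (intro mult_mono; simp)
    qed (rule part; use \<alpha>0 \<beta>0 in simp)+
    also have "\<dots> = (2 + dker J q s) * ?S" by (simp add: algebra_simps)
    finally show ?thesis .
  qed
qed

section \<open>Pair bounds for very short and very long intervals\<close>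

lemma int_le_div_iff: "m > 0 \<Longrightarrow> j \<le> x div m \<longleftrightarrow> j * m \<le> (x :: int)"
proof
  assume m: "m > 0" and j: "j \<le> x div m"
  have "j * m \<le> x div m * m" using m j by (intro mult_right_mono) auto
  also have "\<dots> \<le> x" using m div_mult_mod_eq[of x m] pos_mod_sign[of m x] by linarith
  finally show "j * m \<le> x" .
next
  assume m: "m > 0" and j: "j * m \<le> x"
  have "x < (x div m + 1) * m"
    unfolding distrib_right using m div_mult_mod_eq[of x m] pos_mod_bound[of m x] by linarith
  with j have "j * m < (x div m + 1) * m" by linarith
  thus "j \<le> x div m" using m by (simp add: mult_less_cancel_right)
qed

lemma residue_class_interval:
  assumes "m > 0"
  obtains u v where "\<And>k. b + int m * k \<in> {a..<a + int N} \<longleftrightarrow> k \<in> {u..<v}"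
    and "real (card {u..<v}) \<le> real N / real m + 1"
proof
  \<comment> \<open>Negated floors are ceilings: these are the ceilings of (a - b)/m and (a + N -
    b)/m.\<close>
  let ?u = "- ((b - a) div int m)" and ?v = "- ((b - a - int N) div int m)"
  fix k
  have "- k \<le> (b - a) div int m \<longleftrightarrow> - k * int m \<le> b - a"
    "- k \<le> (b - a - int N) div int m \<longleftrightarrow> - k * int m \<le> b - a - int N"
    using assms by (intro int_le_div_iff; simp)+
  thus "b + int m * k \<in> {a..<a + int N} \<longleftrightarrow> k \<in> {?u..<?v}"
    by (auto simp: algebra_simps)
next
  let ?u = "- ((b - a) div int m)" and ?v = "- ((b - a - int N) div int m)"
  have "real_of_int ((b - a) div int m) \<le> of_int (b - a) / of_int (int m)"
    by (rule real_of_int_div4)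
  moreover have "of_int (b - a - int N) / of_int (int m) - real_of_int ((b - a - int N) div int m) \<le> 1"
    by (rule real_of_int_div3)
  moreover have "real_of_int (b - a) / of_int (int m) = of_int (b - a - int N) / of_int (int m) + real N / real m"
    by (simp add: diff_divide_distrib)
  ultimately have "real_of_int (?v - ?u) \<le> real N / real m + 1"
    by (simp only: of_int_diff of_int_minus)
  hence "real (nat (?v - ?u)) \<le> real N / real m + 1"
    by (cases "?v - ?u \<ge> 0") (simp_all only: of_nat_nat nat_le_0, simp_all)
  thus "real (card {?u..<?v}) \<le> real N / real m + 1" by simp
qed

lemma pair_bound_short_interval:
  assumes p: "prime p" "twisted p G" "N \<le> p" and q: "prime q" "twisted q F" "N \<le> q"
  shows "(cmod (\<Sum>n\<in>{a..<a + int N}. F n * cnj (G n)))\<^sup>2 \<le> 4 * sqsum q F * sqsum p G"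
proof -
  have two: "(\<Sum>n\<in>{a..<a + int N}. (cmod (F n))\<^sup>2) \<le> 2 * sqsum q F"
    if "prime q" "twisted q F" "N \<le> q" for q F
  proof -
    have "(\<Sum>n\<in>{a..<a + int N}. (cmod (F n))\<^sup>2) \<le> (real N / real q + 1) * sqsum q F"
      by (rule sum_twisted_square_le[OF that(1,2)])
    also have "\<dots> \<le> 2 * sqsum q F"
      using that by (intro mult_right_mono) (auto simp: prime_gt_0_nat)
    finally show ?thesis .
  qed
  have "(cmod (\<Sum>n\<in>{a..<a + int N}. F n * cnj (G n)))\<^sup>2
      \<le> (\<Sum>n\<in>{a..<a + int N}. (cmod (F n))\<^sup>2) * (\<Sum>n\<in>{a..<a + int N}. (cmod (cnj (G n)))\<^sup>2)"
    by (rule norm_sum_square_le)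
  also have "\<dots> \<le> (2 * sqsum q F) * (2 * sqsum p G)"
    unfolding complex_mod_cnj using p q by (intro mult_mono two sum_nonneg) auto
  finally show ?thesis by (simp add: mult_ac)
qed

lemma distinct_primes_dvd_mult:
  assumes "prime p" "prime q" "p \<noteq> q" "int p dvd x" "int q dvd x"
  shows "int (p * q) dvd x"
  using assms primes_coprime[of p q] by (simp add: divides_mult)

lemma inverse_cong_unique:
  fixes m :: int
  assumes "[n * y = 1] (mod m)" "[n' * y' = 1] (mod m)"
  shows "[n = n'] (mod m) \<longleftrightarrow> [y = y'] (mod m)"
proof -
  have *: "[y = y'] (mod m)" if "[n * y = 1] (mod m)" "[n' * y' = 1] (mod m)" "[n = n'] (mod m)" for n n' y y' :: int
  proof -
    have "coprime n m" using that(1) by (metis cong_imp_coprime cong_sym coprime_1_left coprime_mult_left_iff)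
    moreover have "[n * y = n * y'] (mod m)"
      using that cong_scalar_right[OF that(3), of y'] by (meson cong_sym cong_trans)
    ultimately show ?thesis using cong_mult_lcancel by blast
  qed
  show ?thesis
    using *[OF assms] *[of y n y' n'] assms by (auto simp: mult.commute)
qed

lemma ex_inverse_function:
  assumes "prime q"
  obtains x where "\<And>n. \<not> int q dvd n \<Longrightarrow> [n * x n = 1] (mod int q)"
proof -
  have "\<forall>n. \<exists>y. \<not> int q dvd n \<longrightarrow> [n * y = 1] (mod int q)"
    using ex_inverse_mod_prime[OF assms] by meson
  from choice[OF this] show ?thesis using that by blast
qed

text \<open>By the Chinese remainder theorem the residues modulo p q embed into pairs of residues,
  so the left side is a part of the expanded product.\<close>

lemma sum_residue_pairs_le:
  fixes f g :: "int \<Rightarrow> real"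
  assumes p: "prime p" and q: "prime q" and pq: "p \<noteq> q"
    and f: "\<And>n. f n \<ge> 0" "\<And>n. f n = f (n mod int q)" and g: "\<And>n. g n \<ge> 0" "\<And>n. g n = g (n mod int p)"
  shows "(\<Sum>c\<in>{0..<int (p * q)}. f c * g c) \<le> (\<Sum>b\<in>{0..<int q}. f b) * (\<Sum>b\<in>{0..<int p}. g b)"
proof -
  let ?h = "\<lambda>c. (c mod int q, c mod int p)"
  have inj: "inj_on ?h {0..<int (p * q)}"
  proof (rule inj_onI)
    fix c c' assume c: "c \<in> {0..<int (p * q)}" "c' \<in> {0..<int (p * q)}" and eq: "?h c = ?h c'"
    have "int (p * q) dvd c - c'"
      by (rule distinct_primes_dvd_mult[OF p q pq]) (use eq in \<open>auto simp: mod_eq_dvd_iff\<close>)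
    thus "c = c'" using c by (intro int_eqI_mod_small[of "p * q" c c' "p * q"]) auto
  qed
  have "(\<Sum>c\<in>{0..<int (p * q)}. f c * g c) = (\<Sum>c\<in>{0..<int (p * q)}. f (c mod int q) * g (c mod int p))"
    by (intro sum.cong refl arg_cong2[where f = "(*)"] f g)
  also have "\<dots> = (\<Sum>x\<in>?h ` {0..<int (p * q)}. f (fst x) * g (snd x))"
    by (subst sum.reindex[OF inj]) simp
  also have "\<dots> \<le> (\<Sum>x\<in>{0..<int q} \<times> {0..<int p}. f (fst x) * g (snd x))"
    using p q f(1) g(1) by (intro sum_mono2) (auto simp: prime_gt_0_nat)
  also have "\<dots> = (\<Sum>b\<in>{0..<int q}. f b) * (\<Sum>b\<in>{0..<int p}. g b)"
    by (simp add: sum_product sum.cartesian_product case_prod_beta)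
  finally show ?thesis .
qed

text \<open>On a class c modulo p q the summand is a geometric progression of frequency
  \<open>s c\<close> over p q. Distinct unit classes have distinct frequencies, so after
  Cauchy--Schwarz over c the squares of \<open>dker\<close> are summed at most once per
  residue.\<close>

lemma pair_bound_long_interval:
  fixes N p q :: nat
  defines "J \<equiv> real N / real (p * q) + 1"
  assumes p: "prime p" "twisted p G" and q: "prime q" "twisted q F" and pq: "p \<noteq> q"
  shows "(cmod (\<Sum>n\<in>{a..<a + int N}. F n * cnj (G n)))\<^sup>2
    \<le> J * (J + real (p * q) * (1 + ln (real (p * q)))) * sqsum q F * sqsum p G"
proof -
  define m where "m = p * q"
  have p0: "p > 0" and q0: "q > 0" using p q by (auto simp: prime_gt_0_nat)
  have m0: "m > 0" using p0 q0 by (simp add: m_def)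
  have J0: "J \<ge> 0" by (simp add: J_def)
  obtain x where x: "\<And>n. \<not> int q dvd n \<Longrightarrow> [n * x n = 1] (mod int q)"
    using ex_inverse_function[OF q(1)] by blast
  obtain y where y: "\<And>n. \<not> int p dvd n \<Longrightarrow> [n * y n = 1] (mod int p)"
    using ex_inverse_function[OF p(1)] by blast
  \<comment> \<open>A step of p q multiplies F by e(p x/q) and the conjugate of G by e(-q y/p); over
    the common denominator p q the frequency is p^2 x - q^2 y.\<close>
  define s where "s = (\<lambda>c. int p ^ 2 * x c - int q ^ 2 * y c)"
  define C where "C = {c\<in>{0..<int m}. \<not> int p dvd c \<and> \<not> int q dvd c}"
  have C_sub: "C \<subseteq> {0..<int m}" by (auto simp: C_def)
  have finC: "finite C" by (rule finite_subset[OF C_sub]) simp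
  let ?I = "{a..<a + int N}"
  have block: "cmod (\<Sum>n\<in>{n\<in>?I. n mod int m = c}. F n * cnj (G n)) \<le> cmod (F c) * cmod (G c) * dker J m (s c)"
    if c: "c \<in> C" for c
  proof -
    obtain u v where uv: "\<And>k. c + int m * k \<in> ?I \<longleftrightarrow> k \<in> {u..<v}"
      and card: "real (card {u..<v}) \<le> real N / real m + 1"
      using residue_class_interval[OF m0] by blast
    have "(\<Sum>n\<in>{n\<in>?I. n mod int m = c}. F n * cnj (G n)) =
        (\<Sum>k\<in>{u..<v}. F (c + int m * k) * cnj (G (c + int m * k)))"
    proof (rule sum.reindex_bij_witness[of _ "\<lambda>k. c + int m * k" "\<lambda>n. n div int m"])
      fix n assume n: "n \<in> {n\<in>?I. n mod int m = c}"
      show eq: "c + int m * (n div int m) = n" using n by (auto simp: mod_mult_div_eq add.commute)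
      show "n div int m \<in> {u..<v}" using uv[of "n div int m"] n eq by simp
    next
      fix k assume k: "k \<in> {u..<v}"
      have c': "0 \<le> c" "c < int m" using c by (auto simp: C_def)
      show "(c + int m * k) div int m = k" using c' m0 by simp
      show "c + int m * k \<in> {n\<in>?I. n mod int m = c}" using uv[of k] k c' by simp
    qed auto
    also have "\<dots> = (\<Sum>k\<in>{u..<v}. F c * cnj (G c) * e (of_int k * of_int (s c) / real m))"
    proof (rule sum.cong[OF refl])
      fix k
      have "F (c + int m * k) = F c * e (of_int (int p * k * x c) / real q)"
        using twistedD(1)[OF q(2) x, of c "int p * k"] c by (simp add: C_def m_def mult_ac)
      moreover have "G (c + int m * k) = G c * e (of_int (int q * k * y c) / real p)"
        using twistedD(1)[OF p(2) y, of c "int q * k"] c by (simp add: C_def m_def mult_ac)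
      moreover have "of_int (int p * k * x c) / real q + - (of_int (int q * k * y c) / real p) =
          of_int k * of_int (s c) / real m"
        using p0 q0 by (simp add: s_def m_def field_simps power2_eq_square)
      ultimately show "F (c + int m * k) * cnj (G (c + int m * k)) = F c * cnj (G c) * e (of_int k * of_int (s c) / real m)"
        by (simp add: cnj_e e_add[symmetric] mult_ac)
    qed
    also have "\<dots> = F c * cnj (G c) * (\<Sum>k\<in>{u..<v}. e (of_int k * of_int (s c) / real m))"
      by (simp add: sum_distrib_left)
    also have "cmod \<dots> \<le> cmod (F c) * cmod (G c) * dker J m (s c)"
      unfolding norm_mult complex_mod_cnj
      using card by (intro mult_left_mono norm_geometric_e_le m0) (auto simp: J_def m_def)
    finally show ?thesis .
  qed
  \<comment> \<open>Modulo q the term with y drops out and p^2 is invertible, so \<open>s c\<close>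
    determines the inverse of c modulo q, hence c modulo q. The roles of p and q are then
    exchanged.\<close>
  have inj: "inj_on (\<lambda>c. s c mod int m) C"
  proof (rule inj_onI)
    fix c c' assume c: "c \<in> C" and c': "c' \<in> C" and eq: "s c mod int m = s c' mod int m"
    have dvd: "int p * int q dvd s c - s c'"
      using eq by (simp add: mod_eq_dvd_iff m_def)
    have key: "int q dvd c - c'"
      if pr: "prime p" "prime q" "p \<noteq> q" and d: "int q dvd int p ^ 2 * (x - x') - int q ^ 2 * z"
        and inv: "[c * x = 1] (mod int q)" "[c' * x' = 1] (mod int q)" for p q :: nat and x x' z :: int
    proof -
      have "int q dvd (int p ^ 2 * (x - x') - int q ^ 2 * z) + int q * (int q * z)"
        by (rule dvd_add[OF d]) simp
      hence "int q dvd int p ^ 2 * (x - x')" by (simp add: power2_eq_square)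
      moreover have "\<not> int q dvd int p ^ 2"
        using pr by (metis int_dvd_int_iff of_nat_power prime_dvd_power primes_dvd_imp_eq)
      ultimately have "int q dvd x - x'" using pr by (simp add: prime_dvd_mult_iff)
      hence "[x = x'] (mod int q)" by (simp add: cong_iff_dvd_diff)
      thus ?thesis using inverse_cong_unique[OF inv] by (simp add: cong_iff_dvd_diff)
    qed
    have "int q dvd c - c'"
    proof (rule key[OF p(1) q(1) pq])
      have "s c - s c' = int p ^ 2 * (x c - x c') - int q ^ 2 * (y c - y c')"
        by (simp add: s_def algebra_simps)
      thus "int q dvd int p ^ 2 * (x c - x c') - int q ^ 2 * (y c - y c')"
        using dvd by (metis dvd_mult_right)
    qed (use c c' x in \<open>auto simp: C_def\<close>)
    moreover have "int p dvd c - c'"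
    proof (rule key[OF q(1) p(1) pq[symmetric]])
      have "- (s c - s c') = int q ^ 2 * (y c - y c') - int p ^ 2 * (x c - x c')"
        by (simp add: s_def algebra_simps)
      thus "int p dvd int q ^ 2 * (y c - y c') - int p ^ 2 * (x c - x c')"
        using dvd by (metis dvd_minus_iff dvd_mult_left)
    qed (use c c' y in \<open>auto simp: C_def\<close>)
    ultimately have "int m dvd c - c'"
      unfolding m_def by (intro distinct_primes_dvd_mult[OF p(1) q(1) pq])
    thus "c = c'" using c c' by (intro int_eqI_mod_small[of m c c' m]) (auto simp: C_def)
  qed
  have "cmod (\<Sum>n\<in>?I. F n * cnj (G n)) =
      cmod (\<Sum>c\<in>{0..<int m}. \<Sum>n\<in>{n\<in>?I. n mod int m = c}. F n * cnj (G n))"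
    by (subst sum_interval_mod_split[OF m0]) auto
  also have "(\<Sum>c\<in>{0..<int m}. \<Sum>n\<in>{n\<in>?I. n mod int m = c}. F n * cnj (G n)) =
      (\<Sum>c\<in>C. \<Sum>n\<in>{n\<in>?I. n mod int m = c}. F n * cnj (G n))"
  proof (rule sum.mono_neutral_right[OF _ C_sub])
    show "\<forall>c\<in>{0..<int m} - C. (\<Sum>n\<in>{n\<in>?I. n mod int m = c}. F n * cnj (G n)) = 0"
    proof
      fix c assume "c \<in> {0..<int m} - C"
      hence dv: "int p dvd c \<or> int q dvd c" by (auto simp: C_def)
      have "F n * cnj (G n) = 0" if "n mod int m = c" for n
      proof -
        have "int p dvd n \<longleftrightarrow> int p dvd n mod int m" "int q dvd n \<longleftrightarrow> int q dvd n mod int m"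
          by (simp_all add: m_def dvd_mod_iff)
        thus ?thesis using dv that twistedD(2)[OF p(2)] twistedD(2)[OF q(2)] by auto
      qed
      thus "(\<Sum>n\<in>{n\<in>?I. n mod int m = c}. F n * cnj (G n)) = 0" by (intro sum.neutral) auto
    qed
  qed auto
  also have "cmod \<dots> \<le> (\<Sum>c\<in>C. (cmod (F c) * cmod (G c)) * dker J m (s c))"
    by (rule order_trans[OF norm_sum sum_mono[OF block]])
  finally have "(cmod (\<Sum>n\<in>?I. F n * cnj (G n)))\<^sup>2 \<le> (\<Sum>c\<in>C. (cmod (F c) * cmod (G c)) * dker J m (s c))\<^sup>2"
    by (rule power_mono) simp
  also have "\<dots> \<le> (\<Sum>c\<in>C. (cmod (F c) * cmod (G c))\<^sup>2) * (\<Sum>c\<in>C. (dker J m (s c))\<^sup>2)"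
    by (rule Cauchy_Schwarz_ineq_sum)
  also have "\<dots> \<le> (sqsum q F * sqsum p G) * (J * (J + real m * (1 + ln (real m))))"
  proof (rule mult_mono)
    have "(\<Sum>c\<in>C. (cmod (F c) * cmod (G c))\<^sup>2) \<le> (\<Sum>c\<in>{0..<int (p * q)}. (cmod (F c))\<^sup>2 * (cmod (G c))\<^sup>2)"
      unfolding power_mult_distrib using C_sub by (intro sum_mono2) (auto simp: m_def)
    also have "\<dots> \<le> sqsum q F * sqsum p G"
    proof -
      have "(cmod (F n))\<^sup>2 = (cmod (F (n mod int q)))\<^sup>2" "(cmod (G n))\<^sup>2 = (cmod (G (n mod int p)))\<^sup>2" for n
        using twisted_norm_cong[OF q, of n "n mod int q"] twisted_norm_cong[OF p, of n "n mod int p"]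
        by (simp_all add: cong_def)
      thus ?thesis
        unfolding sqsum_def by (intro sum_residue_pairs_le[OF p(1) q(1) pq] zero_le_power2)
    qed
    finally show "(\<Sum>c\<in>C. (cmod (F c) * cmod (G c))\<^sup>2) \<le> sqsum q F * sqsum p G" .
    have "(\<Sum>c\<in>C. (dker J m (s c))\<^sup>2) = (\<Sum>c\<in>C. (dker J m (s c mod int m))\<^sup>2)"
      using dker_cong[of "s c" "s c mod int m" m J for c] by (intro sum.cong refl) (simp add: cong_def)
    also have "\<dots> = (\<Sum>t\<in>(\<lambda>c. s c mod int m) ` C. (dker J m t)\<^sup>2)"
      by (subst sum.reindex[OF inj]) simp
    also have "\<dots> \<le> (\<Sum>t\<in>{0..<int m}. (dker J m t)\<^sup>2)"
      using m0 by (intro sum_mono2) auto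
    also have "\<dots> \<le> J * (J + real m * (1 + ln (real m)))"
      by (rule sum_dker_square_le[OF m0 J0])
    finally show "(\<Sum>c\<in>C. (dker J m (s c))\<^sup>2) \<le> J * (J + real m * (1 + ln (real m)))" .
  qed (auto intro!: sum_nonneg)
  finally show ?thesis by (simp add: m_def mult_ac)
qed

section \<open>Reduction of a pair to correlations at shifts by multiples of p\<close>

text \<open>Take \<phi> to be the twisted function equal to 1 on 1, ..., q - 1. It carries all the
  phases, so every twisted F is a function of the class modulo q times this one fixed
  factor.\<close>

lemma ex_unit_twisted:
  assumes q: "prime q" and x: "\<And>n. \<not> int q dvd n \<Longrightarrow> [n * x n = 1] (mod int q)"
  obtains \<phi> where "twisted q \<phi>" "\<And>n. \<not> int q dvd n \<Longrightarrow> cmod (\<phi> n) = 1"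
    "\<And>F n. twisted q F \<Longrightarrow> F n = F (n mod int q) * \<phi> n"
proof
  define \<phi> where "\<phi> = (\<lambda>n. if int q dvd n then 0 else e (of_int (n div int q * x (n mod int q)) / real q))"
  have q0: "q > 0" using q by (simp add: prime_gt_0_nat)
  have xm: "[n mod int q * x (n mod int q) = 1] (mod int q)" if "\<not> int q dvd n" for n
    using that by (intro x) (simp add: dvd_mod_iff)
  show "twisted q \<phi>"
    unfolding twisted_def
  proof (intro conjI allI impI)
    fix n k y assume y: "[n * y = 1] (mod int q)"
    show "\<phi> (n + int q * k) = \<phi> n * e (of_int (k * y) / real q)"
    proof (cases "int q dvd n")
      case True
      thus ?thesis by (simp add: \<phi>_def)
    next
      case False
      have "[n = n mod int q] (mod int q)" by (simp add: cong_def)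
      hence "[y = x (n mod int q)] (mod int q)"
        using inverse_cong_unique[OF y xm[OF False]] by simp
      hence "e (of_int (k * y) / real q) = e (of_int (k * x (n mod int q)) / real q)"
        by (intro e_int_div_eqI q0 cong_scalar_left)
      thus ?thesis
        using False q0 by (simp add: \<phi>_def dvd_add_left_iff e_add[symmetric] add_divide_distrib distrib_right add.commute)
    qed
  qed (simp add: \<phi>_def)
  show "cmod (\<phi> n) = 1" if "\<not> int q dvd n" for n using that by (simp add: \<phi>_def)
  show "F n = F (n mod int q) * \<phi> n" if F: "twisted q F" for F n
  proof (cases "int q dvd n")
    case True
    thus ?thesis using twistedD(2)[OF F] by (simp add: \<phi>_def)
  next
    case False
    show ?thesis
      using twistedD(1)[OF F xm[OF False], of "n div int q"] False by (simp add: \<phi>_def)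
  qed
qed

text \<open>With the arbitrary coefficients stripped off, this is the kernel of the quadratic form
  left by Cauchy--Schwarz modulo p: r is the difference of the two variables divided by p, b the
  class of the second modulo q.\<close>

definition twisted_correlation ::
    "nat \<Rightarrow> nat \<Rightarrow> (int \<Rightarrow> complex) \<Rightarrow> (int \<Rightarrow> complex) \<Rightarrow> int set \<Rightarrow> int \<Rightarrow> int \<Rightarrow> complex" where
  "twisted_correlation p q \<phi> \<psi> I r b = (\<Sum>m\<in>{m\<in>I. m + int p * r \<in> I \<and> m mod int q = b}.
     \<phi> (m + int p * r) * cnj (\<phi> m) * cnj (\<psi> (m + int p * r)) * \<psi> m)"

text \<open>A Schur test. Cauchy--Schwarz over the classes modulo p separates G and leaves a form in
  the values of F with kernel \<open>T\<close>; since \<open>T\<close> is Hermitian under exchange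
  of the two variables, row sums bounded uniformly in b control it.\<close>

lemma pair_bound_of_correlations:
  fixes p q N :: nat and a :: int and \<phi> \<psi> :: "int \<Rightarrow> complex"
  defines "I \<equiv> {a..<a + int N}" and "L \<equiv> int (N div p)"
  defines "T \<equiv> twisted_correlation p q \<phi> \<psi> I"
  assumes p: "prime p" and q: "prime q"
    and \<phi>: "\<And>F n. twisted q F \<Longrightarrow> F n = F (n mod int q) * \<phi> n"
    and \<psi>: "\<And>G n. twisted p G \<Longrightarrow> G n = G (n mod int p) * \<psi> n"
    and X: "\<And>b. \<not> int q dvd b \<Longrightarrow> (\<Sum>r\<in>{-L..L}. cmod (T r (b mod int q))) \<le> X"
    and F: "twisted q F" and G: "twisted p G"
  shows "(cmod (\<Sum>n\<in>I. F n * cnj (G n)))\<^sup>2 \<le> X * sqsum q F * sqsum p G"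
proof -
  define \<tau> where "\<tau> = (\<lambda>n m. \<phi> n * cnj (\<phi> m) * cnj (\<psi> n) * \<psi> m)"
  have T_eq: "T r b = (\<Sum>m\<in>{m\<in>I. m + int p * r \<in> I \<and> m mod int q = b}. \<tau> (m + int p * r) m)" for r b
    by (simp add: T_def twisted_correlation_def \<tau>_def)
  have p0: "p > 0" and q0: "q > 0" using p q by (auto simp: prime_gt_0_nat)
  have finI: "finite I" by (simp add: I_def)
  define h where "h = (\<lambda>n. F n * cnj (\<psi> n))"
  define U where "U = (\<lambda>c. \<Sum>n\<in>{n\<in>I. n mod int p = c}. h n)"
  have "(\<Sum>n\<in>I. F n * cnj (G n)) = (\<Sum>c\<in>{0..<int p}. \<Sum>n\<in>{n\<in>I. n mod int p = c}. F n * cnj (G n))"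
    by (rule sum_interval_mod_split[OF p0 finI])
  also have "\<dots> = (\<Sum>c\<in>{0..<int p}. cnj (G c) * U c)"
    unfolding U_def sum_distrib_left
    by (intro sum.cong refl) (subst \<psi>[OF G], auto simp: h_def)
  finally have "(cmod (\<Sum>n\<in>I. F n * cnj (G n)))\<^sup>2 \<le> (\<Sum>c\<in>{0..<int p}. (cmod (cnj (G c)))\<^sup>2) * (\<Sum>c\<in>{0..<int p}. (cmod (U c))\<^sup>2)"
    using norm_sum_square_le[of "\<lambda>c. cnj (G c)" U "{0..<int p}"] by simp
  also have "(\<Sum>c\<in>{0..<int p}. (cmod (cnj (G c)))\<^sup>2) = sqsum p G"
    by (simp add: sqsum_def)
  finally have 1: "(cmod (\<Sum>n\<in>I. F n * cnj (G n)))\<^sup>2 \<le> sqsum p G * (\<Sum>c\<in>{0..<int p}. (cmod (U c))\<^sup>2)" .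

  let ?R = "{-L..L}" and ?B = "{0..<int q}"
  let ?P = "{x\<in>I \<times> I. fst x mod int p = snd x mod int p}"
  \<comment> \<open>The class modulo q of m + p r when m lies in the class b.\<close>
  define \<sigma> where "\<sigma> = (\<lambda>r b. (b + int p * r) mod int q)"
  have finP: "finite ?P" by (rule finite_subset[of _ "I \<times> I"]) (auto simp: finI)
  have corr: "h n * cnj (h m) = F (n mod int q) * cnj (F (m mod int q)) * \<tau> n m" for n m
    using \<phi>[OF F, of n] \<phi>[OF F, of m] by (simp add: h_def \<tau>_def mult_ac)
  have "complex_of_real (\<Sum>c\<in>{0..<int p}. (cmod (U c))\<^sup>2) =
      (\<Sum>c\<in>{0..<int p}. \<Sum>x\<in>{x\<in>?P. fst x mod int p = c}. h (fst x) * cnj (h (snd x)))"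
    unfolding of_real_sum complex_norm_square U_def cnj_sum sum_product sum.cartesian_product
    by (intro sum.cong refl) (auto simp: case_prod_beta)
  also have "\<dots> = (\<Sum>x\<in>?P. h (fst x) * cnj (h (snd x)))"
    by (rule sum.group) (use p0 finP in auto)
  \<comment> \<open>Two congruent integers of I differ by p r with p |r| <= N, hence |r| <=
    L.\<close>
  also have "\<dots> = (\<Sum>y\<in>?R \<times> ?B. \<Sum>x\<in>{x\<in>?P. ((fst x - snd x) div int p, snd x mod int q) = y}. h (fst x) * cnj (h (snd x)))"
  proof (rule sum.group[symmetric])
    show "(\<lambda>x. ((fst x - snd x) div int p, snd x mod int q)) ` ?P \<subseteq> ?R \<times> ?B"
    proof
      fix y assume "y \<in> (\<lambda>x. ((fst x - snd x) div int p, snd x mod int q)) ` ?P"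
      then obtain n m where nm: "n \<in> I" "m \<in> I" "n mod int p = m mod int p"
        "y = ((n - m) div int p, m mod int q)" by auto
      have "int p dvd n - m" using nm(3) by (simp add: mod_eq_dvd_iff)
      then obtain r where r: "n - m = int p * r" by blast
      have "\<bar>n - m\<bar> \<le> int N" using nm(1,2) unfolding I_def by auto
      hence "\<bar>r\<bar> * int p \<le> int N" by (simp add: r abs_mult mult.commute)
      hence "\<bar>r\<bar> \<le> L"
        using int_le_div_iff[of "int p" "\<bar>r\<bar>" "int N"] p0 by (simp add: L_def zdiv_int)
      thus "y \<in> ?R \<times> ?B" using nm(4) r p0 q0 by auto
    qed
  qed (use finP in auto)
  also have "\<dots> = (\<Sum>(r, b)\<in>?R \<times> ?B. F (\<sigma> r b) * cnj (F b) * T r b)"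
  proof (intro sum.cong refl)
    fix y assume y: "y \<in> ?R \<times> ?B"
    obtain r b where rb: "y = (r, b)" by (cases y)
    have "(\<Sum>x\<in>{x\<in>?P. ((fst x - snd x) div int p, snd x mod int q) = y}. h (fst x) * cnj (h (snd x))) =
        (\<Sum>m\<in>{m\<in>I. m + int p * r \<in> I \<and> m mod int q = b}. h (m + int p * r) * cnj (h m))"
    proof (rule sum.reindex_bij_witness[of _ "\<lambda>m. (m + int p * r, m)" snd])
      fix x assume x: "x \<in> {x\<in>?P. ((fst x - snd x) div int p, snd x mod int q) = y}"
      hence "int p dvd fst x - snd x" by (simp add: mod_eq_dvd_iff)
      hence "fst x = snd x + int p * r" using x rb by auto
      thus "(snd x + int p * r, snd x) = x"
        and "snd x \<in> {m\<in>I. m + int p * r \<in> I \<and> m mod int q = b}"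
        and "h (snd x + int p * r) * cnj (h (snd x)) = h (fst x) * cnj (h (snd x))"
        using x rb by auto
    qed (use p0 rb in auto)
    also have "\<dots> = (\<Sum>m\<in>{m\<in>I. m + int p * r \<in> I \<and> m mod int q = b}. F (\<sigma> r b) * cnj (F b) * \<tau> (m + int p * r) m)"
    proof (intro sum.cong refl)
      fix m assume "m \<in> {m\<in>I. m + int p * r \<in> I \<and> m mod int q = b}"
      moreover from this have "(m + int p * r) mod int q = \<sigma> r b"
        unfolding \<sigma>_def by (auto simp: mod_add_left_eq)
      ultimately show "h (m + int p * r) * cnj (h m) = F (\<sigma> r b) * cnj (F b) * \<tau> (m + int p * r) m"
        by (simp add: corr)
    qed
    finally show "(\<Sum>x\<in>{x\<in>?P. ((fst x - snd x) div int p, snd x mod int q) = y}. h (fst x) * cnj (h (snd x))) =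
        (case y of (r, b) \<Rightarrow> F (\<sigma> r b) * cnj (F b) * T r b)"
      by (simp add: rb T_eq sum_distrib_left)
  qed
  finally have V: "complex_of_real (\<Sum>c\<in>{0..<int p}. (cmod (U c))\<^sup>2) = (\<Sum>(r, b)\<in>?R \<times> ?B. F (\<sigma> r b) * cnj (F b) * T r b)" .
  have V0: "(\<Sum>c\<in>{0..<int p}. (cmod (U c))\<^sup>2) \<ge> 0" by (simp add: sum_nonneg)
  define E1 E2 where "E1 = (\<Sum>r\<in>?R. \<Sum>b\<in>?B. (cmod (F (\<sigma> r b)))\<^sup>2 * cmod (T r b))"
    and "E2 = (\<Sum>r\<in>?R. \<Sum>b\<in>?B. (cmod (F b))\<^sup>2 * cmod (T r b))"
  have "(\<Sum>c\<in>{0..<int p}. (cmod (U c))\<^sup>2) = cmod (\<Sum>(r, b)\<in>?R \<times> ?B. F (\<sigma> r b) * cnj (F b) * T r b)"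
    unfolding V[symmetric] norm_of_real using V0 by simp
  also have "\<dots> \<le> (\<Sum>(r, b)\<in>?R \<times> ?B. cmod (F (\<sigma> r b)) * cmod (F b) * cmod (T r b))"
    by (rule order_trans[OF norm_sum]) (simp add: norm_mult case_prod_beta)
  \<comment> \<open>The arithmetic-geometric mean inequality decouples the values of F at b and at
    \<open>\<sigma> r b\<close>.\<close>
  also have "\<dots> \<le> (\<Sum>(r, b)\<in>?R \<times> ?B. ((cmod (F (\<sigma> r b)))\<^sup>2 * cmod (T r b) + (cmod (F b))\<^sup>2 * cmod (T r b)) / 2)"
  proof (rule sum_mono, clarify)
    fix r b
    have "2 * (cmod (F (\<sigma> r b)) * cmod (F b)) \<le> (cmod (F (\<sigma> r b)))\<^sup>2 + (cmod (F b))\<^sup>2"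
      using sum_squares_bound[of "cmod (F (\<sigma> r b))" "cmod (F b)"] by (simp add: mult.assoc)
    from mult_right_mono[OF this norm_ge_zero[of "T r b"]]
    show "cmod (F (\<sigma> r b)) * cmod (F b) * cmod (T r b)
        \<le> ((cmod (F (\<sigma> r b)))\<^sup>2 * cmod (T r b) + (cmod (F b))\<^sup>2 * cmod (T r b)) / 2"
      by (simp add: algebra_simps)
  qed
  also have "\<dots> = (E1 + E2) / 2"
    unfolding E1_def E2_def sum.cartesian_product
    by (simp add: case_prod_beta sum.distrib sum_divide_distrib[symmetric])
  \<comment> \<open>Exchanging the two variables replaces (r, b) by (-r,
    \<open>\<sigma> r b\<close>) and conjugates \<open>T\<close>; the substitution carries one half
    into the other.\<close>
  also have "E1 = E2"
  proof -
    have sym: "cmod (T r b) = cmod (T (- r) (\<sigma> r b))" if "b \<in> ?B" for r b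
    proof -
      have "T (- r) (\<sigma> r b) = (\<Sum>m\<in>{m\<in>I. m + int p * r \<in> I \<and> m mod int q = b}. \<tau> m (m + int p * r))"
        unfolding T_eq
      proof (rule sum.reindex_bij_witness[of _ "\<lambda>m. m + int p * r" "\<lambda>m. m + int p * (- r)"])
        fix m assume m: "m \<in> {m\<in>I. m + int p * (- r) \<in> I \<and> m mod int q = \<sigma> r b}"
        have "m + int p * (- r) \<in> I" using m by simp
        moreover have "(m + int p * (- r)) mod int q = b"
        proof -
          have "int q dvd m - (b + int p * r)" using m by (simp add: \<sigma>_def mod_eq_dvd_iff)
          hence "(m - int p * r) mod int q = b mod int q" by (simp add: mod_eq_dvd_iff algebra_simps)
          thus ?thesis using that by simp
        qed
        ultimately show "m + int p * (- r) \<in> {m\<in>I. m + int p * r \<in> I \<and> m mod int q = b}"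
          using m by simp
      next
        fix m assume m: "m \<in> {m\<in>I. m + int p * r \<in> I \<and> m mod int q = b}"
        hence "(m + int p * r) mod int q = \<sigma> r b"
          unfolding \<sigma>_def by (auto simp: mod_add_left_eq)
        thus "m + int p * r \<in> {m\<in>I. m + int p * (- r) \<in> I \<and> m mod int q = \<sigma> r b}"
          using m by simp
      qed auto
      also have "\<dots> = cnj (T r b)"
        unfolding T_eq cnj_sum by (intro sum.cong refl) (simp add: \<tau>_def mult_ac)
      finally show ?thesis by simp
    qed
    have "E1 = (\<Sum>r\<in>?R. \<Sum>b\<in>?B. (cmod (F (\<sigma> r b)))\<^sup>2 * cmod (T (- r) (\<sigma> r b)))"
      unfolding E1_def by (intro sum.cong refl) (simp only: sym)
    also have "\<dots> = (\<Sum>r\<in>?R. \<Sum>b\<in>?B. (cmod (F b))\<^sup>2 * cmod (T (- r) b))"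
    proof (rule sum.cong[OF refl])
      fix r
      have inv1: "\<sigma> (- r) (\<sigma> r b) = b" and inv2: "\<sigma> r (\<sigma> (- r) b) = b" if "b \<in> ?B" for b
        using that by (simp_all add: \<sigma>_def mod_diff_left_eq mod_add_left_eq)
      show "(\<Sum>b\<in>?B. (cmod (F (\<sigma> r b)))\<^sup>2 * cmod (T (- r) (\<sigma> r b))) = (\<Sum>b\<in>?B. (cmod (F b))\<^sup>2 * cmod (T (- r) b))"
        by (rule sum.reindex_bij_witness[of _ "\<sigma> (- r)" "\<sigma> r"])
           (use q0 inv1 inv2 in \<open>auto simp: \<sigma>_def\<close>)
    qed
    also have "\<dots> = E2"
      unfolding E2_def by (rule sum.reindex_bij_witness[of _ uminus uminus]) auto
    finally show ?thesis .
  qed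
  also have "(E2 + E2) / 2 = E2" by simp
  also have "E2 = (\<Sum>b\<in>?B. (cmod (F b))\<^sup>2 * (\<Sum>r\<in>?R. cmod (T r b)))"
    unfolding E2_def sum_distrib_left by (rule sum.swap)
  also have "\<dots> \<le> (\<Sum>b\<in>?B. (cmod (F b))\<^sup>2 * X)"
  proof (rule sum_mono)
    fix b assume b: "b \<in> ?B"
    show "(cmod (F b))\<^sup>2 * (\<Sum>r\<in>?R. cmod (T r b)) \<le> (cmod (F b))\<^sup>2 * X"
    proof (cases "int q dvd b")
      case True
      thus ?thesis using twistedD(2)[OF F] by simp
    next
      case False
      thus ?thesis using X[OF False] b by (intro mult_left_mono) auto
    qed
  qed
  also have "\<dots> = X * sqsum q F"
    by (simp add: sqsum_def sum_distrib_left mult.commute)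
  finally have "(\<Sum>c\<in>{0..<int p}. (cmod (U c))\<^sup>2) \<le> X * sqsum q F" .
  hence "sqsum p G * (\<Sum>c\<in>{0..<int p}. (cmod (U c))\<^sup>2) \<le> sqsum p G * (X * sqsum q F)"
    by (intro mult_left_mono) auto
  thus ?thesis using 1 by (simp add: mult_ac)
qed

section \<open>Correlations as incomplete Kloosterman sums, and the pair bounds in the middle
  range\<close>

text \<open>Both membership conditions cut out intervals of k, so their conjunction does too. Taking
  b among the first q integers from a makes k start at 0 and end by N div q.\<close>

lemma ex_correlation_window:
  assumes q: "q > 0" and b: "b \<in> {a..<a + int q}"
  obtains u v where "0 \<le> u" "v \<le> int (N div q) + 1"
    "\<And>k. b + int q * k \<in> {a..<a + int N} \<and> b + int q * k + d \<in> {a..<a + int N} \<longleftrightarrow> k \<in> {u..<v}"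
proof -
  let ?I = "{a..<a + int N}"
  obtain u1 v1 where 1: "\<And>k. b + int q * k \<in> ?I \<longleftrightarrow> k \<in> {u1..<v1}"
    using residue_class_interval[OF q, of b a N] by blast
  obtain u2 v2 where 2: "\<And>k. b + d + int q * k \<in> ?I \<longleftrightarrow> k \<in> {u2..<v2}"
    using residue_class_interval[OF q, of "b + d" a N] by blast
  have range: "0 \<le> k \<and> k \<le> int (N div q)" if k: "b + int q * k \<in> ?I" for k
  proof -
    have "int q * (k + 1) > 0" using k b by (simp add: algebra_simps)
    hence "k + 1 > 0" using q by (simp add: zero_less_mult_iff)
    moreover have "k * int q \<le> int N" using k b by (simp add: mult.commute)
    hence "k \<le> int (N div q)" using int_le_div_iff[of "int q" k "int N"] q by (simp add: zdiv_int)
    ultimately show ?thesis by simp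
  qed
  have both: "b + int q * k \<in> ?I \<and> b + int q * k + d \<in> ?I \<longleftrightarrow> k \<in> {max u1 u2..<min v1 v2}" for k
    using 1[of k] 2[of k] by (auto simp: algebra_simps)
  show ?thesis
  proof (cases "max u1 u2 < min v1 v2")
    case True
    hence "b + int q * max u1 u2 \<in> ?I" "b + int q * (min v1 v2 - 1) \<in> ?I"
      using both[of "max u1 u2"] both[of "min v1 v2 - 1"] by auto
    hence "0 \<le> max u1 u2" "min v1 v2 \<le> int (N div q) + 1"
      using range by fastforce+
    thus ?thesis using both that by blast
  next
    case False
    \<comment> \<open>If no k qualifies, the raw endpoints may violate the claimed bounds, so the
      empty window is given harmless ones.\<close>
    hence empty: "{max u1 u2..<min v1 v2} = {0..<0}" by simp
    show ?thesis by (rule that[of 0 0, OF _ _ both[unfolded empty]]) auto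
  qed
qed

lemma twisted_correlation_eq_0:
  assumes "twisted q \<phi>" "int q dvd b + int p * r"
  shows "twisted_correlation p q \<phi> \<psi> I r (b mod int q) = 0"
  unfolding twisted_correlation_def
proof (rule sum.neutral, intro ballI)
  fix m assume "m \<in> {m\<in>I. m + int p * r \<in> I \<and> m mod int q = b mod int q}"
  hence "int q dvd m - b" by (simp add: mod_eq_dvd_iff)
  hence "int q dvd (m - b) + (b + int p * r)" using assms(2) by (rule dvd_add)
  hence "\<phi> (m + int p * r) = 0" using twistedD(2)[OF assms(1)] by simp
  thus "\<phi> (m + int p * r) * cnj (\<phi> m) * cnj (\<psi> (m + int p * r)) * \<psi> m = 0" by simp
qed

text \<open>The summand of the correlation along \<open>m = b + q k\<close>, up to a constant of modulus one.\<close>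
definition corr_summand :: "nat \<Rightarrow> nat \<Rightarrow> (int \<Rightarrow> int) \<Rightarrow> int \<Rightarrow> real \<Rightarrow> int \<Rightarrow> int \<Rightarrow> complex" where
  "corr_summand p q y b \<theta> r k = (if int p dvd b + int q * k then 0
     else e (of_int k * \<theta>) * e (- of_int (r * y (b + int q * k)) / real p))"

text \<open>Along m = b + q k the two factors from \<phi> contribute phases linear in k, with
  frequency depending on r through the inverse of b + p r modulo q. The two factors from \<psi>
  contribute -r/m modulo p, since the shift p r is a multiple of p. Constants of modulus one are
  dropped.\<close>

lemma norm_twisted_correlation_le:
  assumes p: "prime p" and q: "prime q"
    and x: "\<And>n. \<not> int q dvd n \<Longrightarrow> [n * x n = 1] (mod int q)"
    and y: "\<And>n. \<not> int p dvd n \<Longrightarrow> [n * y n = 1] (mod int p)"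
    and \<phi>: "twisted q \<phi>" "\<And>n. \<not> int q dvd n \<Longrightarrow> cmod (\<phi> n) = 1"
    and \<psi>: "twisted p \<psi>" "\<And>n. \<not> int p dvd n \<Longrightarrow> cmod (\<psi> n) = 1"
    and b: "b \<in> {a..<a + int q}" "\<not> int q dvd b" and br: "\<not> int q dvd b + int p * r"
  obtains u v where "0 \<le> u" "v \<le> int (N div q) + 1"
    "cmod (twisted_correlation p q \<phi> \<psi> {a..<a + int N} r (b mod int q)) =
      cmod (\<Sum>k\<in>{u..<v}. corr_summand p q y b (of_int (x (b + int p * r) - x b) / real q) r k)"
proof -
  let ?I = "{a..<a + int N}"
  define \<theta> where "\<theta> = real_of_int (x (b + int p * r) - x b) / real q"
  have q0: "q > 0" and p0: "p > 0" using p q by (auto simp: prime_gt_0_nat)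
  obtain u v where uv: "0 \<le> u" "v \<le> int (N div q) + 1"
    "\<And>k. b + int q * k \<in> ?I \<and> b + int q * k + int p * r \<in> ?I \<longleftrightarrow> k \<in> {u..<v}"
    using ex_correlation_window[OF q0 b(1), of N "int p * r"] by blast
  have "twisted_correlation p q \<phi> \<psi> ?I r (b mod int q) =
      (\<Sum>k\<in>{u..<v}. (\<phi> (b + int p * r) * cnj (\<phi> b)) * corr_summand p q y b \<theta> r k)"
    unfolding twisted_correlation_def
  proof (rule sum.reindex_bij_witness[of _ "\<lambda>k. b + int q * k" "\<lambda>m. (m - b) div int q"])
    fix m assume m: "m \<in> {m\<in>?I. m + int p * r \<in> ?I \<and> m mod int q = b mod int q}"
    hence "int q dvd m - b" by (simp add: mod_eq_dvd_iff)
    then obtain k where k: "m - b = int q * k" by blast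
    hence mk: "m = b + int q * k" by simp
    have kd: "(m - b) div int q = k" using k q0 by simp
    show "b + int q * ((m - b) div int q) = m" by (simp add: kd mk)
    show "(m - b) div int q \<in> {u..<v}" unfolding kd using uv(3)[of k] m mk by auto
    have \<phi>1: "\<phi> (m + int p * r) = \<phi> (b + int p * r) * e (of_int (k * x (b + int p * r)) / real q)"
      using twistedD(1)[OF \<phi>(1) x[OF br], of k] by (simp add: mk add_ac)
    have \<phi>2: "\<phi> m = \<phi> b * e (of_int (k * x b) / real q)"
      unfolding mk by (rule twistedD(1)[OF \<phi>(1) x[OF b(2)]])
    have \<psi>1: "cnj (\<psi> (m + int p * r)) * \<psi> m = (if int p dvd m then 0 else e (- of_int (r * y m) / real p))"
    proof (cases "int p dvd m")
      case True
      thus ?thesis using twistedD(2)[OF \<psi>(1)] by simp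
    next
      case False
      have "cnj (\<psi> (m + int p * r)) * \<psi> m = (\<psi> m * cnj (\<psi> m)) * e (- of_int (r * y m) / real p)"
        unfolding twistedD(1)[OF \<psi>(1) y[OF False]] by (simp add: cnj_e)
      also have "\<psi> m * cnj (\<psi> m) = 1"
        using \<psi>(2)[OF False] by (simp add: complex_norm_square[symmetric])
      finally show ?thesis using False by simp
    qed
    have "\<phi> (m + int p * r) * cnj (\<phi> m) = (\<phi> (b + int p * r) * cnj (\<phi> b)) * e (of_int k * \<theta>)"
    proof -
      have "of_int (k * x (b + int p * r)) / real q + - (of_int (k * x b) / real q) = of_int k * \<theta>"
        by (simp add: \<theta>_def right_diff_distrib diff_divide_distrib)
      thus ?thesis unfolding \<phi>1 \<phi>2 by (simp add: cnj_e e_add[symmetric] mult_ac)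
    qed
    thus "(\<phi> (b + int p * r) * cnj (\<phi> b)) * corr_summand p q y b \<theta> r ((m - b) div int q) =
        \<phi> (m + int p * r) * cnj (\<phi> m) * cnj (\<psi> (m + int p * r)) * \<psi> m"
      using \<psi>1 unfolding kd corr_summand_def mk[symmetric] by (simp add: mult.assoc)
  next
    fix k assume k: "k \<in> {u..<v}"
    show "(b + int q * k - b) div int q = k" using q0 by simp
    show "b + int q * k \<in> {m\<in>?I. m + int p * r \<in> ?I \<and> m mod int q = b mod int q}"
      using uv(3)[of k] k by simp
  qed
  also have "\<dots> = (\<phi> (b + int p * r) * cnj (\<phi> b)) * (\<Sum>k\<in>{u..<v}. corr_summand p q y b \<theta> r k)"
    by (simp add: sum_distrib_left)
  finally have "cmod (twisted_correlation p q \<phi> \<psi> ?I r (b mod int q)) = cmod (\<Sum>k\<in>{u..<v}. corr_summand p q y b \<theta> r k)"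
    using \<phi>(2)[OF br] \<phi>(2)[OF b(2)] by (simp add: norm_mult)
  thus ?thesis using that uv(1,2) unfolding \<theta>_def by blast
qed

text \<open>The twist introduced by completion is linear in k and is absorbed into the frequency
  \<open>\<theta> r\<close>, which \<open>inverse_sum_mean_square\<close> leaves arbitrary.\<close>

lemma corr_summand_majorant_mean_square:
  assumes p: "prime p" and q: "prime q" and pq: "p \<noteq> q"
    and y: "\<And>n. \<not> int p dvd n \<Longrightarrow> [n * y n = 1] (mod int p)"
    and m: "0 < m" "m \<le> p"
  shows "(\<Sum>r\<in>{c..<c + int R}. (window_majorant m (corr_summand p q y b (\<theta> r) r))\<^sup>2)
    \<le> (2 + ln (real m))\<^sup>2 * (real R * real m + 2 * real m * sqrt (real R * ((real R + real p) * (2 * real m))))"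
proof (rule window_majorant_mean_square[OF m(1)])
  fix t
  have "\<not> int p dvd int q" using primes_dvd_imp_eq[OF p q] pq by auto
  have "corr_summand p q y b (\<theta> r) r k * e (of_int k * of_int t / real m) =
      (if int p dvd b + int q * k then 0 else
        e (of_int k * (\<theta> r + of_int t / real m)) * e (- of_int (r * y (b + int q * k)) / real p))" for r k
    by (simp add: corr_summand_def e_add distrib_left mult_ac)
  thus "(\<Sum>r\<in>{c..<c + int R}. (cmod (\<Sum>k\<in>{0..<int m}.
      corr_summand p q y b (\<theta> r) r k * e (of_int k * of_int t / real m)))\<^sup>2)
    \<le> real R * real m + 2 * real m * sqrt (real R * ((real R + real p) * (2 * real m)))"
    using inverse_sum_mean_square[OF p y \<open>\<not> int p dvd int q\<close> m(2), where \<theta> = "\<lambda>r. \<theta> r + of_int t / real m"]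
    by simp
qed

lemma atLeastAtMost_symmetric_eq: "{- int L..int L} = {- int L..<- int L + int (2 * L + 1)}"
  by auto

lemma ex_representative:
  assumes "q > 0"
  obtains b' where "b' \<in> {a..<a + int q}" "b' mod int q = b mod int q"
proof
  show "a + (b - a) mod int q \<in> {a..<a + int q}" using assms by simp
  have "(a + (b - a) mod int q) mod int q = (a + (b - a)) mod int q" by (rule mod_add_right_eq)
  thus "(a + (b - a) mod int q) mod int q = b mod int q" by simp
qed

text \<open>R counts the shifts r with |r| <= N div p, and Y bounds the range of k. As Y <= p the
  range fits into one period, so completion is done modulo Y itself; Cauchy--Schwarz over r then
  gives the outer root.\<close>

lemma pair_bound_window:
  fixes N p q :: nat
  defines "R \<equiv> 2 * (N div p) + 1" and "Y \<equiv> N div q + 1"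
  assumes p: "prime p" and q: "prime q" and pq: "p \<noteq> q" and F: "twisted q F" and G: "twisted p G"
    and Y: "Y \<le> p"
  shows "(cmod (\<Sum>n\<in>{a..<a + int N}. F n * cnj (G n)))\<^sup>2
    \<le> sqrt (real R * ((2 + ln (real Y))\<^sup>2 *
         (real R * real Y + 2 * real Y * sqrt (real R * ((real R + real p) * (2 * real Y))))))
       * sqsum q F * sqsum p G"
proof -
  let ?I = "{a..<a + int N}" and ?R = "{- int (N div p)..int (N div p)}"
  have q0: "q > 0" using q by (simp add: prime_gt_0_nat)
  have Req: "?R = {- int (N div p)..<- int (N div p) + int R}"
    unfolding R_def by (rule atLeastAtMost_symmetric_eq)
  obtain x where x: "\<And>n. \<not> int q dvd n \<Longrightarrow> [n * x n = 1] (mod int q)"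
    using ex_inverse_function[OF q] by blast
  obtain y where y: "\<And>n. \<not> int p dvd n \<Longrightarrow> [n * y n = 1] (mod int p)"
    using ex_inverse_function[OF p] by blast
  obtain \<phi> where \<phi>: "twisted q \<phi>" "\<And>n. \<not> int q dvd n \<Longrightarrow> cmod (\<phi> n) = 1"
    "\<And>F n. twisted q F \<Longrightarrow> F n = F (n mod int q) * \<phi> n"
    using ex_unit_twisted[OF q x] by blast
  obtain \<psi> where \<psi>: "twisted p \<psi>" "\<And>n. \<not> int p dvd n \<Longrightarrow> cmod (\<psi> n) = 1"
    "\<And>F n. twisted p F \<Longrightarrow> F n = F (n mod int p) * \<psi> n"
    using ex_unit_twisted[OF p y] by blast
  show ?thesis
  proof (rule pair_bound_of_correlations[OF p q \<phi>(3) \<psi>(3) _ F G])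
    fix b0 assume b0: "\<not> int q dvd b0"
    obtain b where b: "b \<in> {a..<a + int q}" "b mod int q = b0 mod int q"
      using ex_representative[OF q0] by blast
    have nb: "\<not> int q dvd b" using b0 b(2) by (metis dvd_mod_iff dvd_refl)
    define \<theta> where "\<theta> = (\<lambda>r. real_of_int (x (b + int p * r) - x b) / real q)"
    define W where "W = (\<lambda>r. window_majorant Y (corr_summand p q y b (\<theta> r) r))"
    have T: "cmod (twisted_correlation p q \<phi> \<psi> ?I r (b0 mod int q)) \<le> W r" for r
    proof (cases "int q dvd b + int p * r")
      case True
      thus ?thesis
        using twisted_correlation_eq_0[OF \<phi>(1) True] window_majorant_nonneg
        by (simp add: W_def b(2)[symmetric])
    next
      case False
      obtain u v where uv: "0 \<le> u" "v \<le> int (N div q) + 1"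
        "cmod (twisted_correlation p q \<phi> \<psi> ?I r (b mod int q)) =
          cmod (\<Sum>k\<in>{u..<v}. corr_summand p q y b (\<theta> r) r k)"
        unfolding \<theta>_def using norm_twisted_correlation_le[OF p q x y \<phi>(1,2) \<psi>(1,2) b(1) nb False, of N] by blast
      have "cmod (\<Sum>k\<in>{u..<v}. corr_summand p q y b (\<theta> r) r k) \<le> W r"
        unfolding W_def by (rule norm_window_sum_le) (use uv in \<open>auto simp: Y_def\<close>)
      thus ?thesis using uv(3) by (simp add: b(2))
    qed
    have "(\<Sum>r\<in>?R. cmod (twisted_correlation p q \<phi> \<psi> ?I r (b0 mod int q))) \<le> (\<Sum>r\<in>?R. 1 * W r)"
      using T by (simp add: sum_mono)
    also have "\<dots> \<le> sqrt ((\<Sum>r\<in>?R. 1\<^sup>2) * (\<Sum>r\<in>?R. (W r)\<^sup>2))"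
      by (intro real_le_rsqrt Cauchy_Schwarz_ineq_sum)
    also have "(\<Sum>r\<in>?R. 1\<^sup>2) = real R" by (simp add: Req)
    also have "sqrt (real R * (\<Sum>r\<in>?R. (W r)\<^sup>2)) \<le> sqrt (real R * ((2 + ln (real Y))\<^sup>2 *
         (real R * real Y + 2 * real Y * sqrt (real R * ((real R + real p) * (2 * real Y))))))"
      unfolding W_def Req
      by (intro real_sqrt_le_mono mult_left_mono corr_summand_majorant_mean_square[OF p q pq y _ Y])
         (auto simp: Y_def)
    finally show "(\<Sum>r\<in>?R. cmod (twisted_correlation p q \<phi> \<psi> ?I r (b0 mod int q))) \<le> \<dots>" .
  qed
qed

text \<open>Moving k by p j keeps b + q k, hence its inverse, fixed modulo p. Only the linear phase
  changes, by a power of e(p w/q).\<close>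

lemma corr_summand_quasi_periodic:
  assumes p: "prime p" and q: "q > 0" and y: "\<And>n. \<not> int p dvd n \<Longrightarrow> [n * y n = 1] (mod int p)"
  shows "corr_summand p q y b (of_int w / real q) r (k + int p * j) =
    corr_summand p q y b (of_int w / real q) r k * e (of_int j * of_int (int p * w) / real q)"
proof (cases "int p dvd b + int q * k")
  case True
  hence "int p dvd (b + int q * k) + int p * (int q * j)" by (rule dvd_add) simp
  hence "int p dvd b + int q * (k + int p * j)" by (simp add: algebra_simps)
  thus ?thesis using True by (simp add: corr_summand_def)
next
  case False
  have p0: "p > 0" using p by (simp add: prime_gt_0_nat)
  have eq: "b + int q * (k + int p * j) = (b + int q * k) + int p * (int q * j)"
    by (simp add: algebra_simps)
  have False': "\<not> int p dvd b + int q * (k + int p * j)"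
    unfolding eq using False by (simp add: dvd_add_left_iff)
  have "[b + int q * (k + int p * j) = b + int q * k] (mod int p)"
    unfolding eq by (simp add: cong_iff_dvd_diff)
  hence "[y (b + int q * (k + int p * j)) = y (b + int q * k)] (mod int p)"
    using inverse_cong_unique[OF y[OF False'] y[OF False]] by simp
  hence "[- (r * y (b + int q * (k + int p * j))) = - (r * y (b + int q * k))] (mod int p)"
    by (simp add: cong_minus_minus_iff cong_scalar_left)
  hence "e (of_int (- (r * y (b + int q * (k + int p * j)))) / real p) = e (of_int (- (r * y (b + int q * k))) / real p)"
    by (rule e_int_div_eqI) (rule p0)
  moreover have "of_int (k + int p * j) * (of_int w / real q) =
      of_int k * (of_int w / real q) + of_int j * of_int (int p * w) / real q"
    using q by (simp add: field_simps)
  ultimately show ?thesis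
    using False False' by (simp add: corr_summand_def e_add)
qed

text \<open>When k runs over more than p values, each row entry is at most (2 + D) W, where D bounds
  the Dirichlet kernel of the at most J full periods and W the sum over one period. Cauchy--Schwarz
  over r separates them. The frequency p w(r) modulo q determines r modulo q, because inverses do,
  so the squares of D sum like those of \<open>dker\<close> over distinct residues.\<close>

lemma pair_bound_periods:
  fixes N p q :: nat
  defines "R \<equiv> 2 * (N div p) + 1" and "J \<equiv> real (N div q + 1) / real p"
  assumes p: "prime p" and q: "prime q" and pq: "p \<noteq> q" and F: "twisted q F" and G: "twisted p G"
  shows "(cmod (\<Sum>n\<in>{a..<a + int N}. F n * cnj (G n)))\<^sup>2
    \<le> sqrt ((8 * real R + 2 * ((real R / real q + 1) * (J * (J + real q * (1 + ln (real q)))))) *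
        ((2 + ln (real p))\<^sup>2 *
         (real R * real p + 2 * real p * sqrt (real R * ((real R + real p) * (2 * real p))))))
       * sqsum q F * sqsum p G"
proof -
  let ?I = "{a..<a + int N}" and ?R = "{- int (N div p)..int (N div p)}"
  have q0: "q > 0" and p0: "p > 0" using p q by (auto simp: prime_gt_0_nat)
  have J0: "J \<ge> 0" by (simp add: J_def)
  have Req: "?R = {- int (N div p)..<- int (N div p) + int R}"
    unfolding R_def by (rule atLeastAtMost_symmetric_eq)
  obtain x where x: "\<And>n. \<not> int q dvd n \<Longrightarrow> [n * x n = 1] (mod int q)"
    using ex_inverse_function[OF q] by blast
  obtain y where y: "\<And>n. \<not> int p dvd n \<Longrightarrow> [n * y n = 1] (mod int p)"
    using ex_inverse_function[OF p] by blast
  obtain \<phi> where \<phi>: "twisted q \<phi>" "\<And>n. \<not> int q dvd n \<Longrightarrow> cmod (\<phi> n) = 1"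
    "\<And>F n. twisted q F \<Longrightarrow> F n = F (n mod int q) * \<phi> n"
    using ex_unit_twisted[OF q x] by blast
  obtain \<psi> where \<psi>: "twisted p \<psi>" "\<And>n. \<not> int p dvd n \<Longrightarrow> cmod (\<psi> n) = 1"
    "\<And>F n. twisted p F \<Longrightarrow> F n = F (n mod int p) * \<psi> n"
    using ex_unit_twisted[OF p y] by blast
  show ?thesis
  proof (rule pair_bound_of_correlations[OF p q \<phi>(3) \<psi>(3) _ F G])
    fix b0 assume b0: "\<not> int q dvd b0"
    obtain b where b: "b \<in> {a..<a + int q}" "b mod int q = b0 mod int q"
      using ex_representative[OF q0] by blast
    have nb: "\<not> int q dvd b" using b0 b(2) by (metis dvd_mod_iff dvd_refl)
    define w where "w = (\<lambda>r. x (b + int p * r) - x b)"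
    define W where "W = (\<lambda>r. window_majorant p (corr_summand p q y b (of_int (w r) / real q) r))"
    \<comment> \<open>For q dividing b + p r the correlation vanishes and \<open>x\<close> has no
      prescribed value; the default 0 keeps D periodic in r modulo q.\<close>
    define D where "D = (\<lambda>r. if int q dvd b + int p * r then 0 else dker J q (int p * w r))"
    have T: "cmod (twisted_correlation p q \<phi> \<psi> ?I r (b0 mod int q)) \<le> (2 + D r) * W r" for r
    proof (cases "int q dvd b + int p * r")
      case True
      thus ?thesis
        using twisted_correlation_eq_0[OF \<phi>(1) True] window_majorant_nonneg
        by (simp add: W_def D_def b(2)[symmetric])
    next
      case False
      obtain u v where uv: "0 \<le> u" "v \<le> int (N div q) + 1"
        "cmod (twisted_correlation p q \<phi> \<psi> ?I r (b mod int q)) =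
          cmod (\<Sum>k\<in>{u..<v}. corr_summand p q y b (of_int (w r) / real q) r k)"
        unfolding w_def using norm_twisted_correlation_le[OF p q x y \<phi>(1,2) \<psi>(1,2) b(1) nb False, of N] by blast
      have "cmod (\<Sum>k\<in>{u..<v}. corr_summand p q y b (of_int (w r) / real q) r k)
          \<le> (2 + dker J q (int p * w r)) * W r"
        unfolding W_def
      proof (rule quasi_periodic_sum_le[OF p0 q0 corr_summand_quasi_periodic[OF p q0 y] _ J0])
        have "real_of_int (v - u) \<le> real (N div q + 1)" using uv(1,2) by linarith
        thus "real_of_int (v - u) / real p \<le> J" unfolding J_def by (rule divide_right_mono) simp
      qed
      thus ?thesis using uv(3) False by (simp add: b(2) D_def)
    qed
    have D: "(\<Sum>r\<in>?R. (D r)\<^sup>2) \<le> (real R / real q + 1) * (J * (J + real q * (1 + ln (real q))))"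
    proof -
      have w_cong: "[b + int p * r = b + int p * r'] (mod int q) \<longleftrightarrow> [w r = w r'] (mod int q)"
        if "\<not> int q dvd b + int p * r" "\<not> int q dvd b + int p * r'" for r r'
        using inverse_cong_unique[OF x[OF that(1)] x[OF that(2)]]
        by (simp add: w_def cong_iff_dvd_diff)
      have cop: "coprime (int p) (int q)" using primes_coprime[OF p q pq] by simp
      have "(\<Sum>r\<in>?R. (D r)\<^sup>2) \<le> (real R / real q + 1) * (\<Sum>r\<in>{0..<int q}. (D r)\<^sup>2)"
        unfolding Req
      proof (rule sum_periodic_le[OF q0])
        fix r
        have br: "[b + int p * r = b + int p * (r mod int q)] (mod int q)"
          by (intro cong_add cong_refl cong_scalar_left) (simp add: cong_def)
        hence dv: "int q dvd b + int p * r \<longleftrightarrow> int q dvd b + int p * (r mod int q)"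
          by (rule cong_dvd_iff)
        show "(D r)\<^sup>2 = (D (r mod int q))\<^sup>2"
        proof (cases "int q dvd b + int p * r")
          case False
          hence "[w r = w (r mod int q)] (mod int q)"
            using w_cong[of r "r mod int q"] br dv by simp
          hence "dker J q (int p * w r) = dker J q (int p * w (r mod int q))"
            by (intro dker_cong cong_scalar_left)
          thus ?thesis using dv by (simp add: D_def)
        qed (use dv in \<open>simp add: D_def\<close>)
      qed simp
      also have "(\<Sum>r\<in>{0..<int q}. (D r)\<^sup>2) \<le> J * (J + real q * (1 + ln (real q)))"
      proof -
        define A where "A = {r\<in>{0..<int q}. \<not> int q dvd b + int p * r}"
        have A_sub: "A \<subseteq> {0..<int q}" by (auto simp: A_def)
        have inj: "inj_on (\<lambda>r. int p * w r mod int q) A"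
        proof (rule inj_onI)
          fix r r' assume r: "r \<in> A" "r' \<in> A" and "int p * w r mod int q = int p * w r' mod int q"
          hence "[int p * w r = int p * w r'] (mod int q)" by (simp add: cong_def)
          hence "[w r = w r'] (mod int q)" using cop cong_mult_lcancel by blast
          hence "[b + int p * r = b + int p * r'] (mod int q)"
            using w_cong[of r r'] r by (simp add: A_def)
          hence "[int p * r = int p * r'] (mod int q)" by (simp add: cong_add_lcancel)
          hence "[r = r'] (mod int q)" using cop cong_mult_lcancel by blast
          thus "r = r'" using r by (simp add: A_def cong_def)
        qed
        have "(\<Sum>r\<in>{0..<int q}. (D r)\<^sup>2) = (\<Sum>r\<in>A. (D r)\<^sup>2)"
          by (rule sum.mono_neutral_right[OF _ A_sub]) (auto simp: A_def D_def)
        also have "\<dots> = (\<Sum>r\<in>A. (dker J q (int p * w r mod int q))\<^sup>2)"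
        proof (rule sum.cong[OF refl])
          fix r assume "r \<in> A"
          moreover have "dker J q (int p * w r) = dker J q (int p * w r mod int q)"
            by (rule dker_cong) (simp add: cong_def)
          ultimately show "(D r)\<^sup>2 = (dker J q (int p * w r mod int q))\<^sup>2"
            by (simp add: A_def D_def)
        qed
        also have "\<dots> = (\<Sum>t\<in>(\<lambda>r. int p * w r mod int q) ` A. (dker J q t)\<^sup>2)"
          by (subst sum.reindex[OF inj]) simp
        also have "\<dots> \<le> (\<Sum>t\<in>{0..<int q}. (dker J q t)\<^sup>2)"
          using q0 by (intro sum_mono2) auto
        also have "\<dots> \<le> J * (J + real q * (1 + ln (real q)))"
          by (rule sum_dker_square_le[OF q0 J0])
        finally show ?thesis .
      qed
      finally show ?thesis by (simp add: mult_left_mono)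
    qed
    have "(\<Sum>r\<in>?R. cmod (twisted_correlation p q \<phi> \<psi> ?I r (b0 mod int q))) \<le> (\<Sum>r\<in>?R. (2 + D r) * W r)"
      using T by (intro sum_mono)
    also have "\<dots> \<le> sqrt ((\<Sum>r\<in>?R. (2 + D r)\<^sup>2) * (\<Sum>r\<in>?R. (W r)\<^sup>2))"
      by (intro real_le_rsqrt Cauchy_Schwarz_ineq_sum)
    also have "\<dots> \<le> sqrt ((8 * real R + 2 * ((real R / real q + 1) * (J * (J + real q * (1 + ln (real q)))))) *
        ((2 + ln (real p))\<^sup>2 *
         (real R * real p + 2 * real p * sqrt (real R * ((real R + real p) * (2 * real p))))))"
    proof (intro real_sqrt_le_mono mult_mono)
      have "(\<Sum>r\<in>?R. (2 + D r)\<^sup>2) \<le> (\<Sum>r\<in>?R. 8 + 2 * (D r)\<^sup>2)"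
      proof (rule sum_mono)
        fix r
        have "0 \<le> (2 - D r)\<^sup>2" by simp
        thus "(2 + D r)\<^sup>2 \<le> 8 + 2 * (D r)\<^sup>2" by (simp add: power2_eq_square algebra_simps)
      qed
      also have "\<dots> = 8 * real R + 2 * (\<Sum>r\<in>?R. (D r)\<^sup>2)"
        by (simp add: sum.distrib sum_distrib_left Req)
      finally show "(\<Sum>r\<in>?R. (2 + D r)\<^sup>2) \<le> 8 * real R + 2 * ((real R / real q + 1) * (J * (J + real q * (1 + ln (real q)))))"
        using D by linarith
      show "(\<Sum>r\<in>?R. (W r)\<^sup>2) \<le> (2 + ln (real p))\<^sup>2 *
         (real R * real p + 2 * real p * sqrt (real R * ((real R + real p) * (2 * real p))))"
        unfolding W_def Req by (rule corr_summand_majorant_mean_square[OF p q pq y p0 order_refl])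
      have "ln (real q) \<ge> 0" using q0 by simp
      thus "0 \<le> 8 * real R + 2 * ((real R / real q + 1) * (J * (J + real q * (1 + ln (real q)))))"
        using J0 by (intro add_nonneg_nonneg mult_nonneg_nonneg) auto
    qed (simp add: sum_nonneg)
    finally show "(\<Sum>r\<in>?R. cmod (twisted_correlation p q \<phi> \<psi> ?I r (b0 mod int q))) \<le> \<dots>" .
  qed
qed

section \<open>Numerical estimates and one pair bound for all ranges\<close>

definition sieve_bound :: "real \<Rightarrow> real \<Rightarrow> real" where
  "sieve_bound N Q = N * Q powr (1/2) + N powr (1/4) * Q ^ 2 + N powr (3/4) * Q powr (11/8)"

text \<open>Large enough for 2 + ln x with x <= 3 P and also for 1 + ln (p q) with p and q at most 3
  P, whence the doubled logarithm.\<close>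

definition log_factor :: "nat \<Rightarrow> real" where
  "log_factor P = 2 + 2 * ln (3 * real P)"

lemma log_factor_ge: "P > 0 \<Longrightarrow> log_factor P \<ge> 2"
  by (simp add: log_factor_def)

lemma ln_le_log_factor:
  assumes "P > 0" "0 < x" "x \<le> 3 * real P"
  shows "2 + ln x \<le> log_factor P" "1 + ln x \<le> log_factor P"
proof -
  have "1 \<le> 3 * real P" using assms(1) by linarith
  hence "0 \<le> ln (3 * real P)" by (rule ln_ge_zero)
  moreover have "ln x \<le> ln (3 * real P)" using assms by simp
  ultimately show "2 + ln x \<le> log_factor P" "1 + ln x \<le> log_factor P"
    by (simp_all add: log_factor_def)
qed

text \<open>Here s is the square root of P and y = N/P. From y <= s^2 one gets R + p <= 6 s^2, so
  the inner root is at most 9 y s; the bracket is then at most (6 + 36) y^2 s, and 126 = 3 *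
  42.\<close>

lemma window_numerics:
  fixes R Y p y s l :: real
  assumes "1 \<le> y" "y \<le> s\<^sup>2" "1 \<le> s" "0 \<le> R" "R \<le> 3 * y" "0 \<le> Y" "Y \<le> 2 * y" "0 \<le> p" "p \<le> 3 * s\<^sup>2"
  shows "R * (l\<^sup>2 * (R * Y + 2 * Y * sqrt (R * ((R + p) * (2 * Y))))) \<le> 126 * l\<^sup>2 * (y ^ 3 * s)"
proof -
  have "R * ((R + p) * (2 * Y)) \<le> (3 * y) * ((6 * s\<^sup>2) * (2 * (2 * y)))"
    using assms by (intro mult_mono) auto
  also have "\<dots> \<le> (9 * y * s)\<^sup>2"
    using assms by (simp add: power2_eq_square mult_ac)
  finally have "sqrt (R * ((R + p) * (2 * Y))) \<le> 9 * y * s"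
    using assms by (intro real_le_lsqrt) auto
  hence "2 * Y * sqrt (R * ((R + p) * (2 * Y))) \<le> (2 * (2 * y)) * (9 * y * s)"
    using assms by (intro mult_mono) auto
  hence "2 * Y * sqrt (R * ((R + p) * (2 * Y))) \<le> 36 * (y\<^sup>2 * s)"
    by (simp add: power2_eq_square mult_ac)
  moreover have "R * Y \<le> 6 * (y\<^sup>2 * s)"
  proof -
    have "R * Y \<le> (3 * y) * (2 * y)" using assms by (intro mult_mono) auto
    also have "\<dots> = 6 * (y\<^sup>2 * 1)" by (simp add: power2_eq_square)
    also have "\<dots> \<le> 6 * (y\<^sup>2 * s)" using assms by (intro mult_left_mono) auto
    finally show ?thesis .
  qed
  ultimately have "R * Y + 2 * Y * sqrt (R * ((R + p) * (2 * Y))) \<le> 42 * y\<^sup>2 * s" by linarith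
  hence "R * (l\<^sup>2 * (R * Y + 2 * Y * sqrt (R * ((R + p) * (2 * Y))))) \<le> (3 * y) * (l\<^sup>2 * (42 * y\<^sup>2 * s))"
    using assms by (intro mult_mono mult_nonneg_nonneg add_nonneg_nonneg) auto
  thus ?thesis by (simp add: power2_eq_square power3_eq_cube mult_ac)
qed

text \<open>The same s and y, now with y >= s^2, so R + p <= 6 y. The condition y <= s^4 makes J at
  most a constant times s^2, so J + q l1 has the size of q l. The constants are 104 = 24 + 2 * 40
  and 75 = 9 + 66, with product 7800; the final size y^3 s agrees with
  \<open>window_numerics\<close>.\<close>

lemma periods_numerics:
  fixes R J p q y s l :: real
  assumes "s\<^sup>2 \<le> y" "y \<le> s ^ 4" "1 \<le> s" "0 \<le> R" "R \<le> 3 * y" "0 \<le> J" "J \<le> 2 * y / s\<^sup>2"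
    "s\<^sup>2 \<le> p" "p \<le> 3 * s\<^sup>2" "s\<^sup>2 \<le> q" "q \<le> 3 * s\<^sup>2" "1 \<le> l" "0 \<le> l1" "l1 \<le> l" "0 \<le> l2" "l2 \<le> l"
  shows "(8 * R + 2 * ((R / q + 1) * (J * (J + q * l1)))) *
      (l2\<^sup>2 * (R * p + 2 * p * sqrt (R * ((R + p) * (2 * p))))) \<le> 7800 * l ^ 3 * (y ^ 3 * s)"
proof -
  have s2: "s\<^sup>2 > 0" "1 \<le> s\<^sup>2" using assms by simp_all
  have y: "y \<ge> 1" using assms s2 by linarith
  have A: "8 * R + 2 * ((R / q + 1) * (J * (J + q * l1))) \<le> 104 * (y\<^sup>2 * l / s\<^sup>2)"
  proof -
    have "R / q \<le> 3 * y / s\<^sup>2" using assms s2 by (intro frac_le) auto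
    moreover have "1 \<le> y / s\<^sup>2" using assms s2 by simp
    ultimately have 1: "R / q + 1 \<le> 4 * y / s\<^sup>2" by simp
    have "2 * y / s\<^sup>2 \<le> 2 * s\<^sup>2"
      using assms s2 by (simp add: field_simps flip: power_add)
    hence "J \<le> 2 * s\<^sup>2 * l" using assms s2 mult_left_mono[of 1 l "2 * s\<^sup>2"] by linarith
    moreover have "q * l1 \<le> (3 * s\<^sup>2) * l" using assms s2 by (intro mult_mono) auto
    ultimately have 2: "J + q * l1 \<le> 5 * s\<^sup>2 * l" by linarith
    have "J * (J + q * l1) \<le> (2 * y / s\<^sup>2) * (5 * s\<^sup>2 * l)"
      using assms s2 y by (intro mult_mono 2) auto
    also have "\<dots> = 10 * y * l" using s2 by simp
    finally have "J * (J + q * l1) \<le> 10 * y * l" .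
    hence "(R / q + 1) * (J * (J + q * l1)) \<le> (4 * y / s\<^sup>2) * (10 * y * l)"
      by (rule mult_mono[OF 1]) (use assms s2 y in \<open>auto intro!: mult_nonneg_nonneg add_nonneg_nonneg\<close>)
    also have "\<dots> = 40 * (y\<^sup>2 * l / s\<^sup>2)" by (simp add: power2_eq_square)
    finally have 3: "(R / q + 1) * (J * (J + q * l1)) \<le> 40 * (y\<^sup>2 * l / s\<^sup>2)" .
    have "y * 1 \<le> y * (y / s\<^sup>2 * l)"
    proof (rule mult_left_mono)
      have "1 * 1 \<le> y / s\<^sup>2 * l" using assms s2 by (intro mult_mono) auto
      thus "1 \<le> y / s\<^sup>2 * l" by simp
    qed (use y in simp)
    hence "8 * R \<le> 24 * (y\<^sup>2 * l / s\<^sup>2)" using assms by (simp add: power2_eq_square)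
    thus ?thesis using 3 by linarith
  qed
  have B: "R * p + 2 * p * sqrt (R * ((R + p) * (2 * p))) \<le> 75 * (y * s\<^sup>2 * s)"
  proof -
    have "R * ((R + p) * (2 * p)) \<le> (3 * y) * ((6 * y) * (2 * (3 * s\<^sup>2)))"
      using assms s2 y by (intro mult_mono) auto
    also have "\<dots> = 108 * (y * s)\<^sup>2" by (simp add: power2_eq_square)
    also have "\<dots> \<le> 121 * (y * s)\<^sup>2" by simp
    also have "\<dots> = (11 * y * s)\<^sup>2" by (simp add: power_mult_distrib)
    finally have "sqrt (R * ((R + p) * (2 * p))) \<le> 11 * y * s"
      using assms y by (intro real_le_lsqrt) auto
    hence "2 * p * sqrt (R * ((R + p) * (2 * p))) \<le> (2 * (3 * s\<^sup>2)) * (11 * y * s)"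
      using assms s2 y by (intro mult_mono) auto
    moreover have "R * p \<le> (3 * y) * (3 * s\<^sup>2)" using assms s2 y by (intro mult_mono) auto
    moreover have "y * s\<^sup>2 * 1 \<le> y * s\<^sup>2 * s" using assms y by (intro mult_left_mono) auto
    ultimately show ?thesis by (simp add: mult_ac)
  qed
  have "(8 * R + 2 * ((R / q + 1) * (J * (J + q * l1)))) *
      (l2\<^sup>2 * (R * p + 2 * p * sqrt (R * ((R + p) * (2 * p))))) \<le>
      (104 * (y\<^sup>2 * l / s\<^sup>2)) * (l\<^sup>2 * (75 * (y * s\<^sup>2 * s)))"
    using assms s2 y
    by (intro mult_mono A B power_mono) (auto intro!: mult_nonneg_nonneg add_nonneg_nonneg)
  also have "\<dots> = 7800 * l ^ 3 * (y ^ 3 * s)"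
    using s2 by (simp add: field_simps power2_eq_square power3_eq_cube)
  finally show ?thesis .
qed

lemma uniform_pair_bound:
  fixes P N :: nat
  assumes P: "P \<ge> 1" and N: "N \<ge> 1"
  obtains X :: real where "X \<ge> 0"
    "real P ^ 2 * sqrt X \<le> 10 * log_factor P * sieve_bound (real N) (real P)"
    "\<And>p q F G a. prime p \<Longrightarrow> prime q \<Longrightarrow> p \<noteq> q \<Longrightarrow> P < p \<Longrightarrow> p \<le> 3 * P \<Longrightarrow> P < q \<Longrightarrow> q \<le> 3 * P \<Longrightarrow>
       twisted q F \<Longrightarrow> twisted p G \<Longrightarrow>
       (cmod (\<Sum>n\<in>{a..<a + int N}. F n * cnj (G n)))\<^sup>2 \<le> X * sqsum q F * sqsum p G"
proof -
  define l where "l = log_factor P"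
  define s where "s = sqrt (real P)"
  define y where "y = real N / real P"
  have l: "l \<ge> 2" using log_factor_ge[of P] P by (simp add: l_def)
  have s: "s \<ge> 1" "s\<^sup>2 = real P" using P by (simp_all add: s_def)
  have s': "s = real P powr (1/2)" by (simp add: s_def powr_half_sqrt)
  have nn: "real N * real P powr (1/2) \<ge> 0" "real N powr (1/4) * real P ^ 2 \<ge> 0"
    "real N powr (3/4) * real P powr (11/8) \<ge> 0" by simp_all
  have main: "real N * real P powr (1/2) \<le> sieve_bound N P"
    "real N powr (1/4) * real P ^ 2 \<le> sieve_bound N P"
    "real N powr (3/4) * real P powr (11/8) \<le> sieve_bound N P"
    using nn unfolding sieve_bound_def by linarith+
  have y_cases: "2 * (real N / real p) \<le> 2 * y" "real N / real p \<le> y" if "P < p" for p :: nat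
  proof -
    have "real N / real p \<le> real N / real P" using that P by (intro divide_left_mono) auto
    thus "2 * (real N / real p) \<le> 2 * y" "real N / real p \<le> y" by (simp_all add: y_def)
  qed
  have R_le: "real (2 * (N div p) + 1) \<le> 3 * y" if "P < p" "y \<ge> 1" for p :: nat
    using y_cases[OF that(1)] that(2) of_nat_div_le_of_nat[of N p, where 'a = real] by simp
  have Y_le: "real (N div p + 1) \<le> 2 * y" if "P < p" "y \<ge> 1" for p :: nat
    using y_cases[OF that(1)] that(2) of_nat_div_le_of_nat[of N p, where 'a = real] by simp
  \<comment> \<open>Serves both middle ranges: 126 l^2 from the window bound is smaller than 7800
    l^3.\<close>
  define Z where "Z = 7800 * l ^ 3 * (y ^ 3 * s)"
  have Z0: "Z \<ge> 0" using l s by (simp add: Z_def y_def)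
  have Z_bound: "real P ^ 2 * sqrt (sqrt Z) \<le> 10 * l * sieve_bound N P"
  proof -
    have "real P ^ 2 * sqrt (sqrt Z) \<le> 10 * l * (real N powr (3/4) * real P powr (11/8))"
    \<comment> \<open>Fourth powers remove both roots: P^8 Z = 7800 l^3 N^3 P^(11/2). The factor 10
      l comes from 7800 <= 10^4 and l^3 <= l^4.\<close>
    proof (rule power_le_imp_le_base[of _ 3])
      have "(sqrt (sqrt Z)) ^ 4 = Z"
        using Z0 by (simp add: power4_eq_xxxx) (simp add: mult.assoc)
      moreover have "y ^ 3 * s = real N ^ 3 * real P powr (- (5/2))"
      proof -
        have "real P powr (- (5/2)) = real P powr (1/2) / real P powr 3"
          by (subst powr_diff[symmetric]) simp
        also have "real P powr 3 = real P ^ 3" using P by (simp add: powr_numeral)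
        finally show ?thesis by (simp add: y_def s' power_divide)
      qed
      ultimately have "(real P ^ 2 * sqrt (sqrt Z)) ^ 4 = 7800 * l ^ 3 * (real N ^ 3 * (real P ^ 8 * real P powr (- (5/2))))"
        by (simp add: power_mult_distrib Z_def flip: power_mult)
      also have "real P ^ 8 * real P powr (- (5/2)) = real P powr (11/2)"
        using P by (simp add: powr_add[symmetric] flip: powr_numeral)
      also have "7800 * l ^ 3 * (real N ^ 3 * real P powr (11/2)) \<le> (10 ^ 4 * l ^ 4) * (real N ^ 3 * real P powr (11/2))"
      proof (rule mult_right_mono)
        have "l ^ 3 \<le> l ^ 4" using l by (intro power_increasing) auto
        moreover have "0 \<le> l ^ 3" using l by simp
        ultimately have "7800 * l ^ 3 \<le> 10000 * l ^ 4" by linarith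
        thus "7800 * l ^ 3 \<le> 10 ^ 4 * l ^ 4" by simp
      qed simp
      also have "\<dots> = (10 * l * (real N powr (3/4) * real P powr (11/8))) ^ 4"
        using P N by (simp add: power_mult_distrib powr_powr flip: powr_numeral)
      finally show "(real P ^ 2 * sqrt (sqrt Z)) ^ Suc 3 \<le> (10 * l * (real N powr (3/4) * real P powr (11/8))) ^ Suc 3"
        by simp
    qed (use l in simp)
    also have "\<dots> \<le> 10 * l * sieve_bound N P" using main l by (intro mult_left_mono) auto
    finally show ?thesis .
  qed
  \<comment> \<open>At N = P^2 the number of k, about N/q, reaches the period p, which separates the
    window bound from the bound with full periods.\<close>
  consider "N \<le> P" | "P \<le> N" "N \<le> P ^ 2" | "P ^ 2 \<le> N" "N \<le> P ^ 3" | "P ^ 3 \<le> N" by linarith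
  thus ?thesis
  proof cases
    case 1
    have "1 \<le> real N powr (1/4)" using N by (simp add: ge_one_powr_ge_zero)
    hence "1 * real P ^ 2 \<le> real N powr (1/4) * real P ^ 2" by (intro mult_right_mono) auto
    hence "real P ^ 2 \<le> sieve_bound N P" using main by linarith
    moreover have "0 \<le> real P ^ 2" by simp
    moreover have "2 * sieve_bound N P \<le> 10 * l * sieve_bound N P"
      using l calculation by (intro mult_right_mono) linarith+
    ultimately have "real P ^ 2 * sqrt 4 \<le> 10 * l * sieve_bound N P" by simp
    thus ?thesis
      using pair_bound_short_interval 1 by (intro that[of 4]) (auto simp: l_def)
  next
    case 2
    have y: "1 \<le> y" "y \<le> s\<^sup>2"
    proof -
      show "1 \<le> y" using 2 P by (simp add: y_def)
      have "real N \<le> real P * real P" using 2(2) by (metis of_nat_le_iff of_nat_mult power2_eq_square)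
      thus "y \<le> s\<^sup>2" using P unfolding s y_def by (simp add: divide_le_eq)
    qed
    show ?thesis
    proof (rule that[of "sqrt Z"])
      fix p q F G a
      assume pq: "prime p" "prime q" "p \<noteq> q" "P < p" "p \<le> 3 * P" "P < q" "q \<le> 3 * P"
        and F: "twisted q F" and G: "twisted p G"
      have "real (N div q) \<le> y" using y_cases[OF pq(6)] of_nat_div_le_of_nat[of N q, where 'a = real] by simp
      hence "real (N div q) \<le> real P" using y s by linarith
      hence Yp: "N div q + 1 \<le> p" using pq(4) by linarith
      have ln2: "2 + ln (real (N div q + 1)) \<le> l" "0 \<le> 2 + ln (real (N div q + 1))"
        unfolding l_def using Yp pq P by (auto intro!: ln_le_log_factor(1))
      have "sqrt (real (2 * (N div p) + 1) * ((2 + ln (real (N div q + 1)))\<^sup>2 *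
         (real (2 * (N div p) + 1) * real (N div q + 1) + 2 * real (N div q + 1) *
            sqrt (real (2 * (N div p) + 1) * ((real (2 * (N div p) + 1) + real p) * (2 * real (N div q + 1))))))) \<le> sqrt Z"
      proof (rule real_sqrt_le_mono)
        have "real (2 * (N div p) + 1) * ((2 + ln (real (N div q + 1)))\<^sup>2 *
         (real (2 * (N div p) + 1) * real (N div q + 1) + 2 * real (N div q + 1) *
            sqrt (real (2 * (N div p) + 1) * ((real (2 * (N div p) + 1) + real p) * (2 * real (N div q + 1))))))
          \<le> 126 * (2 + ln (real (N div q + 1)))\<^sup>2 * (y ^ 3 * s)"
          by (rule window_numerics[OF y s(1)]) (use R_le Y_le pq y s in auto)
        also have "\<dots> \<le> 7800 * l ^ 3 * (y ^ 3 * s)"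
        proof (rule mult_right_mono)
          have "(2 + ln (real (N div q + 1)))\<^sup>2 \<le> l\<^sup>2" using ln2 by (rule power_mono)
          moreover have "l\<^sup>2 \<le> l ^ 3" using l by (intro power_increasing) auto
          ultimately show "126 * (2 + ln (real (N div q + 1)))\<^sup>2 \<le> 7800 * l ^ 3"
            using zero_le_power2[of l] by linarith
        qed (use y s in simp)
        finally show "real (2 * (N div p) + 1) * ((2 + ln (real (N div q + 1)))\<^sup>2 *
         (real (2 * (N div p) + 1) * real (N div q + 1) + 2 * real (N div q + 1) *
            sqrt (real (2 * (N div p) + 1) * ((real (2 * (N div p) + 1) + real p) * (2 * real (N div q + 1)))))) \<le> Z"
          by (simp only: Z_def)
      qed
      thus "(cmod (\<Sum>n\<in>{a..<a + int N}. F n * cnj (G n)))\<^sup>2 \<le> sqrt Z * sqsum q F * sqsum p G"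
        by (intro order_trans[OF pair_bound_window[OF pq(1,2,3) F G Yp]] mult_right_mono) auto
    qed (use Z0 Z_bound in \<open>auto simp: l_def\<close>)
  next
    case 3
    have y: "s\<^sup>2 \<le> y" "y \<le> s ^ 4"
    proof -
      have "real P * real P \<le> real N" using 3(1) by (metis of_nat_le_iff of_nat_mult power2_eq_square)
      thus "s\<^sup>2 \<le> y" using P unfolding s y_def by (simp add: le_divide_eq)
      have "real N \<le> real P ^ 3" using 3(2) by (metis of_nat_le_iff of_nat_power)
      hence "y \<le> real P ^ 2" using P unfolding y_def by (simp add: divide_le_eq power2_eq_square power3_eq_cube)
      also have "real P ^ 2 = s ^ 4" by (simp flip: s(2) power_mult)
      finally show "y \<le> s ^ 4" .
    qed
    have y1: "y \<ge> 1" using y s by (metis order_trans one_le_power)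
    show ?thesis
    proof (rule that[of "sqrt Z"])
      fix p q F G a
      assume pq: "prime p" "prime q" "p \<noteq> q" "P < p" "p \<le> 3 * P" "P < q" "q \<le> 3 * P"
        and F: "twisted q F" and G: "twisted p G"
      define R where "R = 2 * (N div p) + 1"
      define J where "J = real (N div q + 1) / real p"
      have lnq: "1 + ln (real q) \<le> l" "0 \<le> 1 + ln (real q)" and lnp: "2 + ln (real p) \<le> l" "0 \<le> 2 + ln (real p)"
        unfolding l_def using pq P by (auto intro!: ln_le_log_factor add_nonneg_nonneg)
      have J: "J \<le> 2 * y / s\<^sup>2"
        unfolding J_def using Y_le[OF pq(6) y1] pq P y1 s by (intro frac_le) auto
      have "(8 * real R + 2 * ((real R / real q + 1) * (J * (J + real q * (1 + ln (real q)))))) *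
        ((2 + ln (real p))\<^sup>2 * (real R * real p + 2 * real p * sqrt (real R * ((real R + real p) * (2 * real p)))))
        \<le> Z"
        unfolding Z_def
        by (rule periods_numerics[OF y s(1)])
           (use R_le[OF pq(4) y1] J pq s l lnp lnq in \<open>auto simp: R_def J_def\<close>)
      hence "sqrt ((8 * real R + 2 * ((real R / real q + 1) * (J * (J + real q * (1 + ln (real q)))))) *
        ((2 + ln (real p))\<^sup>2 * (real R * real p + 2 * real p * sqrt (real R * ((real R + real p) * (2 * real p))))))
        \<le> sqrt Z" by (rule real_sqrt_le_mono)
      thus "(cmod (\<Sum>n\<in>{a..<a + int N}. F n * cnj (G n)))\<^sup>2 \<le> sqrt Z * sqsum q F * sqsum p G"
        unfolding R_def J_def
        by (intro order_trans[OF pair_bound_periods[OF pq(1,2,3) F G]] mult_right_mono) auto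
    qed (use Z0 Z_bound in \<open>auto simp: l_def\<close>)
  next
    case 4
    \<comment> \<open>The long bound consists of 4 N^2/P^4 and 18 l N. For N >= P^3 the second is at
      most 18 l N^2/P^3, and 22 = 4 + 18.\<close>
    define X where "X = 22 * l * real N ^ 2 * real P / real P ^ 4"
    have X0: "X \<ge> 0" using l by (simp add: X_def)
    have "real P ^ 2 * sqrt X \<le> 10 * l * (real N * real P powr (1/2))"
    proof (rule power2_le_imp_le)
      have "(real P ^ 2 * sqrt X)\<^sup>2 = 22 * l * (real N ^ 2 * real P)"
        using P X0 by (simp add: power_mult_distrib X_def flip: power_mult)
      also have "\<dots> \<le> (10\<^sup>2 * l\<^sup>2) * (real N ^ 2 * real P)"
      proof (rule mult_right_mono)
        have "l * 1 \<le> l * l" using l by (intro mult_left_mono) auto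
        thus "22 * l \<le> 10\<^sup>2 * l\<^sup>2" using l by (simp add: power2_eq_square)
      qed simp
      also have "\<dots> = (10 * l * (real N * real P powr (1/2)))\<^sup>2"
        using P by (simp add: power_mult_distrib powr_power)
      finally show "(real P ^ 2 * sqrt X)\<^sup>2 \<le> (10 * l * (real N * real P powr (1/2)))\<^sup>2" .
    qed (use l in simp)
    also have "\<dots> \<le> 10 * l * sieve_bound N P" using main l by (intro mult_left_mono) auto
    finally have X_bound: "real P ^ 2 * sqrt X \<le> 10 * l * sieve_bound N P" .
    show ?thesis
    proof (rule that[of X, OF X0])
      fix p q F G a
      assume pq: "prime p" "prime q" "p \<noteq> q" "P < p" "p \<le> 3 * P" "P < q" "q \<le> 3 * P"
        and F: "twisted q F" and G: "twisted p G"
      define J where "J = real N / real (p * q) + 1"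
      have J0: "J \<ge> 0" by (simp add: J_def)
      have P3: "real P ^ 3 \<le> real N" using 4 by (metis of_nat_le_iff of_nat_power)
      have "real P ^ 2 * 1 \<le> real P ^ 2 * real P" using P by (intro mult_left_mono) auto
      hence "real P ^ 2 \<le> real N" using P3 by (simp add: power2_eq_square power3_eq_cube)
      hence "1 \<le> real N / real P ^ 2" using P by simp
      moreover have "real N / real (p * q) \<le> real N / real P ^ 2"
      proof (rule divide_left_mono)
        show "real P ^ 2 \<le> real (p * q)"
          unfolding of_nat_mult power2_eq_square using pq by (intro mult_mono) auto
      qed (use P pq in auto)
      ultimately have J: "J \<le> 2 * (real N / real P ^ 2)" by (simp add: J_def)
      have pq9: "real (p * q) \<le> 9 * real P ^ 2"
      proof -
        have "real p * real q \<le> (3 * real P) * (3 * real P)" using pq by (intro mult_mono) auto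
        thus ?thesis by (simp add: power2_eq_square)
      qed
      have "ln (real (p * q)) = ln (real p) + ln (real q)"
        using pq P by (simp add: ln_mult)
      also have "\<dots> \<le> ln (3 * real P) + ln (3 * real P)"
        using pq P by (intro add_mono) auto
      finally have lnpq: "1 + ln (real (p * q)) \<le> l" by (simp add: l_def log_factor_def)
      have "p * q \<ge> 1" using pq by (simp add: prime_gt_0_nat Suc_le_eq)
      hence "real (p * q) \<ge> 1" by (simp only: real_of_nat_ge_one_iff)
      hence lnpq0: "0 \<le> 1 + ln (real (p * q))" by (intro add_nonneg_nonneg) auto
      have "J * (J + real (p * q) * (1 + ln (real (p * q)))) \<le>
          (2 * (real N / real P ^ 2)) * (2 * (real N / real P ^ 2) + (9 * real P ^ 2) * l)"
        using J0 l lnpq0 by (intro mult_mono add_mono J pq9 lnpq) (auto intro!: add_nonneg_nonneg mult_nonneg_nonneg)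
      also have "\<dots> = (4 * real N ^ 2 + 18 * l * (real N * real P ^ 4)) / real P ^ 4"
        using P by (simp add: field_simps power2_eq_square power4_eq_xxxx)
      also have "\<dots> \<le> X"
        unfolding X_def
      proof (rule divide_right_mono)
        have "real N * real P * real P ^ 3 \<le> real N * real P * real N" by (intro mult_left_mono P3) auto
        hence "l * (real N * real P ^ 4) \<le> l * (real N ^ 2 * real P)"
          using l by (intro mult_left_mono) (auto simp: power2_eq_square power3_eq_cube power4_eq_xxxx mult_ac)
        moreover have "1 * real N ^ 2 \<le> (l * real P) * real N ^ 2"
        proof (rule mult_right_mono)
          have "1 * 1 \<le> l * real P" using l P by (intro mult_mono) auto
          thus "1 \<le> l * real P" by simp
        qed simp
        ultimately show "4 * real N ^ 2 + 18 * l * (real N * real P ^ 4) \<le> 22 * l * real N ^ 2 * real P"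
          by (simp add: mult_ac)
      qed simp
      finally have "J * (J + real (p * q) * (1 + ln (real (p * q)))) \<le> X" .
      thus "(cmod (\<Sum>n\<in>{a..<a + int N}. F n * cnj (G n)))\<^sup>2 \<le> X * sqsum q F * sqsum p G"
        unfolding J_def
        by (intro order_trans[OF pair_bound_long_interval[OF pq(1) G pq(2) F pq(3)]] mult_right_mono) auto
    qed (use X_bound in \<open>simp add: l_def\<close>)
  qed
qed

section \<open>Dyadic ranges of primes and their summation\<close>

text \<open>The limit 2 P + 1 admits odd Q with P = Q div 2; it is at most 3 P, the size allowed in
  the pair bound. In 64, the pairs account for 6 * 10 and the rest covers the diagonal.\<close>

lemma G1_large_sieve_dyadic:
  fixes P Q N :: nat and a :: int
  assumes P: "P \<ge> 1" and N: "N \<ge> 1" and Q: "Q \<le> 2 * P + 1"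
  shows "(\<Sum>q\<in>{q. prime q \<and> P < q \<and> q \<le> Q}. (real q / real (totient q)) *
      (\<Sum>\<xi>\<in>G1 q. (cmod (\<Sum>n\<in>{a..<a + int N}. c n * \<xi> n))\<^sup>2))
    \<le> 64 * log_factor P * sieve_bound N P * (\<Sum>n\<in>{a..<a + int N}. (cmod (c n))\<^sup>2)"
proof -
  define S where "S = {q. prime q \<and> P < q \<and> q \<le> Q}"
  obtain X where X: "X \<ge> 0" "real P ^ 2 * sqrt X \<le> 10 * log_factor P * sieve_bound (real N) (real P)"
    and pair: "\<And>p q F G a. prime p \<Longrightarrow> prime q \<Longrightarrow> p \<noteq> q \<Longrightarrow> P < p \<Longrightarrow> p \<le> 3 * P \<Longrightarrow> P < q \<Longrightarrow> q \<le> 3 * P \<Longrightarrow>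
       twisted q F \<Longrightarrow> twisted p G \<Longrightarrow>
       (cmod (\<Sum>n\<in>{a..<a + int N}. F n * cnj (G n)))\<^sup>2 \<le> X * sqsum q F * sqsum p G"
    using uniform_pair_bound[OF P N] by blast
  define B where "B = real N + 3 * real P + 6 * real P ^ 2 * sqrt X"
  have S_sub: "S \<subseteq> {P<..Q}" by (auto simp: S_def)
  have finS: "finite S" by (rule finite_subset[OF S_sub]) simp
  have S: "\<And>q. q \<in> S \<Longrightarrow> prime q" "\<And>q. q \<in> S \<Longrightarrow> P < q" "\<And>q. q \<in> S \<Longrightarrow> q \<le> 3 * P"
    using Q P by (auto simp: S_def)
  have "card S \<le> card {P<..Q}" by (intro card_mono S_sub) simp
  hence cardS: "card S \<le> 2 * P" using Q P by simp
  have B0: "B \<ge> 0" using X by (simp add: B_def)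
  have "B \<le> 64 * log_factor P * sieve_bound N P"
  proof -
    have l: "log_factor P \<ge> 2" using log_factor_ge P by simp
    have arith: "n + 3 * x \<le> 3 * (A + B + C) \<and> 0 \<le> A + B + C"
      if "n \<le> A" "x \<le> B" "0 \<le> C" "0 \<le> A" "0 \<le> x" for n x A B C :: real
      using that by auto
    have "real N + 3 * real P \<le> 3 * sieve_bound N P \<and> 0 \<le> sieve_bound N P"
      unfolding sieve_bound_def
    proof (rule arith)
      have "real N * 1 \<le> real N * real P powr (1/2)"
        using P by (intro mult_left_mono) (auto simp: ge_one_powr_ge_zero)
      thus "real N \<le> real N * real P powr (1/2)" by simp
      have "1 * real P \<le> real N powr (1/4) * real P ^ 2"
        using P N by (intro mult_mono) (auto simp: ge_one_powr_ge_zero self_le_power)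
      thus "real P \<le> real N powr (1/4) * real P ^ 2" by simp
    qed auto
    hence "real N + 3 * real P \<le> 3 * sieve_bound N P" "0 \<le> sieve_bound N P" by auto
    moreover from this have "1 * sieve_bound N P \<le> log_factor P * sieve_bound N P"
      using l by (intro mult_right_mono) auto
    ultimately show ?thesis using X(2) unfolding B_def by (simp add: mult.assoc)
  qed
  moreover have "(\<Sum>q\<in>S. (real q / real (totient q)) * (\<Sum>\<xi>\<in>G1 q. (cmod (\<Sum>n\<in>{a..<a + int N}. c n * \<xi> n))\<^sup>2))
      \<le> B * (\<Sum>n\<in>{a..<a + int N}. (cmod (c n))\<^sup>2)"
  proof (rule G1_large_sieve_of_dual[OF finS S(1) B0])
    fix G :: "nat \<Rightarrow> int \<Rightarrow> complex" assume "\<And>q. q \<in> S \<Longrightarrow> twisted q (G q)"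
    thus "(\<Sum>n\<in>{a..<a + int N}. (cmod (\<Sum>q\<in>S. G q n))\<^sup>2) \<le> B * (\<Sum>q\<in>S. sqsum q (G q) / real q)"
      unfolding B_def using S pair
      by (intro dual_large_sieve_of_pairs[OF finS S(1) S(3) cardS X(1)]) auto
  qed
  ultimately show ?thesis
    unfolding S_def by (meson mult_right_mono order_trans sum_nonneg zero_le_power2)
qed

text \<open>The smallest exponent of Q in \<open>sieve_bound\<close> is 1/2, and 2^(-1/2) <= 3/4. A
  fixed ratio below 1 makes the dyadic contributions sum geometrically.\<close>

lemma powr_halving_le:
  fixes x y \<alpha> :: real
  assumes "0 \<le> x" "x \<le> y / 2" "1/2 \<le> \<alpha>"
  shows "x powr \<alpha> \<le> 3/4 * y powr \<alpha>"
proof -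
  have "(1/2 :: real) powr \<alpha> \<le> (1/2) powr (1/2)" using assms by (auto intro: powr_mono')
  also have "(1/2 :: real) powr (1/2) = sqrt (1/2)" by (rule powr_half_sqrt) simp
  also have "\<dots> \<le> 3/4" by (rule real_le_lsqrt) (simp_all add: power2_eq_square)
  finally have half: "(1/2 :: real) powr \<alpha> \<le> 3/4" .
  have "x powr \<alpha> \<le> (y * (1/2)) powr \<alpha>" using assms by (intro powr_mono2) auto
  also have "\<dots> = y powr \<alpha> * (1/2) powr \<alpha>" by (rule powr_mult)
  also have "\<dots> \<le> y powr \<alpha> * (3/4)" by (rule mult_left_mono[OF half]) simp
  finally show ?thesis by simp
qed

lemma sieve_bound_halving_le:
  assumes "N \<ge> 0" "0 \<le> P" "P \<le> Q / 2"
  shows "sieve_bound N P \<le> 3/4 * sieve_bound N Q"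
proof -
  have "P ^ 2 \<le> (Q / 2) ^ 2" using assms by (intro power_mono) auto
  hence "P ^ 2 \<le> Q ^ 2 / 4" by (simp add: power_divide)
  hence "P ^ 2 \<le> 3/4 * Q ^ 2" using zero_le_power2[of Q] by linarith
  hence "N powr (1/4) * P ^ 2 \<le> N powr (1/4) * (3/4 * Q ^ 2)" by (intro mult_left_mono) auto
  moreover have "N * P powr (1/2) \<le> N * (3/4 * Q powr (1/2))"
    using assms by (intro mult_left_mono powr_halving_le) auto
  moreover have "N powr (3/4) * P powr (11/8) \<le> N powr (3/4) * (3/4 * Q powr (11/8))"
    using assms by (intro mult_left_mono powr_halving_le) auto
  ultimately show ?thesis by (simp add: sieve_bound_def algebra_simps)
qed

lemma log_factor_le_powr:
  assumes "\<epsilon> > 0" "P \<ge> 1"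
  shows "log_factor P \<le> (2 + 2 * 3 powr \<epsilon> / \<epsilon>) * real P powr \<epsilon>"
proof -
  have "ln (3 * real P) \<le> (3 * real P) powr \<epsilon> / \<epsilon>"
    using assms by (intro ln_powr_bound) auto
  also have "\<dots> = 3 powr \<epsilon> / \<epsilon> * real P powr \<epsilon>" using assms by (simp add: powr_mult)
  finally have "2 * ln (3 * real P) \<le> 2 * 3 powr \<epsilon> / \<epsilon> * real P powr \<epsilon>" by simp
  moreover have "1 \<le> real P powr \<epsilon>" using assms by (intro ge_one_powr_ge_zero) auto
  ultimately show ?thesis by (simp add: log_factor_def distrib_right)
qed

text \<open>Induction from Q div 2 to Q. The constant reproduces itself: the old 192 and the new 64
  add to 256, and halving Q gains 3/4, which returns 192. The summation over dyadic ranges thus adds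
  no further logarithm.\<close>

lemma G1_large_sieve:
  fixes \<epsilon> :: real and Q N :: nat and a :: int
  defines "K \<equiv> 2 + 2 * 3 powr \<epsilon> / \<epsilon>"
  assumes \<epsilon>: "\<epsilon> > 0" and N: "N \<ge> 1"
  shows "(\<Sum>q\<in>{q. prime q \<and> q \<le> Q}. (real q / real (totient q)) *
      (\<Sum>\<xi>\<in>G1 q. (cmod (\<Sum>n\<in>{a..<a + int N}. c n * \<xi> n))\<^sup>2))
    \<le> 192 * K * real Q powr \<epsilon> * sieve_bound N Q * (\<Sum>n\<in>{a..<a + int N}. (cmod (c n))\<^sup>2)"
proof (induction Q rule: less_induct)
  case (less Q)
  define f where "f = (\<lambda>q. (real q / real (totient q)) *
      (\<Sum>\<xi>\<in>G1 q. (cmod (\<Sum>n\<in>{a..<a + int N}. c n * \<xi> n))\<^sup>2))"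
  define Z where "Z = (\<Sum>n\<in>{a..<a + int N}. (cmod (c n))\<^sup>2)"
  have Z0: "Z \<ge> 0" by (simp add: Z_def sum_nonneg)
  have K0: "K \<ge> 0" using \<epsilon> by (simp add: K_def)
  have sb0: "sieve_bound (real N) (real Q) \<ge> 0" for Q :: nat by (simp add: sieve_bound_def)
  show ?case
  proof (cases "Q < 2")
    case True
    hence empty: "{q. prime q \<and> q \<le> Q} = {}" by (auto dest: prime_ge_2_nat)
    have "0 \<le> 192 * K * real Q powr \<epsilon> * sieve_bound N Q * Z"
      using K0 sb0[of Q] Z0 by simp
    thus ?thesis unfolding empty Z_def by simp
  next
    case False
    define P where "P = Q div 2"
    have P: "P \<ge> 1" "Q \<le> 2 * P + 1" "P < Q" "real P \<le> real Q / 2" using False by (auto simp: P_def)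
    have "{q. prime q \<and> q \<le> Q} = {q. prime q \<and> q \<le> P} \<union> {q. prime q \<and> P < q \<and> q \<le> Q}"
      using P by auto
    moreover have "finite {q. prime q \<and> q \<le> P}" "finite {q. prime q \<and> P < q \<and> q \<le> Q}"
      by (rule finite_subset[of _ "{..Q}"]; use P in auto)+
    ultimately have "(\<Sum>q\<in>{q. prime q \<and> q \<le> Q}. f q) =
        (\<Sum>q\<in>{q. prime q \<and> q \<le> P}. f q) + (\<Sum>q\<in>{q. prime q \<and> P < q \<and> q \<le> Q}. f q)"
      by (simp only:) (rule sum.union_disjoint, auto)
    also have "(\<Sum>q\<in>{q. prime q \<and> q \<le> P}. f q) \<le> 192 * K * real P powr \<epsilon> * sieve_bound N P * Z"
      unfolding f_def Z_def by (rule less[OF P(3)])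
    also have "(\<Sum>q\<in>{q. prime q \<and> P < q \<and> q \<le> Q}. f q) \<le> 64 * log_factor P * sieve_bound N P * Z"
      unfolding f_def Z_def by (rule G1_large_sieve_dyadic[OF P(1) N P(2)])
    also have "\<dots> \<le> 64 * (K * real P powr \<epsilon>) * sieve_bound N P * Z"
      using log_factor_le_powr[OF \<epsilon> P(1)] sb0[of P] Z0
      by (intro mult_right_mono mult_left_mono) (auto simp: K_def)
    also have "192 * K * real P powr \<epsilon> * sieve_bound N P * Z + 64 * (K * real P powr \<epsilon>) * sieve_bound N P * Z =
        256 * K * (real P powr \<epsilon> * sieve_bound N P) * Z"
      by (simp add: algebra_simps)
    also have "\<dots> \<le> 256 * K * (real Q powr \<epsilon> * (3/4 * sieve_bound N Q)) * Z"
      using K0 Z0 sb0[of P] P \<epsilon>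
      by (intro mult_right_mono mult_left_mono mult_mono powr_mono2 sieve_bound_halving_le) auto
    also have "\<dots> = 192 * K * real Q powr \<epsilon> * sieve_bound N Q * Z" by simp
    finally show ?thesis by (simp only: f_def Z_def)
  qed
qed

theorem theorem3:
  fixes \<epsilon> :: real
  assumes "\<epsilon> > 0"
  shows "\<exists>C>0. \<forall>(Q::nat) (N::nat) (M::int) (a::int \<Rightarrow> complex).
    (\<Sum>q\<in>{q. prime q \<and> q \<le> Q}. (real q / real (totient q)) *
        (\<Sum>\<xi>\<in>G1 q. (cmod (\<Sum>n\<in>{M+1..M+int N}. a n * \<xi> n))\<^sup>2))
    \<le> C * real Q powr \<epsilon> *
       (real N * real Q powr (1/2) + real N powr (1/4) * real Q ^ 2
        + real N powr (3/4) * real Q powr (11/8))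
       * (\<Sum>n\<in>{M+1..M+int N}. (cmod (a n))\<^sup>2)"
proof (intro exI conjI allI)
  show "192 * (2 + 2 * 3 powr \<epsilon> / \<epsilon>) > 0" using assms by (simp add: add_pos_nonneg)
  fix Q N :: nat and M :: int and a :: "int \<Rightarrow> complex"
  show "(\<Sum>q\<in>{q. prime q \<and> q \<le> Q}. (real q / real (totient q)) *
        (\<Sum>\<xi>\<in>G1 q. (cmod (\<Sum>n\<in>{M+1..M+int N}. a n * \<xi> n))\<^sup>2))
    \<le> 192 * (2 + 2 * 3 powr \<epsilon> / \<epsilon>) * real Q powr \<epsilon> *
       (real N * real Q powr (1/2) + real N powr (1/4) * real Q ^ 2
        + real N powr (3/4) * real Q powr (11/8))
       * (\<Sum>n\<in>{M+1..M+int N}. (cmod (a n))\<^sup>2)"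
  proof (cases "N = 0")
    case False
    have "{M+1..M+int N} = {M+1..<(M+1) + int N}" by auto
    thus ?thesis
      using G1_large_sieve[OF assms, of N a "M + 1" Q] False unfolding sieve_bound_def by simp
  qed simp
qed



end
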